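(* Let $P_t$ denote the transition semigroup and $\pi$ the unique invariant probability measure of the process under consideration (processes defined in the context). (i) For the instantaneous linear process with $\omega>0$, $v>c>0$, for all $(x,\sigma)\in E$, $$\frac12\,\omega\frac{c^2}{v^2}\le\liminf_{t\to+\infty}-\frac1t\log\left\Vert\delta_{(x,\sigma)}P_t-\pi\right\Vert_{\mathrm{TV}}\le\limsup_{t\to+\infty}-\frac1t\log\left\Vert\delta_{(x,\sigma)}P_t-\pi\right\Vert_{\mathrm{TV}}\le4\omega\frac{c^2}{v^2}.$$ (ii) For the finite linear process with $\alpha,\beta>0$, $v>c>0$, for all $(x,\sigma)\in E$, $$\frac{3-\sqrt5}8\min\left(\alpha\left(1+\frac\alpha\beta\right)\frac{c^2}{v^2},\ \alpha\frac cv\right)\le\liminf_{t\to+\infty}-\frac1t\log\left\Vert\delta_{(x,\sigma)}P_t-\pi\right\Vert_{\mathrm{TV}}\le\limsup_{t\to+\infty}-\frac1t\log\left\Vert\delta_{(x,\sigma)}P_t-\pi\right\Vert_{\mathrm{TV}}\le4\alpha\left(1+\frac\alpha\beta\right)\frac{c^2}{v^2}.$$ (iii) For the instantaneous harmonic process with $\omega,\mu,v>0$, for all $p\ge1$ and all $(x,\sigma)\in E$, $$\min\left(\mu,\frac\omega p\right)\le\liminf_{t\to+\infty}-\frac1t\log\mathcal W_p\left(\delta_{(x,\sigma)}P_t,\pi\right).$$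
   Context: **Processes.** Each process is $X(t)=(x(t),\sigma(t))$ with state space $E=[0,+\infty)\times\Sigma$. Here $\sigma(t)$ is a $\Sigma$-valued Markov jump process with jump times $0=T_0<T_1<\cdots$ ($\sigma(T_n+)$ is the value of $\sigma$ on $(T_n,T_{n+1})$), and $x(t)$ is built recursively and continuously by $x(t)=\max\left[0,\phi^{\sigma(T_n+)}_{t-T_n}(x(T_n))\right]$ for $t\in[T_n,T_{n+1})$. *Instantaneous tumble:* $\Sigma=\{2,0,-2\}$, with jump rates $2\to0$: $2\omega$; $-2\to0$: $2\omega$; $0\to2$: $\omega$; $0\to-2$: $\omega$. *Finite tumble:* $\Sigma=\{2,1,0_\pm,0_0,-1,-2\}$ where $0_\pm$ and $0_0$ both have numerical value $0$; jump rates $2\to1$: $2\alpha$; $1\to2$: $\beta/2$; $1\to0_\pm$: $\beta/2$; $1\to0_0$: $\alpha$; $0_\pm\to1$ and $0_\pm\to-1$: $\alpha$ each; $0_0\to1$ and $0_0\to-1$: $\beta$ each; $-1\to-2$: $\beta/2$; $-1\to0_\pm$: $\beta/2$; $-1\to0_0$: $\alpha$; $-2\to-1$: $2\alpha$. *Linear potential* $V(x)=c|x|$: $\phi^\sigma_t(x)=x+(v\sigma-2c)t$. *Harmonic potential* $V(x)=\frac\mu2x^2$: $\phi^\sigma_t(x)=\frac{v\sigma}{2\mu}+e^{-2\mu t}\left(x-\frac{v\sigma}{2\mu}\right)$. The instantaneous linear (resp. finite linear, resp. instantaneous harmonic) process uses the instantaneous tumble with the linear potential (resp. finite tumble with linear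 potential, resp. instantaneous tumble with harmonic potential). $\delta_{(x,\sigma)}P_t$ is the law of $X(t)$ started from $(x,\sigma)$. **Distances.** The total variation distance is $$\Vert\eta-\tilde\eta\Vert_{\mathrm{TV}}=\inf\left\{\mathbb P((x,\sigma)\ne(\tilde x,\tilde\sigma)):(x,\sigma)\sim\eta,\ (\tilde x,\tilde\sigma)\sim\tilde\eta\right\}.$$ For probabilities $\eta,\tilde\eta$ on $E$ whose $x$-marginals have a finite moment of order $p$, $$\mathcal W_p(\eta,\tilde\eta)=\inf\left\{\left(\mathbb E|x-\tilde x|^p\right)^{1/p}+\mathbb P(\sigma\ne\tilde\sigma):(x,\sigma)\sim\eta,\ (\tilde x,\tilde\sigma)\sim\tilde\eta\right\}.$$ Both infima are over all couplings. *)

theory Defs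
  imports "HOL-Probability.Probability"
begin

section \<open>Markov jump processes\<close>

text \<open>
  A Markov jump process on a finite type, given by its off-diagonal jump rates \<open>q s s'\<close>
  (with \<open>q s s = 0\<close>), is realised by its jump chain and its holding times on a canonical sample
  space: \<open>noise n s\<close> is the pair (holding time, next state) that is used if the process enters its
  \<open>n\<close>-th state and this state is \<open>s\<close>. All these pairs are independent; the holding time is
  exponential with parameter \<open>exit_rate q s\<close>, and is independent of the next state, which is \<open>s'\<close>
  with probability \<open>q s s' / exit_rate q s\<close>. None of the states below is absorbing.
\<close>

definition exit_rate :: "('s::finite \<Rightarrow> 's \<Rightarrow> real) \<Rightarrow> 's \<Rightarrow> real" where
  "exit_rate q s = (\<Sum>s'\<in>UNIV. q s s')"

definition next_state :: "('s::finite \<Rightarrow> 's \<Rightarrow> real) \<Rightarrow> 's \<Rightarrow> 's pmf" where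
  "next_state q s = embed_pmf (\<lambda>s'. q s s' / exit_rate q s)"

type_synonym 's noise = "nat \<Rightarrow> 's \<Rightarrow> real \<times> 's"

definition noise_measure :: "('s::finite \<Rightarrow> 's \<Rightarrow> real) \<Rightarrow> 's noise measure" where
  "noise_measure q =
    (\<Pi>\<^sub>M n\<in>UNIV. \<Pi>\<^sub>M s\<in>UNIV.
       density lborel (exponential_density (exit_rate q s)) \<Otimes>\<^sub>M measure_pmf (next_state q s))"

fun jump_state :: "'s \<Rightarrow> 's noise \<Rightarrow> nat \<Rightarrow> 's" where
  "jump_state s0 w 0 = s0"
| "jump_state s0 w (Suc n) = snd (w n (jump_state s0 w n))"

fun jump_time :: "'s \<Rightarrow> 's noise \<Rightarrow> nat \<Rightarrow> real" where
  "jump_time s0 w 0 = 0"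
| "jump_time s0 w (Suc n) = jump_time s0 w n + fst (w n (jump_state s0 w n))"

text \<open>
  Almost surely, \<open>jump_index s0 w t\<close> is the \<open>n\<close> with
  \<open>jump_time s0 w n \<le> t < jump_time s0 w (Suc n)\<close>.
\<close>

definition jump_index :: "'s \<Rightarrow> 's noise \<Rightarrow> real \<Rightarrow> nat" where
  "jump_index s0 w t = (LEAST n. t < jump_time s0 w (Suc n))"


section \<open>The position driven by the jump process\<close>

text \<open>
  A flow is a function \<open>\<phi>\<close> such that \<open>\<phi> s t x\<close> is the unreflected position after time \<open>t\<close> when
  starting from \<open>x\<close> in state \<open>s\<close>. The function \<open>jump_pos\<close> gives the position at jump times.
\<close>

fun jump_pos :: "('s \<Rightarrow> real \<Rightarrow> real \<Rightarrow> real) \<Rightarrow> real \<Rightarrow> 's \<Rightarrow> 's noise \<Rightarrow> nat \<Rightarrow> real" where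
  "jump_pos \<phi> x0 s0 w 0 = x0"
| "jump_pos \<phi> x0 s0 w (Suc n) =
     max 0 (\<phi> (jump_state s0 w n) (jump_time s0 w (Suc n) - jump_time s0 w n)
              (jump_pos \<phi> x0 s0 w n))"

definition process ::
  "('s \<Rightarrow> real \<Rightarrow> real \<Rightarrow> real) \<Rightarrow> real \<times> 's \<Rightarrow> real \<Rightarrow> 's noise \<Rightarrow> real \<times> 's" where
  "process \<phi> z t w =
    (let x0 = fst z; s0 = snd z; n = jump_index s0 w t
     in (max 0 (\<phi> (jump_state s0 w n) (t - jump_time s0 w n) (jump_pos \<phi> x0 s0 w n)),
         jump_state s0 w n))"

text \<open>The state space \<open>[0, \<infinity>) \<times> \<Sigma>\<close>, with \<open>\<Sigma>\<close> the whole type \<open>'s\<close>.\<close>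

definition E_space :: "(real \<times> 's) measure" where
  "E_space = restrict_space borel {0..} \<Otimes>\<^sub>M count_space UNIV"

definition transition ::
  "('s::finite \<Rightarrow> 's \<Rightarrow> real) \<Rightarrow> ('s \<Rightarrow> real \<Rightarrow> real \<Rightarrow> real) \<Rightarrow>
   real \<Rightarrow> real \<times> 's \<Rightarrow> (real \<times> 's) measure" where
  "transition q \<phi> t z = distr (noise_measure q) E_space (process \<phi> z t)"

definition invariant_prob ::
  "(real \<Rightarrow> real \<times> 's \<Rightarrow> (real \<times> 's) measure) \<Rightarrow> (real \<times> 's) measure \<Rightarrow> bool" where
  "invariant_prob P \<pi> \<longleftrightarrow>
     prob_space \<pi> \<and> sets \<pi> = sets E_space \<and> (\<forall>t\<ge>0. (\<pi> \<bind> P t) = \<pi>)"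


section \<open>The two tumbling mechanisms and the two potentials\<close>

datatype inst_state = Inst_Plus2 | Inst_Zero | Inst_Minus2

datatype fin_state =
  Fin_Plus2 | Fin_Plus1 | Fin_Zero_PM | Fin_Zero_Zero | Fin_Minus1 | Fin_Minus2

instance inst_state :: finite
proof
  have "UNIV = {Inst_Plus2, Inst_Zero, Inst_Minus2}"
    using inst_state.exhaust by blast
  then show "finite (UNIV :: inst_state set)"
    by (metis finite.emptyI finite.insertI)
qed

instance fin_state :: finite
proof
  have "UNIV = {Fin_Plus2, Fin_Plus1, Fin_Zero_PM, Fin_Zero_Zero, Fin_Minus1, Fin_Minus2}"
    using fin_state.exhaust by blast
  then show "finite (UNIV :: fin_state set)"
    by (metis finite.emptyI finite.insertI)
qed

fun inst_value :: "inst_state \<Rightarrow> real" where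
  "inst_value Inst_Plus2 = 2"
| "inst_value Inst_Zero = 0"
| "inst_value Inst_Minus2 = -2"

fun fin_value :: "fin_state \<Rightarrow> real" where
  "fin_value Fin_Plus2 = 2"
| "fin_value Fin_Plus1 = 1"
| "fin_value Fin_Zero_PM = 0"
| "fin_value Fin_Zero_Zero = 0"
| "fin_value Fin_Minus1 = -1"
| "fin_value Fin_Minus2 = -2"

fun inst_rate :: "real \<Rightarrow> inst_state \<Rightarrow> inst_state \<Rightarrow> real" where
  "inst_rate \<omega> Inst_Plus2 Inst_Zero = 2 * \<omega>"
| "inst_rate \<omega> Inst_Minus2 Inst_Zero = 2 * \<omega>"
| "inst_rate \<omega> Inst_Zero Inst_Plus2 = \<omega>"
| "inst_rate \<omega> Inst_Zero Inst_Minus2 = \<omega>"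
| "inst_rate \<omega> _ _ = 0"

fun fin_rate :: "real \<Rightarrow> real \<Rightarrow> fin_state \<Rightarrow> fin_state \<Rightarrow> real" where
  "fin_rate \<alpha> \<beta> Fin_Plus2 Fin_Plus1 = 2 * \<alpha>"
| "fin_rate \<alpha> \<beta> Fin_Plus1 Fin_Plus2 = \<beta> / 2"
| "fin_rate \<alpha> \<beta> Fin_Plus1 Fin_Zero_PM = \<beta> / 2"
| "fin_rate \<alpha> \<beta> Fin_Plus1 Fin_Zero_Zero = \<alpha>"
| "fin_rate \<alpha> \<beta> Fin_Zero_PM Fin_Plus1 = \<alpha>"
| "fin_rate \<alpha> \<beta> Fin_Zero_PM Fin_Minus1 = \<alpha>"
| "fin_rate \<alpha> \<beta> Fin_Zero_Zero Fin_Plus1 = \<beta>"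
| "fin_rate \<alpha> \<beta> Fin_Zero_Zero Fin_Minus1 = \<beta>"
| "fin_rate \<alpha> \<beta> Fin_Minus1 Fin_Minus2 = \<beta> / 2"
| "fin_rate \<alpha> \<beta> Fin_Minus1 Fin_Zero_PM = \<beta> / 2"
| "fin_rate \<alpha> \<beta> Fin_Minus1 Fin_Zero_Zero = \<alpha>"
| "fin_rate \<alpha> \<beta> Fin_Minus2 Fin_Minus1 = 2 * \<alpha>"
| "fin_rate \<alpha> \<beta> _ _ = 0"

definition linear_flow :: "real \<Rightarrow> real \<Rightarrow> real \<Rightarrow> real \<Rightarrow> real \<Rightarrow> real" where
  "linear_flow v c a t x = x + (v * a - 2 * c) * t"

definition harmonic_flow :: "real \<Rightarrow> real \<Rightarrow> real \<Rightarrow> real \<Rightarrow> real \<Rightarrow> real" where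
  "harmonic_flow v \<mu> a t x = v * a / (2 * \<mu>) + exp (- 2 * \<mu> * t) * (x - v * a / (2 * \<mu>))"

definition inst_linear ::
  "real \<Rightarrow> real \<Rightarrow> real \<Rightarrow> real \<Rightarrow> real \<times> inst_state \<Rightarrow> (real \<times> inst_state) measure" where
  "inst_linear \<omega> v c = transition (inst_rate \<omega>) (\<lambda>s. linear_flow v c (inst_value s))"

definition fin_linear ::
  "real \<Rightarrow> real \<Rightarrow> real \<Rightarrow> real \<Rightarrow> real \<Rightarrow> real \<times> fin_state \<Rightarrow> (real \<times> fin_state) measure" where
  "fin_linear \<alpha> \<beta> v c = transition (fin_rate \<alpha> \<beta>) (\<lambda>s. linear_flow v c (fin_value s))"

definition inst_harmonic ::
  "real \<Rightarrow> real \<Rightarrow> real \<Rightarrow> real \<Rightarrow> real \<times> inst_state \<Rightarrow> (real \<times> inst_state) measure" where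
  "inst_harmonic \<omega> v \<mu> = transition (inst_rate \<omega>) (\<lambda>s. harmonic_flow v \<mu> (inst_value s))"


section \<open>Distances\<close>

definition couplings :: "'a measure \<Rightarrow> 'a measure \<Rightarrow> ('a \<times> 'a) measure set" where
  "couplings \<eta> \<eta>' =
    {\<Gamma>. prob_space \<Gamma> \<and> sets \<Gamma> = sets (\<eta> \<Otimes>\<^sub>M \<eta>') \<and> distr \<Gamma> \<eta> fst = \<eta> \<and> distr \<Gamma> \<eta>' snd = \<eta>'}"

definition tv_dist :: "'a measure \<Rightarrow> 'a measure \<Rightarrow> real" where
  "tv_dist \<eta> \<eta>' = (INF \<Gamma>\<in>couplings \<eta> \<eta>'. measure \<Gamma> {u \<in> space \<Gamma>. fst u \<noteq> snd u})"

text \<open>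
  For laws with finite moments of order \<open>p\<close>, the integrability condition below holds for every
  coupling. It only prevents the Bochner integral of a non-integrable function from being read as 0.
\<close>

definition wasserstein :: "real \<Rightarrow> (real \<times> 's) measure \<Rightarrow> (real \<times> 's) measure \<Rightarrow> real" where
  "wasserstein p \<eta> \<eta>' =
    (INF \<Gamma>\<in>{\<Gamma> \<in> couplings \<eta> \<eta>'. integrable \<Gamma> (\<lambda>u. \<bar>fst (fst u) - fst (snd u)\<bar> powr p)}.
       (\<integral>u. \<bar>fst (fst u) - fst (snd u)\<bar> powr p \<partial>\<Gamma>) powr (1 / p)
       + measure \<Gamma> {u \<in> space \<Gamma>. snd (fst u) \<noteq> snd (snd u)})"

text \<open>The logarithm on \<open>[0, \<infinity>)\<close> with the convention \<open>log 0 = -\<infinity>\<close>, unlike \<^term>\<open>ln (0::real) = 0\<close>.\<close>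

definition log_ext :: "real \<Rightarrow> ereal" where
  "log_ext y = (if 0 < y then ereal (ln y) else - \<infinity>)"

end

theory Submission
  imports Defs "HOL-Real_Asymp.Real_Asymp"
begin

text \<open>
  Conditioning on the first jump gives a renewal equation for the semigroup, and a sub- and a
  supersolution of it are ordered. Every estimate is obtained by exhibiting explicit
  sub- or supersolutions, mostly of the form \<open>exp (\<Lambda> t) exp (\<theta> x) f \<sigma>\<close>.

  Upper bounds on the distance: the internal state relaxes at the spectral gap of its generator,
  so at time \<open>t / 2\<close> the two internal states can be coupled; from then on both copies use the same
  noise. In the linear potential they merge when the upper copy hits \<open>0\<close>, whose time has an
  exponential moment; in the harmonic potential the flow contracts.

  Lower bounds: if \<open>\<pi> (x > z) \<ge> const exp (- \<theta>1 z)\<close> while the process started at a point exceeds \<open>y t\<close>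
  at time \<open>t\<close> with probability at most \<open>exp (\<Lambda>2 t - \<theta>2 y t)\<close> up to polynomial factors, then the total
  variation distance is at least of order \<open>exp (- \<theta>1 y t)\<close> as soon as \<open>\<Lambda>2 < y (\<theta>2 - \<theta>1)\<close>.
\<close>

subsection \<open>First-jump decomposition\<close>

text \<open>The functions exp (\<theta> x) f do not satisfy the boundary condition at 0. In the
  renewal equation a candidate is only differentiated along the unreflected flow between two jumps,
  and reflection enters through the inequality exp (\<theta> max 0 x) \<ge> exp (\<theta> x). This
  helps subsolutions; supersolutions either never meet the boundary (two copies that are still
  apart) or pay a source term. The measure \<pi> is known only through its invariance: its moments
  and tails come from integrating semigroup inequalities for bounded test functions against it,
  since finiteness of the unbounded integrals is part of what is to be shown. Splitting the time
  into halves is the origin of \<gamma> / 2, \<rho> / 2 and \<kappa> / 2 in the rates; in the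
  Wasserstein distance the failure probability also passes through a p-th root. For the upper rate B
  the level is y = B / \<theta>1, so that all freedom in \<theta>1, \<theta>2 is spent on one strict
  inequality, a condition on derivatives at the point where the eigenvalue vanishes.\<close>

locale jump_flow =
  fixes q :: "'s::finite \<Rightarrow> 's \<Rightarrow> real" and \<phi> :: "'s \<Rightarrow> real \<Rightarrow> real \<Rightarrow> real"
  assumes q_nonneg: "0 \<le> q s s'"
    and exit_pos: "0 < exit_rate q s"
    and flow_measurable: "(\<lambda>p. \<phi> s (fst p) (snd p)) \<in> borel_measurable (borel \<Otimes>\<^sub>M borel)"
    and flow_add: "0 \<le> x \<Longrightarrow> 0 \<le> r \<Longrightarrow> 0 \<le> t \<Longrightarrow> max 0 (\<phi> s t (max 0 (\<phi> s r x))) = max 0 (\<phi> s (r + t) x)"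
begin

abbreviation N :: "'s noise measure" where
  "N \<equiv> noise_measure q"

abbreviation H :: "'s \<Rightarrow> (real \<times> 's) measure" where
  "H s \<equiv> density lborel (exponential_density (exit_rate q s)) \<Otimes>\<^sub>M measure_pmf (next_state q s)"

text \<open>Only the end point of the free flow is reflected. By \<open>flow_add\<close> this is
  still a semigroup in time on [0, \<infinity>), so that a path may be cut at any instant between
  two jumps; the Markov property rests on this.\<close>

definition \<Phi> :: "'s \<Rightarrow> real \<Rightarrow> real \<Rightarrow> real" where
  "\<Phi> s t x = max 0 (\<phi> s t x)"

lemma \<Phi>_nonneg [simp]: "0 \<le> \<Phi> s t x"
  by (simp add: \<Phi>_def)

lemma measurable_\<Phi> [measurable (raw)]:
  assumes "f \<in> borel_measurable M" "g \<in> borel_measurable M"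
  shows "(\<lambda>w. \<Phi> s (f w) (g w)) \<in> borel_measurable M"
proof -
  have "(\<lambda>w. (f w, g w)) \<in> M \<rightarrow>\<^sub>M borel \<Otimes>\<^sub>M borel"
    using assms by measurable
  from measurable_compose[OF this flow_measurable[of s]]
  have "(\<lambda>w. \<phi> s (f w) (g w)) \<in> borel_measurable M" by simp
  then show ?thesis
    unfolding \<Phi>_def by measurable
qed

lemma prob_space_H: "prob_space (H s)"
proof -
  interpret A: prob_space "density lborel (exponential_density (exit_rate q s))"
    using prob_space_exponential_density[OF exit_pos] .
  interpret B: prob_space "measure_pmf (next_state q s)"
    by (rule measure_pmf.prob_space_axioms)
  interpret pair_prob_space "density lborel (exponential_density (exit_rate q s))" "measure_pmf (next_state q s)" ..
  show ?thesis by (rule prob_space_axioms)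
qed

lemma sets_H [measurable_cong, simp]: "sets (H s) = sets (borel \<Otimes>\<^sub>M count_space UNIV)"
  by (intro sets_pair_measure_cong) simp_all

lemma space_H [simp]: "space (H s) = UNIV"
  by (simp add: space_pair_measure)

abbreviation HH :: "('s \<Rightarrow> real \<times> 's) measure" where
  "HH \<equiv> \<Pi>\<^sub>M s\<in>UNIV. H s"

lemma prob_space_HH: "prob_space HH"
  by (intro prob_space_PiM prob_space_H)

lemma N_eq: "N = (\<Pi>\<^sub>M n\<in>UNIV. HH)"
  by (simp add: noise_measure_def)

lemma prob_space_N: "prob_space N"
  unfolding N_eq by (intro prob_space_PiM prob_space_HH)

lemma space_N [simp]: "space N = UNIV"
  unfolding N_eq by (simp add: space_PiM)

sublocale N: prob_space N
  by (rule prob_space_N)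

lemma sets_N [measurable_cong]: "sets N = sets (\<Pi>\<^sub>M n\<in>(UNIV::nat set). \<Pi>\<^sub>M s\<in>(UNIV::'s set). (borel \<Otimes>\<^sub>M count_space UNIV :: (real \<times> 's) measure))"
  unfolding N_eq by (intro sets_PiM_cong refl sets_H)

lemma measurable_noise: "(\<lambda>w. w n s) \<in> N \<rightarrow>\<^sub>M borel \<Otimes>\<^sub>M count_space UNIV"
proof -
  have "(\<lambda>w. w n) \<in> N \<rightarrow>\<^sub>M (\<Pi>\<^sub>M s\<in>(UNIV::'s set). (borel \<Otimes>\<^sub>M count_space UNIV :: (real \<times> 's) measure))"
    unfolding measurable_cong_sets[OF sets_N refl]
    by (rule measurable_component_singleton) simp
  from measurable_compose[OF this measurable_component_singleton[of s]] show ?thesis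
    by simp
qed

lemma measurable_shift: "(\<lambda>w n. w (Suc n)) \<in> N \<rightarrow>\<^sub>M N"
proof -
  have "(\<lambda>w n. w (Suc n)) \<in> (\<Pi>\<^sub>M n\<in>(UNIV::nat set). HH) \<rightarrow>\<^sub>M (\<Pi>\<^sub>M n\<in>(UNIV::nat set). HH)"
    by (rule measurable_PiM_single') (auto intro!: measurable_component_singleton simp: space_PiM PiE_iff extensional_def)
  then show ?thesis unfolding N_eq .
qed

text \<open>The noise is a product over time steps, so the first step is independent of the shifted
  noise, which has the law of the whole. Of the first step only the coordinate of the current state
  \<open>s\<close> is read; the other coordinates integrate out.\<close>

lemma first_step:
  assumes F [measurable]: "F \<in> borel_measurable ((borel \<Otimes>\<^sub>M count_space UNIV) \<Otimes>\<^sub>M N)"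
  shows "(\<integral>\<^sup>+w. F (w 0 s, \<lambda>n. w (Suc n)) \<partial>N) = (\<integral>\<^sup>+a. \<integral>\<^sup>+w. F (a, w) \<partial>N \<partial>H s)"
proof -
  note measurable_noise [measurable] measurable_shift [measurable]
  interpret HH: prob_space HH by (rule prob_space_HH)
  interpret sequence_space HH
    by unfold_locales
  have N': "N = S" unfolding N_eq ..
  have iter: "distr (HH \<Otimes>\<^sub>M N) N (\<lambda>(m, w). case_nat m w) = N"
    unfolding N' by (rule PiM_iter)
  have cn: "(\<lambda>(m, w). case_nat m w) \<in> HH \<Otimes>\<^sub>M N \<rightarrow>\<^sub>M N"
    unfolding N' case_prod_beta' by (rule measurable_case_nat') (rule measurable_fst, rule measurable_snd)
  have Fm: "(\<lambda>w. F (w 0 s, \<lambda>n. w (Suc n))) \<in> borel_measurable N"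
    by measurable
  have ms: "(\<lambda>m. m s) \<in> HH \<rightarrow>\<^sub>M H s"
    by (rule measurable_component_singleton) simp
  have ms' [measurable]: "(\<lambda>m. m s) \<in> HH \<rightarrow>\<^sub>M borel \<Otimes>\<^sub>M count_space UNIV"
    using ms measurable_cong_sets[OF refl[of "sets HH"] sets_H[of s]] by blast
  have "(\<integral>\<^sup>+w. F (w 0 s, \<lambda>n. w (Suc n)) \<partial>N)
      = (\<integral>\<^sup>+w. F (w 0 s, \<lambda>n. w (Suc n)) \<partial>distr (HH \<Otimes>\<^sub>M N) N (\<lambda>(m, w). case_nat m w))"
    by (subst iter) simp
  also have "\<dots> = (\<integral>\<^sup>+(m, w). F (m s, w) \<partial>(HH \<Otimes>\<^sub>M N))"
    by (subst nn_integral_distr[OF cn]) (simp_all add: case_prod_beta' Fm)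
  also have "\<dots> = (\<integral>\<^sup>+m. \<integral>\<^sup>+w. F (m s, w) \<partial>N \<partial>HH)"
    by (subst N.nn_integral_fst[symmetric]) (simp_all add: case_prod_beta')
  also have "\<dots> = (\<integral>\<^sup>+a. \<integral>\<^sup>+w. F (a, w) \<partial>N \<partial>distr HH (H s) (\<lambda>m. m s))"
    by (subst nn_integral_distr[OF ms]) (simp_all add: measurable_cong_sets[OF sets_H refl])
  also have "distr HH (H s) (\<lambda>m. m s) = H s"
    by (rule distr_PiM_component) (simp_all add: prob_space_H)
  finally show ?thesis .
qed

lemma AE_H_nonneg: "AE a in H s. 0 \<le> fst a"
proof -
  interpret B: prob_space "measure_pmf (next_state q s)"
    by (rule measure_pmf.prob_space_axioms)
  interpret A: prob_space "density lborel (exponential_density (exit_rate q s))"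
    using prob_space_exponential_density[OF exit_pos] .
  interpret pair_prob_space "density lborel (exponential_density (exit_rate q s))" "measure_pmf (next_state q s)" ..
  have "AE x in density lborel (exponential_density (exit_rate q s)). 0 \<le> x"
    by (subst AE_density) (auto simp: exponential_density_def)
  then have "AE x in density lborel (exponential_density (exit_rate q s)). AE y in measure_pmf (next_state q s). 0 \<le> fst (x, y)"
    by auto
  then show ?thesis
  proof (rule AE_pair_measure[rotated])
    have "Measurable.pred (H s) (\<lambda>a. 0 \<le> fst a)"
      unfolding measurable_cong_sets[OF sets_H refl] by measurable
    then show "{a \<in> space (H s). 0 \<le> fst a} \<in> sets (H s)"
      by (simp only: pred_def)
  qed
qed

lemma pmf_next_state: "pmf (next_state q s) s' = q s s' / exit_rate q s"
  unfolding next_state_def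
proof (rule pmf_embed_pmf)
  show "0 \<le> q s x / exit_rate q s" for x
    using q_nonneg[of s x] exit_pos[of s] by simp
  have "(\<integral>\<^sup>+x. ennreal (q s x / exit_rate q s) \<partial>count_space UNIV) = (\<Sum>x\<in>UNIV. ennreal (q s x / exit_rate q s))"
    by (simp add: nn_integral_count_space_finite)
  also have "\<dots> = ennreal (\<Sum>x\<in>UNIV. q s x / exit_rate q s)"
    using q_nonneg exit_pos[of s] by (intro sum_ennreal) simp
  also have "(\<Sum>x\<in>UNIV. q s x / exit_rate q s) = 1"
    using exit_pos[of s] by (simp add: sum_divide_distrib[symmetric] exit_rate_def)
  finally show "(\<integral>\<^sup>+x. ennreal (q s x / exit_rate q s) \<partial>count_space UNIV) = 1" by simp
qed

text \<open>The factor \<open>exit_rate q s\<close> of the exponential density cancels the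
  denominator of the jump probability. What remains is the density exp (- e r) q s s' of a first
  jump at time r that leads to s'.\<close>

lemma nn_integral_H:
  assumes [measurable]: "F \<in> borel_measurable (borel \<Otimes>\<^sub>M count_space UNIV)"
  shows "(\<integral>\<^sup>+a. F a \<partial>H s) =
    (\<integral>\<^sup>+r. (\<Sum>s'\<in>UNIV. ennreal (exp (- exit_rate q s * r) * q s s') * F (r, s')) * indicator {0..} r \<partial>lborel)"
proof -
  let ?e = "exit_rate q s"
  have e: "0 < ?e" by (rule exit_pos)
  have "(\<integral>\<^sup>+a. F a \<partial>H s) = (\<integral>\<^sup>+r. \<integral>\<^sup>+s'. F (r, s') \<partial>measure_pmf (next_state q s) \<partial>density lborel (exponential_density ?e))"
    by (rule measure_pmf.nn_integral_fst[symmetric]) (simp add: measurable_cong_sets[OF sets_H refl])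
  also have "\<dots> = (\<integral>\<^sup>+r. (\<Sum>s'\<in>UNIV. ennreal (q s s' / ?e) * F (r, s')) \<partial>density lborel (exponential_density ?e))"
    by (simp add: nn_integral_measure_pmf nn_integral_count_space_finite pmf_next_state)
  also have "\<dots> = (\<integral>\<^sup>+r. ennreal (exponential_density ?e r) * (\<Sum>s'\<in>UNIV. ennreal (q s s' / ?e) * F (r, s')) \<partial>lborel)"
    by (subst nn_integral_density) simp_all
  also have "\<dots> = (\<integral>\<^sup>+r. (\<Sum>s'\<in>UNIV. ennreal (exp (- ?e * r) * q s s') * F (r, s')) * indicator {0..} r \<partial>lborel)"
  proof (rule nn_integral_cong)
    fix r :: real
    have "ennreal (exponential_density ?e r) * (ennreal (q s s' / ?e) * F (r, s'))
       = ennreal (exp (- ?e * r) * q s s') * F (r, s')" if "0 \<le> r" for s'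
    proof -
      have "ennreal (exponential_density ?e r) * ennreal (q s s' / ?e) = ennreal (exp (- ?e * r) * q s s')"
        using that e q_nonneg[of s s'] by (simp add: exponential_density_def ennreal_mult[symmetric] field_simps)
      then show ?thesis by (simp add: mult.assoc[symmetric])
    qed
    then show "ennreal (exponential_density ?e r) * (\<Sum>s'\<in>UNIV. ennreal (q s s' / ?e) * F (r, s'))
      = (\<Sum>s'\<in>UNIV. ennreal (exp (- ?e * r) * q s s') * F (r, s')) * indicator {0..} r"
      by (auto simp: sum_distrib_left exponential_density_def not_le indicator_def)
  qed
  finally show ?thesis .
qed

lemma emeasure_H_gt:
  assumes "0 \<le> t"
  shows "(\<integral>\<^sup>+a. indicator {t<..} (fst a) \<partial>H s) = ennreal (exp (- exit_rate q s * t))"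
proof -
  let ?e = "exit_rate q s"
  let ?D = "density lborel (exponential_density ?e)"
  have e: "0 < ?e" by (rule exit_pos)
  interpret A: prob_space ?D
    using prob_space_exponential_density[OF e] .
  have dist: "distributed ?D lborel (\<lambda>x. x) (exponential_density ?e)"
    unfolding distributed_def using exponential_density_nonneg[OF e] by (simp add: distr_id2)
  have gt: "emeasure ?D {t<..} = ennreal (exp (- t * ?e))"
    using A.exponential_distributedD_gt[OF dist assms e] by (simp add: A.emeasure_eq_measure greaterThan_def)
  have "(\<integral>\<^sup>+a. indicator {t<..} (fst a) \<partial>H s) = (\<integral>\<^sup>+r. \<integral>\<^sup>+s'. indicator {t<..} r \<partial>measure_pmf (next_state q s) \<partial>?D)"
    by (subst measure_pmf.nn_integral_fst[symmetric]) (simp_all add: measurable_cong_sets[OF sets_H refl])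
  also have "\<dots> = emeasure ?D {t<..}"
    by (simp add: measure_pmf.emeasure_space_1)
  finally show ?thesis using gt by (simp add: mult.commute)
qed

definition exit_max :: real where
  "exit_max = Max (range (exit_rate q))"

lemma exit_le_max: "exit_rate q s \<le> exit_max"
  unfolding exit_max_def by (intro Max_ge) auto


subsection \<open>Comparison of sub- and supersolutions\<close>

text \<open>The right-hand side of the renewal equation over the horizon t: \<open>a\<close> is
  collected when no jump occurs up to t, and \<open>b r s'\<close> when the first jump leads to s'
  at time r.\<close>

lemma nn_integral_H_split:
  fixes b :: "real \<Rightarrow> 's \<Rightarrow> real"
  assumes t: "0 \<le> t" and a: "0 \<le> a" and b: "\<And>r s'. 0 \<le> r \<Longrightarrow> r \<le> t \<Longrightarrow> 0 \<le> b r s'"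
    and b_meas [measurable]: "\<And>s'. (\<lambda>r. b r s') \<in> borel_measurable borel"
  shows "(\<integral>\<^sup>+z. ennreal (if t < fst z then a else b (fst z) (snd z)) \<partial>H s) =
    ennreal (exp (- exit_rate q s * t) * a) +
    (\<integral>\<^sup>+r. ennreal (exp (- exit_rate q s * r) * (\<Sum>s'\<in>UNIV. q s s' * b r s')) * indicator {0..t} r \<partial>lborel)"
proof -
  let ?e = "exit_rate q s"
  have [measurable]: "(\<lambda>z. b (fst z) (snd z)) \<in> borel_measurable (borel \<Otimes>\<^sub>M count_space UNIV)"
    by (rule measurable_compose_countable'[where I = UNIV]) auto
  have "(\<integral>\<^sup>+z. ennreal (if t < fst z then a else b (fst z) (snd z)) \<partial>H s)
    = (\<integral>\<^sup>+z. ennreal a * indicator {t<..} (fst z) + ennreal (b (fst z) (snd z)) * indicator {..t} (fst z) \<partial>H s)"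
    by (intro nn_integral_cong) (auto simp: indicator_def)
  also have "\<dots> = (\<integral>\<^sup>+z. ennreal a * indicator {t<..} (fst z) \<partial>H s) + (\<integral>\<^sup>+z. ennreal (b (fst z) (snd z)) * indicator {..t} (fst z) \<partial>H s)"
    by (rule nn_integral_add) (auto simp: measurable_cong_sets[OF sets_H refl])
  also have "(\<integral>\<^sup>+z. ennreal a * indicator {t<..} (fst z) \<partial>H s) = ennreal (exp (- ?e * t) * a)"
    using a t by (subst nn_integral_cmult)
      (auto simp: measurable_cong_sets[OF sets_H refl] emeasure_H_gt ennreal_mult mult.commute)
  also have "(\<integral>\<^sup>+z. ennreal (b (fst z) (snd z)) * indicator {..t} (fst z) \<partial>H s)
    = (\<integral>\<^sup>+r. ennreal (exp (- ?e * r) * (\<Sum>s'\<in>UNIV. q s s' * b r s')) * indicator {0..t} r \<partial>lborel)"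
  proof (subst nn_integral_H)
    show "(\<lambda>z. ennreal (b (fst z) (snd z)) * indicator {..t} (fst z)) \<in> borel_measurable (borel \<Otimes>\<^sub>M count_space UNIV)"
      by measurable
    show "(\<integral>\<^sup>+ r. (\<Sum>s'\<in>UNIV. ennreal (exp (- ?e * r) * q s s') * (ennreal (b (fst (r, s')) (snd (r, s'))) * indicator {..t} (fst (r, s')))) * indicator {0..} r \<partial>lborel)
      = (\<integral>\<^sup>+r. ennreal (exp (- ?e * r) * (\<Sum>s'\<in>UNIV. q s s' * b r s')) * indicator {0..t} r \<partial>lborel)"
    proof (rule nn_integral_cong)
      fix r :: real
      have "(\<Sum>s'\<in>UNIV. ennreal (exp (- ?e * r) * q s s') * ennreal (b r s'))
        = ennreal (exp (- ?e * r) * (\<Sum>s'\<in>UNIV. q s s' * b r s'))" if "0 \<le> r" "r \<le> t"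
        using q_nonneg b[OF that] by (simp add: ennreal_mult[symmetric] sum_ennreal sum_distrib_left mult.assoc)
      then show "(\<Sum>s'\<in>UNIV. ennreal (exp (- ?e * r) * q s s') * (ennreal (b (fst (r, s')) (snd (r, s'))) * indicator {..t} (fst (r, s')))) * indicator {0..} r
        = ennreal (exp (- ?e * r) * (\<Sum>s'\<in>UNIV. q s s' * b r s')) * indicator {0..t} r"
        by (auto simp: indicator_def)
    qed
  qed
  finally show ?thesis .
qed

text \<open>The integrand is the derivative of - exp (- e r) u r. Hence \<open>u 0\<close> is the
  value of the first-jump formula with final value u t and continuation e u - u';
  \<open>step_le\<close> and \<open>step_ge\<close> move these data in one direction each.\<close>

lemma nn_integral_exp_FTC:
  fixes u u' :: "real \<Rightarrow> real"
  assumes t: "0 \<le> t" and ut: "0 \<le> u t"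
    and [measurable]: "u \<in> borel_measurable borel" "u' \<in> borel_measurable borel"
    and u: "\<And>r. 0 \<le> r \<Longrightarrow> r \<le> t \<Longrightarrow> (u has_real_derivative u' r) (at r)"
    and nn: "\<And>r. 0 \<le> r \<Longrightarrow> r \<le> t \<Longrightarrow> 0 \<le> e * u r - u' r"
  shows "ennreal (exp (- e * t) * u t) +
    (\<integral>\<^sup>+r. ennreal (exp (- e * r) * (e * u r - u' r)) * indicator {0..t} r \<partial>lborel) = ennreal (u 0)"
proof -
  let ?F = "\<lambda>r. - exp (- e * r) * u r"
  have eq: "(\<integral>\<^sup>+r. ennreal (exp (- e * r) * (e * u r - u' r)) * indicator {0..t} r \<partial>lborel) = ennreal (?F t - ?F 0)"
  proof (rule nn_integral_FTC_Icc)
    show "DERIV ?F r :> exp (- e * r) * (e * u r - u' r)" if "r \<in> {0..t}" for r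
      using that by (auto intro!: derivative_eq_intros u simp: algebra_simps)
  qed (use t nn in auto)
  have "0 \<le> ?F t - ?F 0"
  proof -
    have "?F 0 \<le> ?F t"
    proof (rule DERIV_nonneg_imp_nondecreasing[OF t])
      show "\<exists>y. DERIV ?F r :> y \<and> 0 \<le> y" if "0 \<le> r" "r \<le> t" for r
        by (rule exI[of _ "exp (- e * r) * (e * u r - u' r)"])
           (use that nn[of r] in \<open>auto intro!: derivative_eq_intros u simp: algebra_simps\<close>)
    qed
    then show ?thesis by simp
  qed
  then show ?thesis
    unfolding eq using ut by (subst ennreal_plus[symmetric]) auto
qed

text \<open>A pointwise differential inequality becomes an inequality for the renewal operator. In
  the applications u r is the candidate after r units of time on the flow line, with t - r left, and
  the hypothesis on the sum says that time derivative, transport and jumps together have the sign of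
  a supersolution.\<close>

lemma step_le:
  fixes u u' :: "real \<Rightarrow> real" and b :: "real \<Rightarrow> 's \<Rightarrow> real"
  assumes t: "0 \<le> t" and a: "0 \<le> a" "a \<le> u t" and b: "\<And>r s'. 0 \<le> r \<Longrightarrow> r \<le> t \<Longrightarrow> 0 \<le> b r s'"
    and b_meas: "\<And>s'. (\<lambda>r. b r s') \<in> borel_measurable borel"
    and meas: "u \<in> borel_measurable borel" "u' \<in> borel_measurable borel"
    and u: "\<And>r. 0 \<le> r \<Longrightarrow> r \<le> t \<Longrightarrow> (u has_real_derivative u' r) (at r)"
    and le: "\<And>r. 0 \<le> r \<Longrightarrow> r \<le> t \<Longrightarrow> (\<Sum>s'\<in>UNIV. q s s' * b r s') \<le> exit_rate q s * u r - u' r"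
  shows "(\<integral>\<^sup>+z. ennreal (if t < fst z then a else b (fst z) (snd z)) \<partial>H s) \<le> ennreal (u 0)"
proof -
  have eq: "(\<integral>\<^sup>+z. ennreal (if t < fst z then a else b (fst z) (snd z)) \<partial>H s) =
    ennreal (exp (- exit_rate q s * t) * a) +
    (\<integral>\<^sup>+r. ennreal (exp (- exit_rate q s * r) * (\<Sum>s'\<in>UNIV. q s s' * b r s')) * indicator {0..t} r \<partial>lborel)"
    by (rule nn_integral_H_split[OF t a(1) _ b_meas]) (rule b)
  have nn: "0 \<le> (\<Sum>s'\<in>UNIV. q s s' * b r s')" if "0 \<le> r" "r \<le> t" for r
    by (intro sum_nonneg mult_nonneg_nonneg q_nonneg b that)
  have "(\<integral>\<^sup>+z. ennreal (if t < fst z then a else b (fst z) (snd z)) \<partial>H s)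
    \<le> ennreal (exp (- exit_rate q s * t) * u t) +
      (\<integral>\<^sup>+r. ennreal (exp (- exit_rate q s * r) * (exit_rate q s * u r - u' r)) * indicator {0..t} r \<partial>lborel)"
    unfolding eq
  proof (intro add_mono nn_integral_mono ennreal_leI mult_left_mono)
    fix r :: real
    show "ennreal (exp (- exit_rate q s * r) * (\<Sum>s'\<in>UNIV. q s s' * b r s')) * indicator {0..t} r
      \<le> ennreal (exp (- exit_rate q s * r) * (exit_rate q s * u r - u' r)) * indicator {0..t} r"
      using le[of r] by (cases "r \<in> {0..t}") (auto intro!: ennreal_leI mult_left_mono)
  qed (use a in auto)
  also have "\<dots> = ennreal (u 0)"
  proof (rule nn_integral_exp_FTC[OF t _ meas u])
    show "0 \<le> u t" using a by simp
    show "0 \<le> exit_rate q s * u r - u' r" if "0 \<le> r" "r \<le> t" for r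
      using nn[OF that] le[OF that] by linarith
  qed
  finally show ?thesis .
qed

text \<open>Mirror image of \<open>step_le\<close>. There the nonnegativity of e u - u' follows from
  that of the sum, which lies below it; here the sum lies above, so the sign is a hypothesis of its
  own (a negative integrand would be cut off by \<open>ennreal\<close>).\<close>

lemma step_ge:
  fixes u u' :: "real \<Rightarrow> real" and b :: "real \<Rightarrow> 's \<Rightarrow> real"
  assumes t: "0 \<le> t" and a: "0 \<le> u t" "u t \<le> a" and b: "\<And>r s'. 0 \<le> r \<Longrightarrow> r \<le> t \<Longrightarrow> 0 \<le> b r s'"
    and b_meas: "\<And>s'. (\<lambda>r. b r s') \<in> borel_measurable borel"
    and meas: "u \<in> borel_measurable borel" "u' \<in> borel_measurable borel"
    and u: "\<And>r. 0 \<le> r \<Longrightarrow> r \<le> t \<Longrightarrow> (u has_real_derivative u' r) (at r)"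
    and nn: "\<And>r. 0 \<le> r \<Longrightarrow> r \<le> t \<Longrightarrow> 0 \<le> exit_rate q s * u r - u' r"
    and ge: "\<And>r. 0 \<le> r \<Longrightarrow> r \<le> t \<Longrightarrow> exit_rate q s * u r - u' r \<le> (\<Sum>s'\<in>UNIV. q s s' * b r s')"
  shows "ennreal (u 0) \<le> (\<integral>\<^sup>+z. ennreal (if t < fst z then a else b (fst z) (snd z)) \<partial>H s)"
proof -
  have a': "0 \<le> a" using a by simp
  have eq: "(\<integral>\<^sup>+z. ennreal (if t < fst z then a else b (fst z) (snd z)) \<partial>H s) =
    ennreal (exp (- exit_rate q s * t) * a) +
    (\<integral>\<^sup>+r. ennreal (exp (- exit_rate q s * r) * (\<Sum>s'\<in>UNIV. q s s' * b r s')) * indicator {0..t} r \<partial>lborel)"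
    by (rule nn_integral_H_split[OF t a' _ b_meas]) (rule b)
  have "ennreal (u 0) = ennreal (exp (- exit_rate q s * t) * u t) +
      (\<integral>\<^sup>+r. ennreal (exp (- exit_rate q s * r) * (exit_rate q s * u r - u' r)) * indicator {0..t} r \<partial>lborel)"
    by (rule nn_integral_exp_FTC[symmetric, OF t a(1) meas u nn])
  also have "\<dots> \<le> (\<integral>\<^sup>+z. ennreal (if t < fst z then a else b (fst z) (snd z)) \<partial>H s)"
    unfolding eq
  proof (intro add_mono nn_integral_mono ennreal_leI mult_left_mono)
    fix r :: real
    show "ennreal (exp (- exit_rate q s * r) * (exit_rate q s * u r - u' r)) * indicator {0..t} r
      \<le> ennreal (exp (- exit_rate q s * r) * (\<Sum>s'\<in>UNIV. q s s' * b r s')) * indicator {0..t} r"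
      using ge[of r] by (cases "r \<in> {0..t}") (auto intro!: ennreal_leI mult_left_mono)
  qed (use a in auto)
  finally show ?thesis .
qed

lemma emeasure_H_le:
  assumes "0 \<le> t"
  shows "(\<integral>\<^sup>+z. indicator {..t} (fst z) \<partial>H s) \<le> ennreal (1 - exp (- exit_rate q s * t))"
proof -
  have "(\<integral>\<^sup>+z. indicator {..t} (fst z) \<partial>H s) = (\<integral>\<^sup>+z. ennreal (if t < fst z then 0 else 1) \<partial>H s)"
    by (intro nn_integral_cong) (auto simp: indicator_def)
  also have "\<dots> \<le> ennreal (1 - exp (- exit_rate q s * (t - 0)))"
  \<comment> \<open>u r is the probability of a jump within the remaining time t - r; it solves the
    equation with final value 0 and continuation 1.\<close>
  proof (rule step_le[where u = "\<lambda>r. 1 - exp (- exit_rate q s * (t - r))"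
        and u' = "\<lambda>r. - exit_rate q s * exp (- exit_rate q s * (t - r))"])
    show "((\<lambda>r. 1 - exp (- exit_rate q s * (t - r))) has_real_derivative
          - exit_rate q s * exp (- exit_rate q s * (t - r))) (at r)" for r
      by (auto intro!: derivative_eq_intros)
    show "(\<Sum>s'\<in>UNIV. q s s' * 1) \<le> exit_rate q s * (1 - exp (- exit_rate q s * (t - r))) -
        - exit_rate q s * exp (- exit_rate q s * (t - r))" for r
      by (simp add: exit_rate_def algebra_simps)
  qed (use assms in auto)
  finally show ?thesis by simp
qed

text \<open>
  \<open>U\<close> and \<open>V\<close> are a sub- and a supersolution of the renewal equation obtained by conditioning on the
  first jump. If \<open>U \<le> V + K\<close> then \<open>U \<le> V + K (1 - exp (- exit_max T))\<close> up to time \<open>T\<close>, because the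
  error is only inherited when the first jump occurs before \<open>T\<close>.
\<close>

lemma comparison:
  fixes U V :: "real \<Rightarrow> 'p \<Rightarrow> 's \<Rightarrow> ennreal" and \<Theta> :: "'s \<Rightarrow> real \<Rightarrow> 'p \<Rightarrow> 'p" and D :: "real \<Rightarrow> 'p set"
  assumes dom: "\<And>t p s r. p \<in> D t \<Longrightarrow> 0 \<le> r \<Longrightarrow> r \<le> t \<Longrightarrow> \<Theta> s r p \<in> D (t - r)"
    and sub: "\<And>t p s. 0 \<le> t \<Longrightarrow> p \<in> D t \<Longrightarrow>
      U t p s \<le> (\<integral>\<^sup>+z. (if t < fst z then g (\<Theta> s t p) s else U (t - fst z) (\<Theta> s (fst z) p) (snd z)) \<partial>H s)"
    and super: "\<And>t p s. 0 \<le> t \<Longrightarrow> p \<in> D t \<Longrightarrow>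
      (\<integral>\<^sup>+z. (if t < fst z then g (\<Theta> s t p) s else V (t - fst z) (\<Theta> s (fst z) p) (snd z)) \<partial>H s) \<le> V t p s"
    and meas: "\<And>t p s s'. 0 \<le> t \<Longrightarrow> p \<in> D t \<Longrightarrow> (\<lambda>r. V (t - r) (\<Theta> s r p) s') \<in> borel_measurable borel"
    and bounded: "\<And>t p s. 0 \<le> t \<Longrightarrow> p \<in> D t \<Longrightarrow> U t p s \<le> ennreal B"
    and t: "0 \<le> t" and p: "p \<in> D t"
  shows "U t p s \<le> V t p s"
proof -
  have [simp]: "z \<le> t \<longleftrightarrow> \<not> t < z" for z t :: real by auto
  define k where "k = 1 - exp (- exit_max * t)"
  have em: "0 < exit_max" using exit_pos[of undefined] exit_le_max[of undefined] by linarith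
  have "0 \<le> exit_max * t" using em t by (intro mult_nonneg_nonneg) auto
  then have k: "0 \<le> k" "k < 1" by (auto simp: k_def)
  \<comment> \<open>The bound is proved for all horizons up to t at once, since a first jump at time
    r leaves the horizon t' - r. One factor k is gained per round because \<open>k\<close> bounds
    the probability of a jump before t' from every state.\<close>
  have main: "\<forall>t' p s. 0 \<le> t' \<longrightarrow> t' \<le> t \<longrightarrow> p \<in> D t' \<longrightarrow> U t' p s \<le> V t' p s + ennreal (\<bar>B\<bar> * k ^ n)" for n
  proof (induction n)
    case 0
    have "U t' p s \<le> V t' p s + ennreal \<bar>B\<bar>" if "0 \<le> t'" "p \<in> D t'" for t' p s
      using bounded[OF that, of s] by (meson abs_ge_self add_increasing ennreal_leI order_trans zero_le)
    then show ?case by simp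
  next
    case (Suc n)
    show ?case
    proof (intro allI impI)
      fix t' p s assume t': "0 \<le> t'" "t' \<le> t" and p: "p \<in> D t'"
      let ?K = "\<bar>B\<bar> * k ^ n"
      have K: "0 \<le> ?K" using k by (intro mult_nonneg_nonneg zero_le_power) auto
      have [measurable]: "(\<lambda>z. V (t' - fst z) (\<Theta> s (fst z) p) (snd z)) \<in> borel_measurable (borel \<Otimes>\<^sub>M count_space UNIV)"
      proof (rule measurable_compose_countable'[where I = UNIV and g = snd])
        show "(\<lambda>z. V (t' - fst z) (\<Theta> s (fst z) p) i) \<in> borel_measurable (borel \<Otimes>\<^sub>M count_space UNIV)" for i
          by (rule measurable_compose[OF _ meas[OF t'(1) p]]) measurable
      qed auto
      have "U t' p s \<le> (\<integral>\<^sup>+z. (if t' < fst z then g (\<Theta> s t' p) s else U (t' - fst z) (\<Theta> s (fst z) p) (snd z)) \<partial>H s)"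
        by (rule sub[OF t'(1) p])
      also have "\<dots> \<le> (\<integral>\<^sup>+z. (if t' < fst z then g (\<Theta> s t' p) s else V (t' - fst z) (\<Theta> s (fst z) p) (snd z))
          + ennreal ?K * indicator {..t'} (fst z) \<partial>H s)"
      proof (rule nn_integral_mono_AE, rule AE_mp[OF AE_H_nonneg], rule AE_I2, rule impI)
        fix z :: "real \<times> 's" assume z: "0 \<le> fst z"
        show "(if t' < fst z then g (\<Theta> s t' p) s else U (t' - fst z) (\<Theta> s (fst z) p) (snd z))
          \<le> (if t' < fst z then g (\<Theta> s t' p) s else V (t' - fst z) (\<Theta> s (fst z) p) (snd z))
          + ennreal ?K * indicator {..t'} (fst z)"
          using Suc.IH t' z dom[OF p z] by (auto simp: indicator_def)
      qed
      also have "\<dots> = (\<integral>\<^sup>+z. (if t' < fst z then g (\<Theta> s t' p) s else V (t' - fst z) (\<Theta> s (fst z) p) (snd z)) \<partial>H s)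
          + (\<integral>\<^sup>+z. ennreal ?K * indicator {..t'} (fst z) \<partial>H s)"
        by (rule nn_integral_add) (auto simp: measurable_cong_sets[OF sets_H refl])
      also have "\<dots> \<le> V t' p s + ennreal (\<bar>B\<bar> * k ^ Suc n)"
      proof (rule add_mono[OF super[OF t'(1) p]])
        have "(\<integral>\<^sup>+z. ennreal ?K * indicator {..t'} (fst z) \<partial>H s) = ennreal ?K * (\<integral>\<^sup>+z. indicator {..t'} (fst z) \<partial>H s)"
          by (rule nn_integral_cmult) (auto simp: measurable_cong_sets[OF sets_H refl])
        also have "\<dots> \<le> ennreal ?K * ennreal k"
        proof (rule mult_left_mono)
          have "(\<integral>\<^sup>+z. indicator {..t'} (fst z) \<partial>H s) \<le> ennreal (1 - exp (- exit_rate q s * t'))"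
            by (rule emeasure_H_le[OF t'(1)])
          also have "\<dots> \<le> ennreal k"
          proof (rule ennreal_leI)
            have "exit_rate q s * t' \<le> exit_max * t"
              using exit_le_max[of s] t' em exit_pos[of s] by (intro mult_mono) auto
            then show "1 - exp (- exit_rate q s * t') \<le> k" by (simp add: k_def)
          qed
          finally show "(\<integral>\<^sup>+z. indicator {..t'} (fst z) \<partial>H s) \<le> ennreal k" .
        qed simp
        also have "\<dots> = ennreal (\<bar>B\<bar> * k ^ Suc n)"
          using k K by (subst ennreal_mult[symmetric]) (simp_all add: mult_ac)
        finally show "(\<integral>\<^sup>+z. ennreal ?K * indicator {..t'} (fst z) \<partial>H s) \<le> ennreal (\<bar>B\<bar> * k ^ Suc n)" .
      qed
      finally show "U t' p s \<le> V t' p s + ennreal (\<bar>B\<bar> * k ^ Suc n)" .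
    qed
  qed
  have "(\<lambda>n. V t p s + ennreal (\<bar>B\<bar> * k ^ n)) \<longlonglongrightarrow> V t p s + ennreal (\<bar>B\<bar> * 0)"
    using k by (intro tendsto_intros LIMSEQ_realpow_zero) auto
  then show ?thesis
    using main t p by (intro LIMSEQ_le_const[where X = "\<lambda>n. V t p s + ennreal (\<bar>B\<bar> * k ^ n)"]) auto
qed


subsection \<open>The renewal equation\<close>

lemma space_E: "space (E_space :: (real \<times> 's) measure) = {0..} \<times> UNIV"
  by (simp add: E_space_def space_pair_measure space_restrict_space)

lemma jump_state_shift: "jump_state s w (Suc n) = jump_state (snd (w 0 s)) (\<lambda>n. w (Suc n)) n"
  by (induction n) simp_all

lemma jump_time_shift: "jump_time s w (Suc n) = fst (w 0 s) + jump_time (snd (w 0 s)) (\<lambda>n. w (Suc n)) n"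
proof (induction n)
  case (Suc n)
  then show ?case
    using jump_state_shift[of s w n] by (simp del: jump_state.simps)
qed simp

lemma jump_pos_shift:
  "jump_pos \<phi> x s w (Suc n) = jump_pos \<phi> (\<Phi> s (fst (w 0 s)) x) (snd (w 0 s)) (\<lambda>n. w (Suc n)) n"
proof (induction n)
  case 0
  show ?case by (simp add: \<Phi>_def)
next
  case (Suc n)
  have "jump_pos \<phi> x s w (Suc (Suc n)) =
    max 0 (\<phi> (jump_state s w (Suc n)) (jump_time s w (Suc (Suc n)) - jump_time s w (Suc n)) (jump_pos \<phi> x s w (Suc n)))"
    by (rule jump_pos.simps)
  also have "\<dots> = jump_pos \<phi> (\<Phi> s (fst (w 0 s)) x) (snd (w 0 s)) (\<lambda>n. w (Suc n)) (Suc n)"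
    unfolding Suc jump_time_shift[of s w n] jump_time_shift[of s w "Suc n"] jump_state_shift[of s w n]
      jump_pos.simps(2)[of \<phi> "\<Phi> s (fst (w 0 s)) x"] add_diff_cancel_left ..
  finally show ?case .
qed

text \<open>Exactly the condition under which the \<open>LEAST\<close> in \<open>jump_index\<close>
  has a witness.\<close>

definition nonexplosive :: "'s \<Rightarrow> real \<Rightarrow> 's noise \<Rightarrow> bool" where
  "nonexplosive s t w \<longleftrightarrow> (\<exists>n. t < jump_time s w (Suc n))"

lemma nonexplosive_shift:
  "nonexplosive s t w \<longleftrightarrow> t < fst (w 0 s) \<or> nonexplosive (snd (w 0 s)) (t - fst (w 0 s)) (\<lambda>n. w (Suc n))"
proof -
  have "(\<exists>n. t < jump_time s w (Suc n)) \<longleftrightarrow>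
      (\<exists>n. t - fst (w 0 s) < jump_time (snd (w 0 s)) (\<lambda>n. w (Suc n)) n)"
    unfolding jump_time_shift by (auto simp: algebra_simps)
  also have "\<dots> \<longleftrightarrow> t < fst (w 0 s) \<or> (\<exists>n. t - fst (w 0 s) < jump_time (snd (w 0 s)) (\<lambda>n. w (Suc n)) (Suc n))"
    using not0_implies_Suc by (metis diff_less_0_iff_less jump_time.simps(1))
  finally show ?thesis by (simp add: nonexplosive_def)
qed

lemma process_shift:
  assumes "nonexplosive s t w"
  shows "process \<phi> (x, s) t w = (if t < fst (w 0 s) then (\<Phi> s t x, s)
    else process \<phi> (\<Phi> s (fst (w 0 s)) x, snd (w 0 s)) (t - fst (w 0 s)) (\<lambda>n. w (Suc n)))"
proof (cases "t < fst (w 0 s)")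
  case True
  then have "jump_index s w t = 0" by (simp add: jump_index_def Least_eq_0)
  then show ?thesis using True by (simp add: process_def \<Phi>_def)
next
  case False
  from assms obtain n where n: "t < jump_time s w (Suc n)" by (auto simp: nonexplosive_def)
  \<comment> \<open>Index 0 is excluded since the first holding time is at most t, so the least
    index is one more than that of the shifted noise.\<close>
  have "jump_index s w t = Suc (LEAST n. t < jump_time s w (Suc (Suc n)))"
    unfolding jump_index_def by (rule Least_Suc[of "\<lambda>n. t < jump_time s w (Suc n)", OF n]) (use False in simp)
  also have "(LEAST n. t < jump_time s w (Suc (Suc n))) = jump_index (snd (w 0 s)) (\<lambda>n. w (Suc n)) (t - fst (w 0 s))"
    unfolding jump_index_def
    by (rule arg_cong[where f = Least]) (simp add: jump_time_shift[of s w "Suc _"] fun_eq_iff algebra_simps del: jump_time.simps)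
  finally show ?thesis
    using False by (simp only: process_def Let_def fst_conv snd_conv jump_pos_shift jump_time_shift jump_state_shift if_False)
      (simp add: algebra_simps)
qed

lemma measurable_state_fun:
  assumes [measurable]: "\<And>i. (\<lambda>y. f i y) \<in> M \<rightarrow>\<^sub>M L" "g \<in> M \<rightarrow>\<^sub>M count_space (UNIV :: 's set)"
  shows "(\<lambda>y. f (g y) y) \<in> M \<rightarrow>\<^sub>M L"
  by (rule measurable_compose_countable'[where I = UNIV]) auto

lemma measurable_jump_state: "(\<lambda>w. jump_state s w n) \<in> N \<rightarrow>\<^sub>M count_space UNIV"
proof (induction n)
  case (Suc n)
  have "(\<lambda>w. snd (w n (jump_state s w n))) \<in> N \<rightarrow>\<^sub>M count_space UNIV"
    by (rule measurable_state_fun[where f = "\<lambda>i w. snd (w n i)", OF _ Suc])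
       (rule measurable_compose[OF measurable_noise measurable_snd])
  then show ?case unfolding jump_state.simps .
qed simp

lemma measurable_jump_time: "(\<lambda>w. jump_time s w n) \<in> borel_measurable N"
proof (induction n)
  case (Suc n)
  have "(\<lambda>w. fst (w n (jump_state s w n))) \<in> borel_measurable N"
    by (rule measurable_state_fun[where f = "\<lambda>i w. fst (w n i)", OF _ measurable_jump_state])
       (rule measurable_compose[OF measurable_noise measurable_fst])
  with Suc show ?case unfolding jump_time.simps by (rule borel_measurable_add)
next
  case 0
  show ?case unfolding jump_time.simps by (rule borel_measurable_const)
qed

lemma measurable_jump_pos:
  assumes g: "g \<in> borel_measurable M" and h: "h \<in> M \<rightarrow>\<^sub>M N"
  shows "(\<lambda>y. jump_pos \<phi> (g y) s (h y) n) \<in> borel_measurable M"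
proof (induction n)
  case 0
  then show ?case using g by simp
next
  case (Suc n)
  note T = measurable_compose[OF h measurable_jump_time]
  have "(\<lambda>y. \<Phi> (jump_state s (h y) n) (jump_time s (h y) (Suc n) - jump_time s (h y) n) (jump_pos \<phi> (g y) s (h y) n)) \<in> borel_measurable M"
  proof (rule measurable_state_fun[where f = "\<lambda>i y. \<Phi> i (jump_time s (h y) (Suc n) - jump_time s (h y) n) (jump_pos \<phi> (g y) s (h y) n)"])
    show "(\<lambda>y. jump_state s (h y) n) \<in> M \<rightarrow>\<^sub>M count_space UNIV"
      by (rule measurable_compose[OF h measurable_jump_state])
    show "(\<lambda>y. \<Phi> i (jump_time s (h y) (Suc n) - jump_time s (h y) n) (jump_pos \<phi> (g y) s (h y) n)) \<in> borel_measurable M" for i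
      by (intro measurable_\<Phi> borel_measurable_diff T Suc)
  qed
  then show ?case unfolding \<Phi>_def jump_pos.simps(2) .
qed

lemma measurable_process_index:
  assumes f: "f \<in> borel_measurable M" and h: "h \<in> M \<rightarrow>\<^sub>M N"
  shows "(\<lambda>y. jump_index s (h y) (f y)) \<in> M \<rightarrow>\<^sub>M count_space UNIV"
proof -
  have "Measurable.pred M (\<lambda>y. f y < jump_time s (h y) (Suc n))" for n
    by (rule borel_measurable_pred_less[OF f measurable_compose[OF h measurable_jump_time]])
  then show ?thesis
    unfolding jump_index_def by (rule measurable_Least)
qed

lemma measurable_process_aux:
  assumes f [measurable]: "f \<in> borel_measurable M" and g [measurable]: "g \<in> borel_measurable M"
    and h [measurable]: "h \<in> M \<rightarrow>\<^sub>M N"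
  shows "(\<lambda>y. process \<phi> (g y, s) (f y) (h y)) \<in> M \<rightarrow>\<^sub>M E_space"
proof -
  note st = measurable_compose[OF h measurable_jump_state] and T = measurable_compose[OF h measurable_jump_time]
  have A: "(\<lambda>y. (\<Phi> (jump_state s (h y) n) (f y - jump_time s (h y) n) (jump_pos \<phi> (g y) s (h y) n),
     jump_state s (h y) n)) \<in> M \<rightarrow>\<^sub>M E_space" for n
    unfolding E_space_def
  proof (intro measurable_Pair measurable_restrict_space2 st)
    show "(\<lambda>y. \<Phi> (jump_state s (h y) n) (f y - jump_time s (h y) n) (jump_pos \<phi> (g y) s (h y) n)) \<in> borel_measurable M"
    proof (rule measurable_state_fun[where f = "\<lambda>i y. \<Phi> i (f y - jump_time s (h y) n) (jump_pos \<phi> (g y) s (h y) n)", OF _ st])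
      show "(\<lambda>y. \<Phi> i (f y - jump_time s (h y) n) (jump_pos \<phi> (g y) s (h y) n)) \<in> borel_measurable M" for i
        by (intro measurable_\<Phi> borel_measurable_diff T f measurable_jump_pos[OF g h])
    qed
  qed auto
  have "(\<lambda>y. (\<lambda>n. (\<Phi> (jump_state s (h y) n) (f y - jump_time s (h y) n) (jump_pos \<phi> (g y) s (h y) n),
     jump_state s (h y) n)) (jump_index s (h y) (f y))) \<in> M \<rightarrow>\<^sub>M E_space"
    by (rule measurable_compose_countable'[where I = UNIV, OF A measurable_process_index[OF f h]]) auto
  then show ?thesis
    by (simp add: process_def Let_def \<Phi>_def)
qed

lemma measurable_process [measurable (raw)]:
  assumes f [measurable]: "f \<in> borel_measurable M" and g [measurable]: "g \<in> borel_measurable M"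
    and k: "k \<in> M \<rightarrow>\<^sub>M count_space UNIV" and h [measurable]: "h \<in> M \<rightarrow>\<^sub>M N"
  shows "(\<lambda>y. process \<phi> (g y, k y) (f y) (h y)) \<in> M \<rightarrow>\<^sub>M E_space"
  by (rule measurable_state_fun[where f = "\<lambda>i y. process \<phi> (g y, i) (f y) (h y)", OF measurable_process_aux[OF f g h] k])

text \<open>An almost sure identity suffices, which is what the shift formula for
  \<open>process\<close> offers: it holds off the explosive noise.\<close>

lemma first_step_AE:
  fixes k :: "real \<Rightarrow> 's \<Rightarrow> 's noise \<Rightarrow> ennreal"
  assumes f: "AE w in N. f w = (if t < fst (w 0 s) then a else k (fst (w 0 s)) (snd (w 0 s)) (\<lambda>n. w (Suc n)))"
    and k [measurable]: "\<And>s'. (\<lambda>p. k (fst p) s' (snd p)) \<in> borel_measurable (borel \<Otimes>\<^sub>M N)"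
  shows "(\<integral>\<^sup>+w. f w \<partial>N) = (\<integral>\<^sup>+z. (if t < fst z then a else \<integral>\<^sup>+w. k (fst z) (snd z) w \<partial>N) \<partial>H s)"
proof -
  let ?F = "\<lambda>p. if t < fst (fst p) then a else k (fst (fst p)) (snd (fst p)) (snd p)"
  have "(\<lambda>p. k (fst (fst p)) (snd (fst p)) (snd p)) \<in> borel_measurable ((borel \<Otimes>\<^sub>M count_space UNIV) \<Otimes>\<^sub>M N)"
  proof (rule measurable_state_fun[where f = "\<lambda>i p. k (fst (fst p)) i (snd p)"])
    show "(\<lambda>p. k (fst (fst p)) i (snd p)) \<in> borel_measurable ((borel \<Otimes>\<^sub>M count_space UNIV) \<Otimes>\<^sub>M N)" for i
      using measurable_compose[OF _ k[of i], of "\<lambda>p. (fst (fst p), snd p)" "(borel \<Otimes>\<^sub>M count_space UNIV) \<Otimes>\<^sub>M N"] by simp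
  qed simp
  then have F: "?F \<in> borel_measurable ((borel \<Otimes>\<^sub>M count_space UNIV) \<Otimes>\<^sub>M N)" by measurable
  have "(\<integral>\<^sup>+w. f w \<partial>N) = (\<integral>\<^sup>+w. ?F (w 0 s, \<lambda>n. w (Suc n)) \<partial>N)"
    using f by (intro nn_integral_cong_AE) auto
  also have "\<dots> = (\<integral>\<^sup>+z. \<integral>\<^sup>+w. ?F (z, w) \<partial>N \<partial>H s)"
    by (rule first_step[OF F])
  also have "\<dots> = (\<integral>\<^sup>+z. (if t < fst z then a else \<integral>\<^sup>+w. k (fst z) (snd z) w \<partial>N) \<partial>H s)"
    by (intro nn_integral_cong) (simp add: N.emeasure_space_1[simplified])
  finally show ?thesis .
qed

lemma measurable_nonexplosive [measurable]:
  assumes [measurable]: "f \<in> borel_measurable M" "h \<in> M \<rightarrow>\<^sub>M N"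
  shows "Measurable.pred M (\<lambda>y. nonexplosive s (f y) (h y))"
  unfolding nonexplosive_def
  by (intro pred_intros_countable borel_measurable_pred_less assms(1) measurable_compose[OF assms(2) measurable_jump_time])

text \<open>The probability of explosion solves the renewal equation with final value 0, and so does
  the zero function; the comparison bounds the former by the latter. There is no position to carry
  along, hence the parameter of type \<open>unit\<close>.\<close>

lemma AE_nonexplosive:
  assumes t: "0 \<le> t"
  shows "AE w in N. nonexplosive s t w"
proof -
  let ?U = "\<lambda>t (_::unit) s. \<integral>\<^sup>+w. indicator {w. \<not> nonexplosive s t w} w \<partial>N"
  have "?U t () s \<le> 0"
  proof (rule comparison[where \<Theta> = "\<lambda>_ _ _. ()" and D = "\<lambda>_. UNIV" and V = "\<lambda>_ _ _. 0" and g = "\<lambda>_ _. 0" and B = 1 and U = ?U])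
    show "?U t () s \<le> (\<integral>\<^sup>+z. (if t < fst z then 0 else ?U (t - fst z) () (snd z)) \<partial>H s)" for t s
    proof (subst first_step_AE[where s = s and a = 0 and t = t
        and k = "\<lambda>r s' w. indicator {w. \<not> nonexplosive s' (t - r) w} w"])
      show "AE w in N. indicator {w. \<not> nonexplosive s t w} w = (if t < fst (w 0 s) then 0 else
        indicator {wa. \<not> nonexplosive (snd (w 0 s)) (t - fst (w 0 s)) wa} (\<lambda>n. w (Suc n)) :: ennreal)"
        by (subst nonexplosive_shift) (auto simp: indicator_def)
      show "(\<lambda>p. indicator {w. \<not> nonexplosive s' (t - fst p) w} (snd p)) \<in> borel_measurable (borel \<Otimes>\<^sub>M N)" for s'
        by (simp add: indicator_def)
    qed simp
    show "?U t p s \<le> ennreal 1" for t s and p :: unit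
    proof -
      have "?U t p s \<le> (\<integral>\<^sup>+w. 1 \<partial>N)" by (intro nn_integral_mono) (simp add: indicator_def)
      then show ?thesis by (simp add: N.emeasure_space_1[simplified])
    qed
  qed (use t in auto)
  then have "?U t () s = 0" by simp
  moreover have "(\<lambda>w. indicator {w. \<not> nonexplosive s t w} w :: ennreal) \<in> borel_measurable N"
    by (simp add: indicator_def)
  ultimately have "AE w in N. (indicator {w. \<not> nonexplosive s t w} w :: ennreal) = 0"
    by (simp add: nn_integral_0_iff_AE)
  then show ?thesis by eventually_elim (auto simp: indicator_def split: if_splits)
qed

text \<open>Two copies with a common internal state and common noise keep the same internal path for
  ever, so one \<open>s\<close> serves both. Functions of the first component alone recover the
  semigroup of a single copy.\<close>

definition joint_mean :: "real \<Rightarrow> real \<times> real \<Rightarrow> 's \<Rightarrow> ((real \<times> 's) \<times> (real \<times> 's) \<Rightarrow> ennreal) \<Rightarrow> ennreal" where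
  "joint_mean t p s G = (\<integral>\<^sup>+w. G (process \<phi> (fst p, s) t w, process \<phi> (snd p, s) t w) \<partial>N)"

lemma measurable_joint_mean:
  assumes G [measurable]: "G \<in> borel_measurable (E_space \<Otimes>\<^sub>M E_space)"
    and [measurable]: "f \<in> borel_measurable M" "g \<in> borel_measurable M" "h \<in> borel_measurable M"
  shows "(\<lambda>y. joint_mean (f y) (g y, h y) s G) \<in> borel_measurable M"
  unfolding joint_mean_def
  by (rule N.borel_measurable_nn_integral) (simp add: case_prod_beta')

lemma renewal:
  assumes G [measurable]: "G \<in> borel_measurable (E_space \<Otimes>\<^sub>M E_space)" and t: "0 \<le> t"
  shows "joint_mean t p s G = (\<integral>\<^sup>+z. (if t < fst z then G ((\<Phi> s t (fst p), s), (\<Phi> s t (snd p), s))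
     else joint_mean (t - fst z) (\<Phi> s (fst z) (fst p), \<Phi> s (fst z) (snd p)) (snd z) G) \<partial>H s)"
  unfolding joint_mean_def fst_conv snd_conv
proof (rule first_step_AE)
  show "AE w in N. G (process \<phi> (fst p, s) t w, process \<phi> (snd p, s) t w) = (if t < fst (w 0 s)
     then G ((\<Phi> s t (fst p), s), (\<Phi> s t (snd p), s))
     else G (process \<phi> (\<Phi> s (fst (w 0 s)) (fst p), snd (w 0 s)) (t - fst (w 0 s)) (\<lambda>n. w (Suc n)),
             process \<phi> (\<Phi> s (fst (w 0 s)) (snd p), snd (w 0 s)) (t - fst (w 0 s)) (\<lambda>n. w (Suc n))))"
    using AE_nonexplosive[OF t, of s] by eventually_elim (simp add: process_shift)
qed measurable

end

subsection \<open>The Markov property\<close>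

lemma measurable_fst_E [measurable]: "fst \<in> E_space \<rightarrow>\<^sub>M borel"
  unfolding E_space_def by (rule measurable_compose[OF measurable_fst]) (simp add: measurable_restrict_space1)

lemma measurable_snd_E [measurable]: "snd \<in> E_space \<rightarrow>\<^sub>M count_space UNIV"
  unfolding E_space_def by (rule measurable_snd)

context jump_flow
begin

abbreviation TR :: "real \<Rightarrow> real \<times> 's \<Rightarrow> (real \<times> 's) measure" where
  "TR \<equiv> transition q \<phi>"

lemma sets_TR [simp, measurable_cong]: "sets (TR t z) = sets E_space"
  by (simp add: transition_def)

lemma space_TR [simp]: "space (TR t z) = space E_space"
  by (simp add: transition_def)

lemma measurable_process' [measurable]: "process \<phi> z t \<in> N \<rightarrow>\<^sub>M E_space"
  using measurable_process[of "\<lambda>_. t" N "\<lambda>_. fst z" "\<lambda>_. snd z" "\<lambda>w. w"] by simp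

lemma prob_space_TR: "prob_space (TR t z)"
  unfolding transition_def by (rule N.prob_space_distr) measurable

lemma nn_integral_TR_joint_mean:
  assumes [measurable]: "g \<in> borel_measurable E_space"
  shows "(\<integral>\<^sup>+z'. g z' \<partial>TR t (x, s)) = joint_mean t (x, y) s (\<lambda>u. g (fst u))"
  unfolding transition_def joint_mean_def by (subst nn_integral_distr) simp_all

lemma measurable_TR [measurable]: "TR t \<in> E_space \<rightarrow>\<^sub>M subprob_algebra E_space"
  unfolding transition_def
proof (rule measurable_distr2)
  have "(\<lambda>p. process \<phi> (fst (fst p), snd (fst p)) t (snd p)) \<in> E_space \<Otimes>\<^sub>M N \<rightarrow>\<^sub>M E_space"
    by (rule measurable_process) (rule measurable_const measurable_snd
        measurable_compose[OF measurable_fst measurable_fst_E] measurable_compose[OF measurable_fst measurable_snd_E]; simp)+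
  then show "(\<lambda>(z, w). process \<phi> z t w) \<in> E_space \<Otimes>\<^sub>M N \<rightarrow>\<^sub>M E_space"
    by (simp add: case_prod_beta')
  show "(\<lambda>z. N) \<in> E_space \<rightarrow>\<^sub>M subprob_algebra N"
    by (rule measurable_const) (simp add: N.M_in_subprob)
qed

lemma measurable_nn_integral_TR [measurable]:
  assumes "g \<in> borel_measurable E_space"
  shows "(\<lambda>z. \<integral>\<^sup>+z'. g z' \<partial>TR t z) \<in> borel_measurable E_space"
  by (rule measurable_compose[OF measurable_TR nn_integral_measurable_subprob_algebra[OF assms]])

lemma renewal_TR:
  assumes [measurable]: "g \<in> borel_measurable E_space" and t: "0 \<le> t"
  shows "(\<integral>\<^sup>+z'. g z' \<partial>TR t (x, s)) = (\<integral>\<^sup>+z. (if t < fst z then g (\<Phi> s t x, s)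
    else \<integral>\<^sup>+z'. g z' \<partial>TR (t - fst z) (\<Phi> s (fst z) x, snd z)) \<partial>H s)"
  using renewal[OF _ t, of "\<lambda>u. g (fst u)" "(x, x)" s]
  by (simp add: nn_integral_TR_joint_mean[symmetric, OF assms(1)] cong: if_cong)

lemma measurable_TR_time:
  assumes g [measurable]: "g \<in> borel_measurable E_space"
    and [measurable]: "f \<in> borel_measurable M" "h \<in> borel_measurable M"
  shows "(\<lambda>y. \<integral>\<^sup>+z'. g z' \<partial>TR (f y) (h y, s)) \<in> borel_measurable M"
proof -
  have "(\<lambda>y. joint_mean (f y) (h y, h y) s (\<lambda>u. g (fst u))) \<in> borel_measurable M"
    by (rule measurable_joint_mean) measurable
  then show ?thesis by (simp add: nn_integral_TR_joint_mean[symmetric, OF g])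
qed

lemma comparison_TR_le:
  fixes V :: "real \<Rightarrow> real \<Rightarrow> 's \<Rightarrow> ennreal"
  assumes g [measurable]: "g \<in> borel_measurable E_space" and B: "\<And>z. z \<in> space E_space \<Longrightarrow> g z \<le> ennreal B"
    and dom: "\<And>t x s r. x \<in> D t \<Longrightarrow> 0 \<le> r \<Longrightarrow> r \<le> t \<Longrightarrow> \<Phi> s r x \<in> D (t - r)"
    and super: "\<And>t x s. 0 \<le> t \<Longrightarrow> x \<in> D t \<Longrightarrow>
      (\<integral>\<^sup>+z. (if t < fst z then g (\<Phi> s t x, s) else V (t - fst z) (\<Phi> s (fst z) x) (snd z)) \<partial>H s) \<le> V t x s"
    and meas: "\<And>t x s s'. 0 \<le> t \<Longrightarrow> x \<in> D t \<Longrightarrow> (\<lambda>r. V (t - r) (\<Phi> s r x) s') \<in> borel_measurable borel"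
    and t: "0 \<le> t" and x: "x \<in> D t"
  shows "(\<integral>\<^sup>+z'. g z' \<partial>TR t (x, s)) \<le> V t x s"
proof (rule comparison[where \<Theta> = \<Phi> and D = D and g = "\<lambda>x s. g (x, s)" and V = V and B = B
      and U = "\<lambda>t x s. \<integral>\<^sup>+z'. g z' \<partial>TR t (x, s)", OF dom _ super meas _ t x])
  show "(\<integral>\<^sup>+z'. g z' \<partial>TR t (x, s)) \<le> ennreal B" for t x s
  proof -
    interpret prob_space "TR t (x, s)" by (rule prob_space_TR)
    have "(\<integral>\<^sup>+z'. g z' \<partial>TR t (x, s)) \<le> (\<integral>\<^sup>+z'. ennreal B \<partial>TR t (x, s))"
      by (rule nn_integral_mono) (simp add: B)
    then show ?thesis by (simp add: emeasure_space_1[simplified])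
  qed
qed (auto simp: renewal_TR)

lemma comparison_TR_ge:
  fixes U :: "real \<Rightarrow> real \<Rightarrow> 's \<Rightarrow> ennreal"
  assumes g [measurable]: "g \<in> borel_measurable E_space"
    and dom: "\<And>t x s r. x \<in> D t \<Longrightarrow> 0 \<le> r \<Longrightarrow> r \<le> t \<Longrightarrow> \<Phi> s r x \<in> D (t - r)"
    and sub: "\<And>t x s. 0 \<le> t \<Longrightarrow> x \<in> D t \<Longrightarrow>
      U t x s \<le> (\<integral>\<^sup>+z. (if t < fst z then g (\<Phi> s t x, s) else U (t - fst z) (\<Phi> s (fst z) x) (snd z)) \<partial>H s)"
    and bounded: "\<And>t x s. 0 \<le> t \<Longrightarrow> x \<in> D t \<Longrightarrow> U t x s \<le> ennreal B"
    and t: "0 \<le> t" and x: "x \<in> D t"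
  shows "U t x s \<le> (\<integral>\<^sup>+z'. g z' \<partial>TR t (x, s))"
proof (rule comparison[where \<Theta> = \<Phi> and D = D and g = "\<lambda>x s. g (x, s)" and U = U and B = B
      and V = "\<lambda>t x s. \<integral>\<^sup>+z'. g z' \<partial>TR t (x, s)", OF dom sub _ _ bounded t x])
  show "(\<lambda>r. \<integral>\<^sup>+z'. g z' \<partial>TR (t - r) (\<Phi> s r x, s')) \<in> borel_measurable borel" for t x s s'
    by (rule measurable_TR_time) measurable
qed (auto simp: renewal_TR)

text \<open>Shifting the integration variable by t pulls the factor exp (- e t) out of the
  exponential law and leaves the next state untouched. The shifted half-line is open at 0 while the
  support of the holding time is closed there; they differ by a null set.\<close>

lemma memoryless:
  assumes t: "0 \<le> t" and F [measurable]: "F \<in> borel_measurable (borel \<Otimes>\<^sub>M count_space UNIV)"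
  shows "(\<integral>\<^sup>+z. F z * indicator {t<..} (fst z) \<partial>H s) =
    ennreal (exp (- exit_rate q s * t)) * (\<integral>\<^sup>+z. F (t + fst z, snd z) \<partial>H s)"
proof -
  let ?e = "exit_rate q s"
  let ?f = "\<lambda>r. (\<Sum>s'\<in>UNIV. ennreal (exp (- ?e * r) * q s s') * F (r, s'))"
  have "(\<integral>\<^sup>+z. F z * indicator {t<..} (fst z) \<partial>H s) = (\<integral>\<^sup>+r. ?f r * indicator {t<..} r \<partial>lborel)"
    using t by (subst nn_integral_H) (auto intro!: nn_integral_cong simp: indicator_def)
  also have "\<dots> = (\<integral>\<^sup>+r. ?f (t + r) * indicator {t<..} (t + r) \<partial>lborel)"
    by (subst nn_integral_real_affine[where c = 1 and t = t]) auto
  also have "\<dots> = (\<integral>\<^sup>+r. ?f (t + r) * indicator {0..} r \<partial>lborel)"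
    by (rule nn_integral_cong_AE) (use AE_lborel_singleton[of 0] in \<open>eventually_elim; auto simp: indicator_def\<close>)
  also have "\<dots> = (\<integral>\<^sup>+r. ennreal (exp (- ?e * t)) *
      ((\<Sum>s'\<in>UNIV. ennreal (exp (- ?e * r) * q s s') * F (t + r, s')) * indicator {0..} r) \<partial>lborel)"
  proof (rule nn_integral_cong)
    fix r :: real
    have "ennreal (exp (- ?e * (t + r)) * q s s') = ennreal (exp (- ?e * t)) * ennreal (exp (- ?e * r) * q s s')" for s'
      using q_nonneg[of s s'] by (subst ennreal_mult[symmetric]) (simp_all add: algebra_simps exp_add[symmetric] exp_diff[symmetric])
    then show "?f (t + r) * indicator {0..} r = ennreal (exp (- ?e * t)) *
      ((\<Sum>s'\<in>UNIV. ennreal (exp (- ?e * r) * q s s') * F (t + r, s')) * indicator {0..} r)"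
      by (simp add: sum_distrib_left[symmetric] mult.assoc)
  qed
  also have "\<dots> = ennreal (exp (- ?e * t)) * (\<integral>\<^sup>+z. F (t + fst z, snd z) \<partial>H s)"
    by (subst nn_integral_cmult, simp, subst nn_integral_H) (simp_all add: measurable_compose[OF _ F])
  finally show ?thesis .
qed

text \<open>If no jump has occurred by time t, the residual holding time is again exponential and,
  by \<open>flow_add\<close>, the flow line continues from its point at time t. Hence P (t + u) g
  solves, as a function of t, the renewal equation with final value P u g.\<close>

lemma renewal_later:
  assumes g [measurable]: "g \<in> borel_measurable E_space" and t: "0 \<le> t" and u: "0 \<le> u" and x: "0 \<le> x"
  shows "(\<integral>\<^sup>+z'. g z' \<partial>TR (t + u) (x, s)) = (\<integral>\<^sup>+z. (if t < fst z then \<integral>\<^sup>+z'. g z' \<partial>TR u (\<Phi> s t x, s)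
    else \<integral>\<^sup>+z'. g z' \<partial>TR (t - fst z + u) (\<Phi> s (fst z) x, snd z)) \<partial>H s)"
proof -
  have flow: "\<Phi> s r (\<Phi> s t x) = \<Phi> s (t + r) x" if "0 \<le> r" for r
    using flow_add[OF x t that, of s] by (simp add: \<Phi>_def)
  let ?F = "\<lambda>z. if t + u < fst z then g (\<Phi> s (t + u) x, s)
    else \<integral>\<^sup>+z'. g z' \<partial>TR (t + u - fst z) (\<Phi> s (fst z) x, snd z)"
  let ?A = "\<integral>\<^sup>+z'. g z' \<partial>TR u (\<Phi> s t x, s)"
  let ?G = "\<lambda>z. \<integral>\<^sup>+z'. g z' \<partial>TR (t - fst z + u) (\<Phi> s (fst z) x, snd z)"
  have [measurable]: "(\<lambda>z. \<integral>\<^sup>+z'. g z' \<partial>TR (t + u - fst z) (\<Phi> s (fst z) x, snd z)) \<in> borel_measurable (borel \<Otimes>\<^sub>M count_space UNIV)"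
    by (rule measurable_state_fun[where f = "\<lambda>i z. \<integral>\<^sup>+z'. g z' \<partial>TR (t + u - fst z) (\<Phi> s (fst z) x, i)"])
       (simp_all add: measurable_TR_time)
  then have [measurable]: "?G \<in> borel_measurable (borel \<Otimes>\<^sub>M count_space UNIV)"
    by (simp add: algebra_simps)
  have F [measurable]: "?F \<in> borel_measurable (borel \<Otimes>\<^sub>M count_space UNIV)"
    by measurable
  have "(\<integral>\<^sup>+z. ?F (t + fst z, snd z) \<partial>H s) = (\<integral>\<^sup>+z. (if u < fst z then g (\<Phi> s u (\<Phi> s t x), s)
    else \<integral>\<^sup>+z'. g z' \<partial>TR (u - fst z) (\<Phi> s (fst z) (\<Phi> s t x), snd z)) \<partial>H s)"
    by (rule nn_integral_cong_AE, rule AE_mp[OF AE_H_nonneg]) (use u in \<open>auto simp: flow\<close>)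
  also have "\<dots> = ?A"
    by (rule renewal_TR[symmetric, OF g u])
  finally have A: "(\<integral>\<^sup>+z. ?F (t + fst z, snd z) \<partial>H s) = ?A" .
  have "(\<integral>\<^sup>+z'. g z' \<partial>TR (t + u) (x, s)) = (\<integral>\<^sup>+z. ?F z \<partial>H s)"
    using t u by (intro renewal_TR) auto
  also have "\<dots> = (\<integral>\<^sup>+z. ?F z * indicator {t<..} (fst z) + ?G z * indicator {..t} (fst z) \<partial>H s)"
    using u by (intro nn_integral_cong) (auto simp: indicator_def algebra_simps)
  also have "\<dots> = (\<integral>\<^sup>+z. ?F z * indicator {t<..} (fst z) \<partial>H s) + (\<integral>\<^sup>+z. ?G z * indicator {..t} (fst z) \<partial>H s)"
    by (rule nn_integral_add) (auto simp: measurable_cong_sets[OF sets_H refl])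
  also have "(\<integral>\<^sup>+z. ?F z * indicator {t<..} (fst z) \<partial>H s) = ennreal (exp (- exit_rate q s * t)) * ?A"
    unfolding memoryless[OF t F] A ..
  also have "\<dots> = (\<integral>\<^sup>+z. ?A * indicator {t<..} (fst z) \<partial>H s)"
    using t by (subst nn_integral_cmult) (auto simp: measurable_cong_sets[OF sets_H refl] emeasure_H_gt mult.commute)
  also have "\<dots> + (\<integral>\<^sup>+z. ?G z * indicator {..t} (fst z) \<partial>H s)
      = (\<integral>\<^sup>+z. ?A * indicator {t<..} (fst z) + ?G z * indicator {..t} (fst z) \<partial>H s)"
    by (rule nn_integral_add[symmetric]) (auto simp: measurable_cong_sets[OF sets_H refl])
  also have "\<dots> = (\<integral>\<^sup>+z. (if t < fst z then ?A else ?G z) \<partial>H s)"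
    by (intro nn_integral_cong) (auto simp: indicator_def)
  finally show ?thesis .
qed

lemma nn_integral_TR_le:
  assumes "\<And>z. z \<in> space E_space \<Longrightarrow> g z \<le> c"
  shows "(\<integral>\<^sup>+z'. g z' \<partial>TR t z) \<le> c"
proof -
  interpret prob_space "TR t z" by (rule prob_space_TR)
  have "(\<integral>\<^sup>+z'. g z' \<partial>TR t z) \<le> (\<integral>\<^sup>+z'. c \<partial>TR t z)"
    by (rule nn_integral_mono) (simp add: assms)
  then show ?thesis by (simp add: emeasure_space_1[simplified])
qed

text \<open>Uniqueness for the renewal equation: as functions of (t, x, s) both sides solve it with
  final value P u g, and each is bounded by the other through the comparison.\<close>

lemma markov:
  assumes g [measurable]: "g \<in> borel_measurable E_space" and B: "\<And>z. z \<in> space E_space \<Longrightarrow> g z \<le> ennreal B"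
    and t: "0 \<le> t" and u: "0 \<le> u" and x: "0 \<le> x"
  shows "(\<integral>\<^sup>+z'. g z' \<partial>TR (t + u) (x, s)) = (\<integral>\<^sup>+y. \<integral>\<^sup>+z'. g z' \<partial>TR u y \<partial>TR t (x, s))"
proof (rule antisym)
  let ?k = "\<lambda>y. \<integral>\<^sup>+z'. g z' \<partial>TR u y"
  have k: "?k \<in> borel_measurable E_space" by measurable
  have kB: "?k y \<le> ennreal B" for y by (rule nn_integral_TR_le[OF B])
  show "(\<integral>\<^sup>+z'. g z' \<partial>TR (t + u) (x, s)) \<le> (\<integral>\<^sup>+y. ?k y \<partial>TR t (x, s))"
  proof (rule comparison_TR_ge[where U = "\<lambda>t x s. \<integral>\<^sup>+z'. g z' \<partial>TR (t + u) (x, s)" and D = "\<lambda>_. {0..}" and B = B, OF k])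
    show "(\<integral>\<^sup>+z'. g z' \<partial>TR (t + u) (x, s)) \<le> ennreal B" for t x s
      by (rule nn_integral_TR_le[OF B])
  qed (use u t x in \<open>auto simp: renewal_later\<close>)
  show "(\<integral>\<^sup>+y. ?k y \<partial>TR t (x, s)) \<le> (\<integral>\<^sup>+z'. g z' \<partial>TR (t + u) (x, s))"
    by (rule comparison_TR_le[where V = "\<lambda>t x s. \<integral>\<^sup>+z'. g z' \<partial>TR (t + u) (x, s)" and D = "\<lambda>_. {0..}" and B = B, OF k kB])
       (use u t x in \<open>auto simp: renewal_later intro!: measurable_TR_time\<close>)
qed

lemma bind_TR:
  assumes t: "0 \<le> t" and u: "0 \<le> u" and x: "0 \<le> x"
  shows "TR (t + u) (x, s) = TR t (x, s) \<bind> TR u"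
proof (rule measure_eqI)
  have ne: "space (TR t (x, s)) \<noteq> {}" by (simp add: space_E)
  have TRu: "TR u \<in> TR t (x, s) \<rightarrow>\<^sub>M subprob_algebra E_space"
    by (simp add: measurable_TR measurable_cong_sets[OF sets_TR refl])
  show "sets (TR (t + u) (x, s)) = sets (TR t (x, s) \<bind> TR u)"
    by (simp add: sets_bind[OF _ ne, of "TR u" E_space])
  fix A assume "A \<in> sets (TR (t + u) (x, s))"
  then have A [measurable]: "A \<in> sets E_space" by simp
  have "emeasure (TR (t + u) (x, s)) A = (\<integral>\<^sup>+z'. indicator A z' \<partial>TR (t + u) (x, s))"
    by simp
  also have "\<dots> = (\<integral>\<^sup>+y. \<integral>\<^sup>+z'. indicator A z' \<partial>TR u y \<partial>TR t (x, s))"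
    by (rule markov[OF _ _ t u x, where B = 1]) (auto simp: indicator_def)
  also have "\<dots> = emeasure (TR t (x, s) \<bind> TR u) A"
    by (subst emeasure_bind[OF ne TRu A]) simp
  finally show "emeasure (TR (t + u) (x, s)) A = emeasure (TR t (x, s) \<bind> TR u) A" .
qed

end

subsection \<open>Couplings and decay rates\<close>

lemma nn_integral_finite_label:
  fixes h :: "'s::finite \<Rightarrow> ennreal"
  assumes l [measurable]: "l \<in> M \<rightarrow>\<^sub>M count_space UNIV"
  shows "(\<integral>\<^sup>+z. h (l z) \<partial>M) = (\<Sum>s\<in>UNIV. h s * emeasure M {z\<in>space M. l z = s})"
proof -
  have "(\<integral>\<^sup>+z. h (l z) \<partial>M) = (\<integral>\<^sup>+z. (\<Sum>s\<in>UNIV. h s * indicator {z\<in>space M. l z = s} z) \<partial>M)"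
    by (intro nn_integral_cong) (simp add: indicator_def if_distrib cong: if_cong)
  also have "\<dots> = (\<Sum>s\<in>UNIV. h s * emeasure M {z\<in>space M. l z = s})"
    by (subst nn_integral_sum) (simp_all add: nn_integral_cmult)
  finally show ?thesis .
qed

text \<open>The maximal coupling: the common mass \<open>m\<close> sits on the diagonal, and the two
  remainders, both of total mass \<open>R\<close>, are coupled independently.\<close>

lemma finite_maximal_coupling:
  fixes a b :: "'s::finite \<Rightarrow> real"
  assumes a: "\<And>s. 0 \<le> a s" "sum a UNIV = 1" and b: "\<And>s. 0 \<le> b s" "sum b UNIV = 1"
  obtains \<gamma> :: "'s \<Rightarrow> 's \<Rightarrow> real" where "\<And>s s'. 0 \<le> \<gamma> s s'"
    "\<And>s. (\<Sum>s'\<in>UNIV. \<gamma> s s') = a s" "\<And>s'. (\<Sum>s\<in>UNIV. \<gamma> s s') = b s'"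
    "(\<Sum>s\<in>UNIV. \<Sum>s'\<in>UNIV. if s = s' then 0 else \<gamma> s s') \<le> (\<Sum>s\<in>UNIV. \<bar>a s - b s\<bar>)"
proof -
  define m where "m s = min (a s) (b s)" for s
  define R where "R = (\<Sum>s\<in>UNIV. a s - m s)"
  have m: "0 \<le> a s - m s" "0 \<le> b s - m s" "0 \<le> m s" for s
    using a(1)[of s] b(1)[of s] by (auto simp: m_def)
  have R: "0 \<le> R" "R = (\<Sum>s\<in>UNIV. b s - m s)"
    unfolding R_def using m by (auto intro!: sum_nonneg) (simp add: sum_subtractf a b)
  have R_le: "R \<le> (\<Sum>s\<in>UNIV. \<bar>a s - b s\<bar>)"
    unfolding R_def by (intro sum_mono) (auto simp: m_def)
  define \<gamma> where "\<gamma> s s' = (if s = s' then m s else 0) + (a s - m s) * (b s' - m s') / R" for s s'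
  \<comment> \<open>For \<open>R = 0\<close> the quotient in \<gamma> is 0 by convention, and both
    remainders vanish, so the marginals stay correct.\<close>
  have zero: "a s - m s = 0" "b s - m s = 0" if "R = 0" for s
    using that m R by (auto simp: R_def sum_nonneg_eq_0_iff)
  show ?thesis
  proof (rule that)
    show "0 \<le> \<gamma> s s'" for s s'
      using m R by (auto simp: \<gamma>_def intro!: add_nonneg_nonneg divide_nonneg_nonneg)
    show "(\<Sum>s'\<in>UNIV. \<gamma> s s') = a s" for s
    proof -
      have "(\<Sum>s'\<in>UNIV. \<gamma> s s') = m s + (a s - m s) * (\<Sum>s'\<in>UNIV. b s' - m s') / R"
        by (simp add: \<gamma>_def sum.distrib sum_distrib_left sum_divide_distrib)
      then show ?thesis using zero[of s] R(2) by (cases "R = 0") auto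
    qed
    show "(\<Sum>s\<in>UNIV. \<gamma> s s') = b s'" for s'
    proof -
      have "(\<Sum>s\<in>UNIV. \<gamma> s s') = m s' + (\<Sum>s\<in>UNIV. a s - m s) * (b s' - m s') / R"
        by (simp add: \<gamma>_def sum.distrib sum_distrib_right sum_divide_distrib)
      then show ?thesis using zero[of s'] R_def by (cases "R = 0") auto
    qed
    have "(\<Sum>s\<in>UNIV. \<Sum>s'\<in>UNIV. if s = s' then 0 else \<gamma> s s')
      \<le> (\<Sum>s\<in>UNIV. \<Sum>s'\<in>UNIV. (a s - m s) * (b s' - m s') / R)"
      using m R by (intro sum_mono) (auto simp: \<gamma>_def)
    also have "\<dots> = (\<Sum>s\<in>UNIV. a s - m s) * (\<Sum>s'\<in>UNIV. b s' - m s') / R"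
      by (simp add: sum_product sum_divide_distrib)
    also have "\<dots> = R" using R(2) R_def by (cases "R = 0") auto
    also note R_le
    finally show "(\<Sum>s\<in>UNIV. \<Sum>s'\<in>UNIV. if s = s' then 0 else \<gamma> s s') \<le> (\<Sum>s\<in>UNIV. \<bar>a s - b s\<bar>)" .
  qed
qed

text \<open>Given the labels, the two points are kept independent: the coupling has a density with
  respect to the product measure that depends on the labels only, so that no conditional
  distributions appear.\<close>

lemma coupling_of_labels:
  fixes l :: "'a \<Rightarrow> 's::finite"
  assumes \<eta>: "prob_space \<eta>" and \<eta>': "prob_space \<eta>'"
    and l [measurable]: "l \<in> \<eta> \<rightarrow>\<^sub>M count_space UNIV" "l \<in> \<eta>' \<rightarrow>\<^sub>M count_space UNIV"
  obtains \<Gamma> where "\<Gamma> \<in> couplings \<eta> \<eta>'"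
    "emeasure \<Gamma> {u\<in>space \<Gamma>. l (fst u) \<noteq> l (snd u)} \<le>
      ennreal (\<Sum>s\<in>UNIV. \<bar>measure \<eta> {z\<in>space \<eta>. l z = s} - measure \<eta>' {z\<in>space \<eta>'. l z = s}\<bar>)"
proof -
  interpret \<eta>: prob_space \<eta> by fact
  interpret \<eta>': prob_space \<eta>' by fact
  define a b where "a s = measure \<eta> {z\<in>space \<eta>. l z = s}" and "b s = measure \<eta>' {z\<in>space \<eta>'. l z = s}" for s
  have ab: "0 \<le> a s" "0 \<le> b s" for s by (simp_all add: a_def b_def)
  have ea: "emeasure \<eta> {z\<in>space \<eta>. l z = s} = ennreal (a s)" and eb: "emeasure \<eta>' {z\<in>space \<eta>'. l z = s} = ennreal (b s)" for s
    by (simp_all add: a_def b_def \<eta>.emeasure_eq_measure \<eta>'.emeasure_eq_measure)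
  have "ennreal (sum a UNIV) = 1"
    using nn_integral_finite_label[OF l(1), of "\<lambda>_. 1"] by (simp add: ea ab sum_ennreal \<eta>.emeasure_space_1)
  moreover have "ennreal (sum b UNIV) = 1"
    using nn_integral_finite_label[OF l(2), of "\<lambda>_. 1"] by (simp add: eb ab sum_ennreal \<eta>'.emeasure_space_1)
  ultimately have sums: "sum a UNIV = 1" "sum b UNIV = 1"
    by (simp_all add: ennreal_eq_1)
  obtain \<gamma> where \<gamma>: "\<And>s s'. 0 \<le> \<gamma> s s'" "\<And>s. (\<Sum>s'\<in>UNIV. \<gamma> s s') = a s" "\<And>s'. (\<Sum>s\<in>UNIV. \<gamma> s s') = b s'"
    "(\<Sum>s\<in>UNIV. \<Sum>s'\<in>UNIV. if s = s' then 0 else \<gamma> s s') \<le> (\<Sum>s\<in>UNIV. \<bar>a s - b s\<bar>)"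
    using finite_maximal_coupling[OF ab(1) sums(1) ab(2) sums(2)] by blast
  have \<gamma>_le: "\<gamma> s s' \<le> a s" "\<gamma> s s' \<le> b s'" for s s'
    using member_le_sum[of s' UNIV "\<gamma> s"] member_le_sum[of s UNIV "\<lambda>s. \<gamma> s s'"] \<gamma>(1-3) by auto
  define W where "W s s' = \<gamma> s s' / (a s * b s')" for s s'
  have W: "0 \<le> W s s'" for s s' using \<gamma>(1) ab by (simp add: W_def)
  \<comment> \<open>Also valid when a s or b s' vanishes: the quotient is then 0, and so is \<gamma>
    s s', because it is dominated by both marginals.\<close>
  have Wb: "W s s' * b s' * a s = \<gamma> s s'" for s s'
    using \<gamma>_le[of s s'] \<gamma>(1)[of s s'] by (auto simp: W_def)
  let ?\<Gamma> = "density (\<eta> \<Otimes>\<^sub>M \<eta>') (\<lambda>u. ennreal (W (l (fst u)) (l (snd u))))"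
  interpret P: pair_prob_space \<eta> \<eta>' ..
  have W_meas [measurable]: "(\<lambda>u. ennreal (W (l (fst u)) (l (snd u)))) \<in> borel_measurable (\<eta> \<Otimes>\<^sub>M \<eta>')"
    by measurable
  have fub: "(\<integral>\<^sup>+u. F u \<partial>?\<Gamma>) = (\<integral>\<^sup>+z. \<integral>\<^sup>+z'. ennreal (W (l z) (l z')) * F (z, z') \<partial>\<eta>' \<partial>\<eta>)"
    and fub': "(\<integral>\<^sup>+u. F u \<partial>?\<Gamma>) = (\<integral>\<^sup>+z'. \<integral>\<^sup>+z. ennreal (W (l z) (l z')) * F (z, z') \<partial>\<eta> \<partial>\<eta>')"
    if [measurable]: "F \<in> borel_measurable (\<eta> \<Otimes>\<^sub>M \<eta>')" for F
    using \<eta>'.nn_integral_fst[of "\<lambda>u. ennreal (W (l (fst u)) (l (snd u))) * F u" \<eta>]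
      P.nn_integral_snd[of "\<lambda>u. ennreal (W (l (fst u)) (l (snd u))) * F u"]
    by (simp_all add: nn_integral_density)
  \<comment> \<open>Labels of mass zero, where the density is not normalised, are almost never
    seen.\<close>
  have AE_pos: "AE z in \<eta>. 0 < a (l z)"
  proof -
    have "AE z in \<eta>. \<forall>s. a s = 0 \<longrightarrow> l z \<noteq> s"
    proof (subst AE_all_countable, intro allI, cases)
      fix s assume "a s = 0"
      then have "emeasure \<eta> {z\<in>space \<eta>. l z = s} = 0" by (simp add: ea)
      then show "AE z in \<eta>. a s = 0 \<longrightarrow> l z \<noteq> s" by (intro AE_I) auto
    qed auto
    then show ?thesis by eventually_elim (use ab in \<open>auto simp: less_le\<close>)
  qed
  have AE_pos': "AE z in \<eta>'. 0 < b (l z)"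
  proof -
    have "AE z in \<eta>'. \<forall>s. b s = 0 \<longrightarrow> l z \<noteq> s"
    proof (subst AE_all_countable, intro allI, cases)
      fix s assume "b s = 0"
      then have "emeasure \<eta>' {z\<in>space \<eta>'. l z = s} = 0" by (simp add: eb)
      then show "AE z in \<eta>'. b s = 0 \<longrightarrow> l z \<noteq> s" by (intro AE_I) auto
    qed auto
    then show ?thesis by eventually_elim (use ab in \<open>auto simp: less_le\<close>)
  qed
  have inner: "(\<integral>\<^sup>+z'. ennreal (W s (l z')) \<partial>\<eta>') = 1" if "0 < a s" for s
  proof -
    have "(\<integral>\<^sup>+z'. ennreal (W s (l z')) \<partial>\<eta>') = ennreal (\<Sum>s'\<in>UNIV. W s s' * b s')"
      by (subst nn_integral_finite_label[where h = "\<lambda>s'. ennreal (W s s')"]) (simp_all add: eb ennreal_mult[symmetric] W ab)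
    also have "(\<Sum>s'\<in>UNIV. W s s' * b s') = (\<Sum>s'\<in>UNIV. \<gamma> s s' / a s)"
      using that by (intro sum.cong) (simp_all add: Wb[symmetric])
    also have "\<dots> = 1" using that \<gamma>(2)[of s] by (simp add: sum_divide_distrib[symmetric])
    finally show ?thesis by simp
  qed
  have inner': "(\<integral>\<^sup>+z. ennreal (W (l z) s') \<partial>\<eta>) = 1" if "0 < b s'" for s'
  proof -
    have "(\<integral>\<^sup>+z. ennreal (W (l z) s') \<partial>\<eta>) = ennreal (\<Sum>s\<in>UNIV. W s s' * a s)"
      by (subst nn_integral_finite_label[where h = "\<lambda>s. ennreal (W s s')"]) (simp_all add: ea ennreal_mult[symmetric] W ab)
    also have "(\<Sum>s\<in>UNIV. W s s' * a s) = (\<Sum>s\<in>UNIV. \<gamma> s s' / b s')"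
      using that by (intro sum.cong) (simp_all add: Wb[symmetric])
    also have "\<dots> = 1" using that \<gamma>(3)[of s'] by (simp add: sum_divide_distrib[symmetric])
    finally show ?thesis by simp
  qed
  have fst_eq: "distr ?\<Gamma> \<eta> fst = \<eta>"
  proof (rule measure_eqI)
    fix A assume "A \<in> sets (distr ?\<Gamma> \<eta> fst)"
    then have A [measurable]: "A \<in> sets \<eta>" by simp
    have "emeasure (distr ?\<Gamma> \<eta> fst) A = (\<integral>\<^sup>+u. indicator A (fst u) \<partial>?\<Gamma>)"
      by (subst nn_integral_distr[symmetric, of fst _ \<eta> "indicator A"]) simp_all
    also have "\<dots> = (\<integral>\<^sup>+z. \<integral>\<^sup>+z'. ennreal (W (l z) (l z')) * indicator A z \<partial>\<eta>' \<partial>\<eta>)"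
      by (subst fub) simp_all
    also have "\<dots> = (\<integral>\<^sup>+z. indicator A z \<partial>\<eta>)"
      by (rule nn_integral_cong_AE) (use AE_pos in \<open>eventually_elim; simp add: nn_integral_multc inner\<close>)
    finally show "emeasure (distr ?\<Gamma> \<eta> fst) A = emeasure \<eta> A" by simp
  qed simp
  have snd_eq: "distr ?\<Gamma> \<eta>' snd = \<eta>'"
  proof (rule measure_eqI)
    fix A assume "A \<in> sets (distr ?\<Gamma> \<eta>' snd)"
    then have A [measurable]: "A \<in> sets \<eta>'" by simp
    have "emeasure (distr ?\<Gamma> \<eta>' snd) A = (\<integral>\<^sup>+u. indicator A (snd u) \<partial>?\<Gamma>)"
      by (subst nn_integral_distr[symmetric, of snd _ \<eta>' "indicator A"]) simp_all
    also have "\<dots> = (\<integral>\<^sup>+z'. \<integral>\<^sup>+z. ennreal (W (l z) (l z')) * indicator A z' \<partial>\<eta> \<partial>\<eta>')"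
      by (subst fub') simp_all
    also have "\<dots> = (\<integral>\<^sup>+z'. indicator A z' \<partial>\<eta>')"
      by (rule nn_integral_cong_AE) (use AE_pos' in \<open>eventually_elim; simp add: nn_integral_multc inner'\<close>)
    finally show "emeasure (distr ?\<Gamma> \<eta>' snd) A = emeasure \<eta>' A" by simp
  qed simp
  have "prob_space ?\<Gamma>"
  proof (rule prob_spaceI)
    have "emeasure ?\<Gamma> (space ?\<Gamma>) = emeasure (distr ?\<Gamma> \<eta> fst) (space \<eta>)"
      by (subst emeasure_distr) (auto intro!: arg_cong2[where f = emeasure] simp: space_pair_measure)
    then show "emeasure ?\<Gamma> (space ?\<Gamma>) = 1" by (simp add: fst_eq \<eta>.emeasure_space_1)
  qed
  then have mem: "?\<Gamma> \<in> couplings \<eta> \<eta>'"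
    using fst_eq snd_eq by (simp add: couplings_def)
  have ne [measurable]: "{u\<in>space (\<eta> \<Otimes>\<^sub>M \<eta>'). l (fst u) \<noteq> l (snd u)} \<in> sets (\<eta> \<Otimes>\<^sub>M \<eta>')"
    by measurable
  have "emeasure ?\<Gamma> {u\<in>space ?\<Gamma>. l (fst u) \<noteq> l (snd u)} = (\<integral>\<^sup>+u. (if l (fst u) = l (snd u) then 0 else 1) \<partial>?\<Gamma>)"
  proof -
    have "emeasure ?\<Gamma> {u\<in>space ?\<Gamma>. l (fst u) \<noteq> l (snd u)}
      = (\<integral>\<^sup>+u. indicator {u\<in>space (\<eta> \<Otimes>\<^sub>M \<eta>'). l (fst u) \<noteq> l (snd u)} u \<partial>?\<Gamma>)"
      using ne by simp
    also have "\<dots> = (\<integral>\<^sup>+u. (if l (fst u) = l (snd u) then 0 else 1) \<partial>?\<Gamma>)"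
      by (intro nn_integral_cong) (auto simp: indicator_def)
    finally show ?thesis .
  qed
  also have "\<dots> = (\<integral>\<^sup>+z. \<integral>\<^sup>+z'. ennreal (W (l z) (l z')) * (if l z = l z' then 0 else 1) \<partial>\<eta>' \<partial>\<eta>)"
    by (subst fub) simp_all
  also have "\<dots> = (\<integral>\<^sup>+z. (\<Sum>s'\<in>UNIV. ennreal (W (l z) s') * (if l z = s' then 0 else 1) * ennreal (b s')) \<partial>\<eta>)"
  proof (rule nn_integral_cong)
    fix z
    show "(\<integral>\<^sup>+z'. ennreal (W (l z) (l z')) * (if l z = l z' then 0 else 1) \<partial>\<eta>') =
      (\<Sum>s'\<in>UNIV. ennreal (W (l z) s') * (if l z = s' then 0 else 1) * ennreal (b s'))"
      by (subst nn_integral_finite_label[where h = "\<lambda>s'. ennreal (W (l z) s') * (if l z = s' then 0 else 1)"])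
         (simp_all add: eb)
  qed
  also have "\<dots> = (\<Sum>s\<in>UNIV. (\<Sum>s'\<in>UNIV. ennreal (W s s') * (if s = s' then 0 else 1) * ennreal (b s')) * ennreal (a s))"
    by (subst nn_integral_finite_label[where h = "\<lambda>s. \<Sum>s'\<in>UNIV. ennreal (W s s') * (if s = s' then 0 else 1) * ennreal (b s')"])
       (simp_all add: ea)
  also have "\<dots> = (\<Sum>s\<in>UNIV. \<Sum>s'\<in>UNIV. ennreal (if s = s' then 0 else \<gamma> s s'))"
    unfolding sum_distrib_right
    by (intro sum.cong refl) (auto simp: ennreal_mult[symmetric] W ab Wb[symmetric])
  also have "\<dots> = ennreal (\<Sum>s\<in>UNIV. \<Sum>s'\<in>UNIV. if s = s' then 0 else \<gamma> s s')"
    using \<gamma>(1) by (simp add: sum_ennreal sum_nonneg)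
  also have "\<dots> \<le> ennreal (\<Sum>s\<in>UNIV. \<bar>a s - b s\<bar>)"
    using \<gamma>(4) by (rule ennreal_leI)
  finally show ?thesis
    using that[OF mem] by (simp add: a_def b_def)
qed

lemma couplings_D:
  assumes "\<Gamma> \<in> couplings \<eta> \<eta>'"
  shows "prob_space \<Gamma>" "sets \<Gamma> = sets (\<eta> \<Otimes>\<^sub>M \<eta>')" "space \<Gamma> = space \<eta> \<times> space \<eta>'"
    "distr \<Gamma> \<eta> fst = \<eta>" "distr \<Gamma> \<eta>' snd = \<eta>'"
  using assms sets_eq_imp_space_eq[of \<Gamma> "\<eta> \<Otimes>\<^sub>M \<eta>'"] by (auto simp: couplings_def space_pair_measure)

lemma nn_integral_coupling_fst:
  assumes \<Gamma>: "\<Gamma> \<in> couplings \<eta> \<eta>'" and f: "f \<in> borel_measurable \<eta>"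
  shows "(\<integral>\<^sup>+u. f (fst u) \<partial>\<Gamma>) = (\<integral>\<^sup>+z. f z \<partial>\<eta>)"
proof -
  have "fst \<in> \<Gamma> \<rightarrow>\<^sub>M \<eta>" by (simp add: measurable_cong_sets[OF couplings_D(2)[OF \<Gamma>] refl])
  then have "(\<integral>\<^sup>+u. f (fst u) \<partial>\<Gamma>) = (\<integral>\<^sup>+z. f z \<partial>distr \<Gamma> \<eta> fst)"
    using f by (subst nn_integral_distr) simp_all
  then show ?thesis by (simp add: couplings_D(4)[OF \<Gamma>])
qed

lemma nn_integral_coupling_snd:
  assumes \<Gamma>: "\<Gamma> \<in> couplings \<eta> \<eta>'" and f: "f \<in> borel_measurable \<eta>'"
  shows "(\<integral>\<^sup>+u. f (snd u) \<partial>\<Gamma>) = (\<integral>\<^sup>+z. f z \<partial>\<eta>')"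
proof -
  have "snd \<in> \<Gamma> \<rightarrow>\<^sub>M \<eta>'" by (simp add: measurable_cong_sets[OF couplings_D(2)[OF \<Gamma>] refl])
  then have "(\<integral>\<^sup>+u. f (snd u) \<partial>\<Gamma>) = (\<integral>\<^sup>+z. f z \<partial>distr \<Gamma> \<eta>' snd)"
    using f by (subst nn_integral_distr) simp_all
  then show ?thesis by (simp add: couplings_D(5)[OF \<Gamma>])
qed

section \<open>Bounds for the distance, and the exponential rates they yield\<close>

lemma tv_dist_le:
  assumes "\<Gamma> \<in> couplings \<eta> \<eta>'" "measure \<Gamma> {u\<in>space \<Gamma>. fst u \<noteq> snd u} \<le> c"
  shows "tv_dist \<eta> \<eta>' \<le> c"
  unfolding tv_dist_def
  using assms by (intro cINF_lower2[where x = \<Gamma>]) (auto intro!: bdd_belowI[of _ 0])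

text \<open>In every coupling a second component in \<open>A\<close> forces the first one into
  \<open>A\<close> or the two apart.\<close>

lemma tv_dist_ge:
  assumes \<eta>: "prob_space \<eta>" and \<eta>': "prob_space \<eta>'" and sets: "sets \<eta> = sets \<eta>'" and A: "A \<in> sets \<eta>"
    and diag: "{u\<in>space (\<eta> \<Otimes>\<^sub>M \<eta>'). fst u \<noteq> snd u} \<in> sets (\<eta> \<Otimes>\<^sub>M \<eta>')"
  shows "measure \<eta>' A - measure \<eta> A \<le> tv_dist \<eta> \<eta>'"
  unfolding tv_dist_def
proof (rule cINF_greatest)
  \<comment> \<open>A one-point label provides a coupling, so the infimum is not over the empty
    set.\<close>
  obtain \<Gamma> where "\<Gamma> \<in> couplings \<eta> \<eta>'"
    by (rule coupling_of_labels[OF \<eta> \<eta>', of "\<lambda>_. ()"]) (auto intro: that)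
  then show "couplings \<eta> \<eta>' \<noteq> {}" by auto
  fix \<Gamma> assume \<Gamma>: "\<Gamma> \<in> couplings \<eta> \<eta>'"
  interpret \<Gamma>: prob_space \<Gamma> using couplings_D(1)[OF \<Gamma>] .
  note s = measurable_cong_sets[OF couplings_D(2)[OF \<Gamma>] refl]
  have A': "A \<in> sets \<eta>'" using A sets by simp
  have 1: "measure \<eta>' A = measure \<Gamma> (snd -` A \<inter> space \<Gamma>)"
    using arg_cong[OF couplings_D(5)[OF \<Gamma>], of "\<lambda>M. measure M A"] A' by (subst (asm) measure_distr) (simp_all add: s)
  have 2: "measure \<eta> A = measure \<Gamma> (fst -` A \<inter> space \<Gamma>)"
    using arg_cong[OF couplings_D(4)[OF \<Gamma>], of "\<lambda>M. measure M A"] A by (subst (asm) measure_distr) (simp_all add: s)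
  have m1: "snd -` A \<inter> space \<Gamma> \<in> sets \<Gamma>" "fst -` A \<inter> space \<Gamma> \<in> sets \<Gamma>"
    using A A' by (auto intro!: measurable_sets simp: s)
  have m2: "{u\<in>space \<Gamma>. fst u \<noteq> snd u} \<in> sets \<Gamma>"
    using diag by (simp add: couplings_D(2,3)[OF \<Gamma>] space_pair_measure)
  have "measure \<Gamma> (snd -` A \<inter> space \<Gamma>) \<le> measure \<Gamma> ((fst -` A \<inter> space \<Gamma>) \<union> {u\<in>space \<Gamma>. fst u \<noteq> snd u})"
    using m1 m2 by (intro \<Gamma>.finite_measure_mono) auto
  also have "\<dots> \<le> measure \<Gamma> (fst -` A \<inter> space \<Gamma>) + measure \<Gamma> {u\<in>space \<Gamma>. fst u \<noteq> snd u}"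
    using m1 m2 by (intro measure_Un_le) auto
  finally show "measure \<eta>' A - measure \<eta> A \<le> measure \<Gamma> {u\<in>space \<Gamma>. fst u \<noteq> snd u}"
    using 1 2 by simp
qed

text \<open>Taking logarithms and dividing by t removes the constant and the polynomial factor in
  the limit, so every b < r is exceeded eventually.\<close>

lemma decay_rate_ge:
  fixes y :: "real \<Rightarrow> real"
  assumes "\<forall>\<^sub>F t in at_top. y t \<le> C * (1 + t) * exp (- r * t)"
  shows "ereal r \<le> Liminf at_top (\<lambda>t. - (log_ext (y t) / ereal t))"
proof (rule le_Liminf_iff[THEN iffD2], intro allI impI)
  fix a assume a: "a < ereal r"
  obtain b :: real where b: "a < ereal b" "b < r"
    using ereal_dense2[OF a] by auto
  have "((\<lambda>t::real. ln ((\<bar>C\<bar> + 1) * (1 + t)) / t) \<longlongrightarrow> 0) at_top"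
    by real_asymp
  then have "\<forall>\<^sub>F t in at_top. ln ((\<bar>C\<bar> + 1) * (1 + t)) / t < r - b"
    using b by (intro order_tendstoD) auto
  with assms show "\<forall>\<^sub>F t in at_top. a < - (log_ext (y t) / ereal t)"
    using eventually_gt_at_top[of 0]
  proof eventually_elim
    case (elim t)
    show ?case
    proof (cases "0 < y t")
      case True
      have "y t \<le> (\<bar>C\<bar> + 1) * (1 + t) * exp (- r * t)"
        using elim by (elim order_trans) (intro mult_right_mono; simp)
      then have "ln (y t) \<le> ln ((\<bar>C\<bar> + 1) * (1 + t) * exp (- r * t))"
        using True elim by (subst ln_le_cancel_iff) (auto intro!: mult_pos_pos)
      also have "\<dots> = ln ((\<bar>C\<bar> + 1) * (1 + t)) - r * t"
        using elim by (subst ln_mult_pos) (auto intro!: mult_pos_pos)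
      also have "\<dots> < (r - b) * t - r * t"
        using elim by (simp add: divide_less_eq)
      finally have "b * t < - ln (y t)" by (simp add: algebra_simps)
      then have "b < - (ln (y t) / t)"
        using elim by (simp add: field_simps)
      then have "ereal b < - (log_ext (y t) / ereal t)"
        using True elim by (simp add: log_ext_def)
      then show ?thesis using b(1) by (rule less_trans[rotated])
    next
      \<comment> \<open>When \<open>y t\<close> is not positive, \<open>log_ext\<close> is minus
        infinity and the rate is plus infinity, which can only help a lower bound.\<close>
      case False
      then have "- (log_ext (y t) / ereal t) = \<infinity>"
        using elim by (simp add: log_ext_def)
      then show ?thesis using a by auto
    qed
  qed
qed

lemma decay_rate_le:
  fixes y :: "real \<Rightarrow> real"
  assumes c: "0 < c" and "\<forall>\<^sub>F t in at_top. c * exp (- r * t) \<le> y t"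
  shows "Limsup at_top (\<lambda>t. - (log_ext (y t) / ereal t)) \<le> ereal r"
proof (rule Limsup_le_iff[THEN iffD2], intro allI impI)
  fix a assume a: "ereal r < a"
  obtain b :: real where b: "ereal b < a" "r < b"
    using ereal_dense2[OF a] by auto
  have "((\<lambda>t::real. - ln c / t) \<longlongrightarrow> 0) at_top"
    by real_asymp
  then have "\<forall>\<^sub>F t in at_top. - ln c / t < b - r"
    using b by (intro order_tendstoD) auto
  with assms(2) show "\<forall>\<^sub>F t in at_top. - (log_ext (y t) / ereal t) < a"
    using eventually_gt_at_top[of 0]
  proof eventually_elim
    case (elim t)
    have pos: "0 < c * exp (- r * t)" using c by simp
    then have y: "0 < y t" using elim by linarith
    have "ln (c * exp (- r * t)) \<le> ln (y t)"
      using elim pos y by (subst ln_le_cancel_iff) auto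
    moreover have "ln (c * exp (- r * t)) = ln c - r * t"
      using c by (subst ln_mult_pos) auto
    moreover have "- ln c < (b - r) * t"
      using elim by (simp add: field_simps)
    ultimately have "- ln (y t) < b * t" by (simp add: algebra_simps)
    then have "- (ln (y t) / t) < b" using elim by (simp add: field_simps)
    then have "- (log_ext (y t) / ereal t) < ereal b"
      using y elim by (simp add: log_ext_def)
    then show ?case using b(1) by (rule less_trans)
  qed
qed

context jump_flow
begin

subsection \<open>Mixing of the internal state\<close>

text \<open>The synchronous evolution of a pair: both copies read the same noise. As the noise is
  indexed by the step and the state, copies with equal internal state use the same holding times and
  jumps. All later estimates are drawn from such pairs; the others are counted as failures.\<close>

definition push :: "real \<Rightarrow> ((real \<times> 's) \<times> (real \<times> 's)) measure \<Rightarrow> ((real \<times> 's) \<times> (real \<times> 's)) measure" where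
  "push t \<Gamma> = distr (\<Gamma> \<Otimes>\<^sub>M N) (E_space \<Otimes>\<^sub>M E_space) (\<lambda>p. (process \<phi> (fst (fst p)) t (snd p), process \<phi> (snd (fst p)) t (snd p)))"

lemma measurable_process_comp:
  assumes f: "f \<in> M \<rightarrow>\<^sub>M E_space" and h: "h \<in> M \<rightarrow>\<^sub>M N"
  shows "(\<lambda>p. process \<phi> (f p) t (h p)) \<in> M \<rightarrow>\<^sub>M E_space"
proof -
  have "(\<lambda>p. process \<phi> (fst (f p), snd (f p)) t (h p)) \<in> M \<rightarrow>\<^sub>M E_space"
    by (rule measurable_process[OF measurable_const measurable_compose[OF f measurable_fst_E]
          measurable_compose[OF f measurable_snd_E] h]) simp
  then show ?thesis by simp
qed

lemma measurable_push:
  assumes "sets \<Gamma> = sets (E_space \<Otimes>\<^sub>M E_space)"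
  shows "(\<lambda>p. (process \<phi> (fst (fst p)) t (snd p), process \<phi> (snd (fst p)) t (snd p)))
    \<in> \<Gamma> \<Otimes>\<^sub>M N \<rightarrow>\<^sub>M E_space \<Otimes>\<^sub>M E_space"
proof -
  have f: "fst \<in> \<Gamma> \<Otimes>\<^sub>M N \<rightarrow>\<^sub>M E_space \<Otimes>\<^sub>M E_space"
    using measurable_fst[of \<Gamma> N] measurable_cong_sets[OF refl assms, of "\<Gamma> \<Otimes>\<^sub>M N"] by blast
  show ?thesis
    by (rule measurable_Pair; rule measurable_process_comp)
       (rule measurable_compose[OF f measurable_fst] measurable_compose[OF f measurable_snd] measurable_snd)+
qed

lemma nn_integral_push:
  assumes \<Gamma>: "sets \<Gamma> = sets (E_space \<Otimes>\<^sub>M E_space)"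
    and G: "G \<in> borel_measurable (E_space \<Otimes>\<^sub>M E_space)"
  shows "(\<integral>\<^sup>+u. G u \<partial>push t \<Gamma>) = (\<integral>\<^sup>+u. \<integral>\<^sup>+w. G (process \<phi> (fst u) t w, process \<phi> (snd u) t w) \<partial>N \<partial>\<Gamma>)"
proof -
  note m = measurable_push[OF \<Gamma>, of t]
  have "(\<integral>\<^sup>+u. G u \<partial>push t \<Gamma>) = (\<integral>\<^sup>+p. G (process \<phi> (fst (fst p)) t (snd p), process \<phi> (snd (fst p)) t (snd p)) \<partial>(\<Gamma> \<Otimes>\<^sub>M N))"
    unfolding push_def using G by (subst nn_integral_distr[OF m]) simp_all
  also have "\<dots> = (\<integral>\<^sup>+u. \<integral>\<^sup>+w. G (process \<phi> (fst u) t w, process \<phi> (snd u) t w) \<partial>N \<partial>\<Gamma>)"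
    using N.nn_integral_fst[OF measurable_compose[OF m G]] by simp
  finally show ?thesis .
qed

lemma sets_push [simp]: "sets (push t \<Gamma>) = sets (E_space \<Otimes>\<^sub>M E_space)"
  by (simp add: push_def)

lemma nn_integral_TR:
  assumes "g \<in> borel_measurable E_space"
  shows "(\<integral>\<^sup>+z'. g z' \<partial>TR t z) = (\<integral>\<^sup>+w. g (process \<phi> z t w) \<partial>N)"
  unfolding transition_def using assms by (subst nn_integral_distr) (simp_all add: measurable_process')

lemma emeasure_bind_TR:
  assumes "prob_space \<eta>" "sets \<eta> = sets E_space" "A \<in> sets E_space"
  shows "emeasure (\<eta> \<bind> TR t) A = (\<integral>\<^sup>+z. emeasure (TR t z) A \<partial>\<eta>)"
  by (rule emeasure_bind[OF prob_space.not_empty[OF assms(1)] _ assms(3)])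
     (use measurable_TR measurable_cong_sets[OF assms(2) refl] in blast)

lemma sets_bind_TR:
  assumes "prob_space \<eta>" "sets \<eta> = sets E_space"
  shows "sets (\<eta> \<bind> TR t) = sets E_space"
  by (rule sets_bind[OF _ prob_space.not_empty[OF assms(1)]]) simp

text \<open>Each marginal of a synchronous pair forgets the other copy, and a single copy follows
  the semigroup.\<close>

lemma push_coupling:
  assumes \<Gamma>: "\<Gamma> \<in> couplings \<eta> \<eta>'" and \<eta>: "prob_space \<eta>" "sets \<eta> = sets E_space"
    and \<eta>': "prob_space \<eta>'" "sets \<eta>' = sets E_space"
  shows "push t \<Gamma> \<in> couplings (\<eta> \<bind> TR t) (\<eta>' \<bind> TR t)"
proof -
  have s\<Gamma>: "sets \<Gamma> = sets (E_space \<Otimes>\<^sub>M E_space)"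
    unfolding couplings_D(2)[OF \<Gamma>] by (rule sets_pair_measure_cong[OF \<eta>(2) \<eta>'(2)])
  interpret \<Gamma>: prob_space \<Gamma> by (rule couplings_D(1)[OF \<Gamma>])
  interpret \<Gamma>N: pair_prob_space \<Gamma> N ..
  have prob: "prob_space (push t \<Gamma>)"
    unfolding push_def by (rule \<Gamma>N.prob_space_distr[OF measurable_push[OF s\<Gamma>]])
  have em: "(\<lambda>z. emeasure (TR t z) A) \<in> borel_measurable E_space" if "A \<in> sets E_space" for A
    using measurable_nn_integral_TR[of "indicator A" t] that by simp
  have "distr (push t \<Gamma>) (\<eta> \<bind> TR t) fst = \<eta> \<bind> TR t"
  proof (rule measure_eqI)
    fix A assume "A \<in> sets (distr (push t \<Gamma>) (\<eta> \<bind> TR t) fst)"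
    then have A: "A \<in> sets E_space" by (simp add: sets_bind_TR[OF \<eta>])
    have "fst \<in> push t \<Gamma> \<rightarrow>\<^sub>M (\<eta> \<bind> TR t)"
      using measurable_fst[of E_space E_space] measurable_cong_sets[OF sets_push sets_bind_TR[OF \<eta>]] by blast
    then have "emeasure (distr (push t \<Gamma>) (\<eta> \<bind> TR t) fst) A = (\<integral>\<^sup>+u. indicator A (fst u) \<partial>push t \<Gamma>)"
      using A by (subst nn_integral_distr[symmetric, of fst _ "\<eta> \<bind> TR t" "indicator A"])
        (simp_all add: sets_bind_TR[OF \<eta>] measurable_cong_sets[OF sets_bind_TR[OF \<eta>] refl])
    also have "\<dots> = (\<integral>\<^sup>+u. emeasure (TR t (fst u)) A \<partial>\<Gamma>)"
      using A by (subst nn_integral_push[OF s\<Gamma>]) (simp_all add: nn_integral_TR[symmetric])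
    also have "\<dots> = (\<integral>\<^sup>+z. emeasure (TR t z) A \<partial>\<eta>)"
      by (rule nn_integral_coupling_fst[OF \<Gamma>]) (use em[OF A] measurable_cong_sets[OF \<eta>(2) refl] in blast)
    also have "\<dots> = emeasure (\<eta> \<bind> TR t) A"
      by (rule emeasure_bind_TR[OF \<eta> A, symmetric])
    finally show "emeasure (distr (push t \<Gamma>) (\<eta> \<bind> TR t) fst) A = emeasure (\<eta> \<bind> TR t) A" .
  qed simp
  moreover have "distr (push t \<Gamma>) (\<eta>' \<bind> TR t) snd = \<eta>' \<bind> TR t"
  proof (rule measure_eqI)
    fix A assume "A \<in> sets (distr (push t \<Gamma>) (\<eta>' \<bind> TR t) snd)"
    then have A: "A \<in> sets E_space" by (simp add: sets_bind_TR[OF \<eta>'])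
    have "snd \<in> push t \<Gamma> \<rightarrow>\<^sub>M (\<eta>' \<bind> TR t)"
      using measurable_snd[of E_space E_space] measurable_cong_sets[OF sets_push sets_bind_TR[OF \<eta>']] by blast
    then have "emeasure (distr (push t \<Gamma>) (\<eta>' \<bind> TR t) snd) A = (\<integral>\<^sup>+u. indicator A (snd u) \<partial>push t \<Gamma>)"
      using A by (subst nn_integral_distr[symmetric, of snd _ "\<eta>' \<bind> TR t" "indicator A"])
        (simp_all add: sets_bind_TR[OF \<eta>'] measurable_cong_sets[OF sets_bind_TR[OF \<eta>'] refl])
    also have "\<dots> = (\<integral>\<^sup>+u. emeasure (TR t (snd u)) A \<partial>\<Gamma>)"
      using A by (subst nn_integral_push[OF s\<Gamma>]) (simp_all add: nn_integral_TR[symmetric])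
    also have "\<dots> = (\<integral>\<^sup>+z. emeasure (TR t z) A \<partial>\<eta>')"
      by (rule nn_integral_coupling_snd[OF \<Gamma>]) (use em[OF A] measurable_cong_sets[OF \<eta>'(2) refl] in blast)
    also have "\<dots> = emeasure (\<eta>' \<bind> TR t) A"
      by (rule emeasure_bind_TR[OF \<eta>' A, symmetric])
    finally show "emeasure (distr (push t \<Gamma>) (\<eta>' \<bind> TR t) snd) A = emeasure (\<eta>' \<bind> TR t) A" .
  qed simp
  moreover have "sets (push t \<Gamma>) = sets ((\<eta> \<bind> TR t) \<Otimes>\<^sub>M (\<eta>' \<bind> TR t))"
    unfolding sets_push by (rule sets_pair_measure_cong[OF sets_bind_TR[OF \<eta>, symmetric] sets_bind_TR[OF \<eta>', symmetric]])
  ultimately show ?thesis using prob by (simp add: couplings_def)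
qed

text \<open>The first hypothesis says that f is an eigenfunction of the jump generator with
  eigenvalue \<Lambda>, the diagonal being written on the right. The shift by \<open>C\<close> keeps
  the candidate nonnegative, as \<open>ennreal\<close> requires, and is harmless since constants are
  preserved.\<close>

lemma nn_integral_eigen:
  assumes f: "\<And>s. (\<Sum>s'\<in>UNIV. q s s' * f s') = (exit_rate q s + \<Lambda>) * f s" and \<Lambda>: "\<Lambda> \<le> 0"
    and C: "\<And>s. \<bar>f s\<bar> \<le> C" and t: "0 \<le> t" and x: "0 \<le> x"
  shows "(\<integral>\<^sup>+z. ennreal (C + f (snd z)) \<partial>TR t (x, s)) = ennreal (C + exp (\<Lambda> * t) * f s)"
proof -
  have pos: "0 \<le> C + exp (\<Lambda> * r) * f s" if "0 \<le> r" for r s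
  proof -
    have "\<bar>exp (\<Lambda> * r) * f s\<bar> \<le> 1 * C"
      unfolding abs_mult using \<Lambda> that C[of s] by (intro mult_mono) (auto simp: mult_nonpos_nonneg)
    then show ?thesis by linarith
  qed
  have le: "C + exp (\<Lambda> * r) * f s \<le> 2 * C" if "0 \<le> r" for r s
  proof -
    have "\<bar>exp (\<Lambda> * r) * f s\<bar> \<le> 1 * C"
      unfolding abs_mult using \<Lambda> that C[of s] by (intro mult_mono) (auto simp: mult_nonpos_nonneg)
    then show ?thesis by linarith
  qed
  let ?u = "\<lambda>t s r. C + exp (\<Lambda> * (t - r)) * f s"
  let ?u' = "\<lambda>t s r. - \<Lambda> * exp (\<Lambda> * (t - r)) * f s"
  have deriv: "(?u t s has_real_derivative ?u' t s r) (at r)" for t s r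
    by (auto intro!: derivative_eq_intros)
  have Q: "(\<Sum>s'\<in>UNIV. q s s' * ?u t s' r) = exit_rate q s * ?u t s r - ?u' t s r" for t s r
  proof -
    have "(\<Sum>s'\<in>UNIV. q s s' * ?u t s' r) = C * exit_rate q s + exp (\<Lambda> * (t - r)) * (\<Sum>s'\<in>UNIV. q s s' * f s')"
      by (simp add: exit_rate_def algebra_simps sum.distrib sum_distrib_left)
    also have "\<dots> = exit_rate q s * ?u t s r - ?u' t s r"
      unfolding f by (simp add: algebra_simps)
    finally show ?thesis .
  qed
  have gm: "(\<lambda>z. ennreal (C + f (snd z))) \<in> borel_measurable E_space"
    by (rule measurable_compose[OF measurable_snd_E]) simp
  let ?H = "\<lambda>t (x::real) s. ennreal (C + exp (\<Lambda> * t) * f s)"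
  have if_eq: "(if t < fst z then ennreal (C + f (snd (\<Phi> s t x, s))) else ?H (t - fst z) (\<Phi> s (fst z) x) (snd z))
      = ennreal (if t < fst z then C + f s else ?u t (snd z) (fst z))" for t x s z
    by simp
  show ?thesis
  proof (rule antisym)
    show "(\<integral>\<^sup>+z. ennreal (C + f (snd z)) \<partial>TR t (x, s)) \<le> ?H t x s"
    proof (rule comparison_TR_le[where V = ?H and D = "\<lambda>_. {0..}" and B = "2 * C", OF gm])
      show "ennreal (C + f (snd z)) \<le> ennreal (2 * C)" for z
        using le[of 0 "snd z"] by (simp add: ennreal_leI)
      show "(\<integral>\<^sup>+z. (if t < fst z then ennreal (C + f (snd (\<Phi> s t x, s))) else ?H (t - fst z) (\<Phi> s (fst z) x) (snd z)) \<partial>H s) \<le> ?H t x s"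
        if t: "0 \<le> t" for t x s
      proof -
        have "(\<integral>\<^sup>+z. ennreal (if t < fst z then C + f s else ?u t (snd z) (fst z)) \<partial>H s) \<le> ennreal (?u t s 0)"
          by (rule step_le[where u' = "?u' t s", OF t])
             (use pos[of 0 s] pos[of "t - _"] deriv Q in \<open>simp_all\<close>)
        then show ?thesis unfolding if_eq by simp
      qed
    qed (use t x in auto)
    show "?H t x s \<le> (\<integral>\<^sup>+z. ennreal (C + f (snd z)) \<partial>TR t (x, s))"
    proof (rule comparison_TR_ge[where U = ?H and D = "\<lambda>_. {0..}" and B = "2 * C", OF gm])
      show "?H t x s \<le> ennreal (2 * C)" if "0 \<le> t" for t x s
        using le[OF that, of s] by (rule ennreal_leI)
      show "?H t x s \<le> (\<integral>\<^sup>+z. (if t < fst z then ennreal (C + f (snd (\<Phi> s t x, s))) else ?H (t - fst z) (\<Phi> s (fst z) x) (snd z)) \<partial>H s)"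
        if t: "0 \<le> t" for t x s
      proof -
        have "ennreal (?u t s 0) \<le> (\<integral>\<^sup>+z. ennreal (if t < fst z then C + f s else ?u t (snd z) (fst z)) \<partial>H s)"
        proof (rule step_ge[where u' = "?u' t s", OF t])
          show "0 \<le> exit_rate q s * ?u t s r - ?u' t s r" if "0 \<le> r" "r \<le> t" for r
            unfolding Q[symmetric] using that by (intro sum_nonneg mult_nonneg_nonneg q_nonneg pos) simp
        qed (use pos[of 0 s] pos[of "t - _"] deriv Q in \<open>simp_all\<close>)
        then show ?thesis unfolding if_eq by simp
      qed
    qed (use t x in auto)
  qed
qed

lemma integral_eigen:
  assumes f: "\<And>s. (\<Sum>s'\<in>UNIV. q s s' * f s') = (exit_rate q s + \<Lambda>) * f s" and \<Lambda>: "\<Lambda> \<le> 0"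
    and t: "0 \<le> t" and x: "0 \<le> x"
  shows "(\<integral>z. f (snd z) \<partial>TR t (x, s)) = exp (\<Lambda> * t) * f s"
proof -
  interpret prob_space "TR t (x, s)" by (rule prob_space_TR)
  define C where "C = (\<Sum>s\<in>UNIV. \<bar>f s\<bar>)"
  have C: "\<bar>f s\<bar> \<le> C" for s
    unfolding C_def by (rule member_le_sum) auto
  have fm: "(\<lambda>z. f (snd z)) \<in> borel_measurable (TR t (x, s))"
    unfolding measurable_cong_sets[OF sets_TR refl] by (rule measurable_compose[OF measurable_snd_E]) simp
  have int: "integrable (TR t (x, s)) (\<lambda>z. f (snd z))"
    by (rule integrable_const_bound[OF _ fm, of C]) (simp add: C)
  have pos: "0 \<le> C + f s" for s using C[of s] by linarith
  have pos': "0 \<le> C + exp (\<Lambda> * t) * f s"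
  proof -
    have "\<bar>exp (\<Lambda> * t) * f s\<bar> \<le> 1 * C"
      unfolding abs_mult using \<Lambda> t C[of s] by (intro mult_mono) (auto simp: mult_nonpos_nonneg)
    then show ?thesis by linarith
  qed
  have "ennreal (\<integral>z. C + f (snd z) \<partial>TR t (x, s)) = (\<integral>\<^sup>+z. ennreal (C + f (snd z)) \<partial>TR t (x, s))"
    by (rule nn_integral_eq_integral[symmetric]) (use int pos in auto)
  also have "\<dots> = ennreal (C + exp (\<Lambda> * t) * f s)"
    by (rule nn_integral_eigen[OF f \<Lambda> C t x])
  finally have "(\<integral>z. C + f (snd z) \<partial>TR t (x, s)) = C + exp (\<Lambda> * t) * f s"
    using pos pos' by (subst (asm) ennreal_inj) (auto intro!: integral_nonneg_AE)
  then show ?thesis using int prob_space by simp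
qed

text \<open>For \<gamma> > 0 the number \<open>c\<close> is the limiting mean of f. It is left
  existential: what matters is that it does not depend on the starting point, and that the property
  passes to linear combinations, so that it can be checked on eigenfunctions.\<close>

definition mixes :: "real \<Rightarrow> ('s \<Rightarrow> real) \<Rightarrow> bool" where
  "mixes \<gamma> f \<longleftrightarrow> (\<exists>c K. \<forall>t\<ge>0. \<forall>x\<ge>0. \<forall>s. \<bar>(\<integral>z. f (snd z) \<partial>TR t (x, s)) - c\<bar> \<le> K * exp (- \<gamma> * t))"

lemma integrable_state: "integrable (TR t z) (\<lambda>z'. (f :: 's \<Rightarrow> real) (snd z'))"
proof -
  interpret prob_space "TR t z" by (rule prob_space_TR)
  have bound: "\<bar>f s\<bar> \<le> (\<Sum>s\<in>UNIV. \<bar>f s\<bar>)" for s by (rule member_le_sum) auto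
  have fm: "(\<lambda>z. f (snd z)) \<in> borel_measurable (TR t z)"
    unfolding measurable_cong_sets[OF sets_TR refl] by (rule measurable_compose[OF measurable_snd_E]) simp
  show ?thesis
    by (rule integrable_const_bound[OF _ fm, of "\<Sum>s\<in>UNIV. \<bar>f s\<bar>"]) (simp add: bound)
qed

lemma mixes_const: "mixes \<gamma> (\<lambda>_. k)"
proof -
  have "(\<integral>z. k \<partial>TR t y) = k" for t y
    using prob_space.prob_space[OF prob_space_TR, of t y] by simp
  then show ?thesis unfolding mixes_def by (intro exI[of _ k] exI[of _ "0::real"]) simp
qed

lemma mixes_add:
  assumes "mixes \<gamma> f" "mixes \<gamma> g"
  shows "mixes \<gamma> (\<lambda>s. f s + g s)"
proof -
  obtain c K where f0: "\<forall>t\<ge>0. \<forall>x\<ge>0. \<forall>s. \<bar>(\<integral>z. f (snd z) \<partial>TR t (x, s)) - c\<bar> \<le> K * exp (- \<gamma> * t)"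
    using assms(1) unfolding mixes_def by blast
  note 1 = f0[rule_format]
  obtain c' K' where g0: "\<forall>t\<ge>0. \<forall>x\<ge>0. \<forall>s. \<bar>(\<integral>z. g (snd z) \<partial>TR t (x, s)) - c'\<bar> \<le> K' * exp (- \<gamma> * t)"
    using assms(2) unfolding mixes_def by blast
  note 2 = g0[rule_format]
  show ?thesis
    unfolding mixes_def
  proof (rule exI[of _ "c + c'"], rule exI[of _ "K + K'"], intro allI impI)
    fix t x :: real and s :: 's assume "0 \<le> t" "0 \<le> x"
    from 1[OF this, of s] 2[OF this, of s]
    show "\<bar>(\<integral>z. f (snd z) + g (snd z) \<partial>TR t (x, s)) - (c + c')\<bar> \<le> (K + K') * exp (- \<gamma> * t)"
      by (subst Bochner_Integration.integral_add[OF integrable_state integrable_state]) (simp add: algebra_simps)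
  qed
qed

lemma mixes_scale:
  assumes "mixes \<gamma> f"
  shows "mixes \<gamma> (\<lambda>s. k * f s)"
proof -
  obtain c K where f0: "\<forall>t\<ge>0. \<forall>x\<ge>0. \<forall>s. \<bar>(\<integral>z. f (snd z) \<partial>TR t (x, s)) - c\<bar> \<le> K * exp (- \<gamma> * t)"
    using assms unfolding mixes_def by blast
  note 1 = f0[rule_format]
  show ?thesis
    unfolding mixes_def
  proof (rule exI[of _ "k * c"], rule exI[of _ "\<bar>k\<bar> * K"], intro allI impI)
    fix t x :: real and s :: 's assume tx: "0 \<le> t" "0 \<le> x"
    have "\<bar>k * (\<integral>z. f (snd z) \<partial>TR t (x, s)) - k * c\<bar> = \<bar>k\<bar> * \<bar>(\<integral>z. f (snd z) \<partial>TR t (x, s)) - c\<bar>"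
      by (simp add: abs_mult[symmetric] right_diff_distrib)
    also have "\<dots> \<le> \<bar>k\<bar> * (K * exp (- \<gamma> * t))"
      by (intro mult_left_mono 1 tx) simp
    finally show "\<bar>(\<integral>z. k * f (snd z) \<partial>TR t (x, s)) - k * c\<bar> \<le> \<bar>k\<bar> * K * exp (- \<gamma> * t)"
      by (simp add: mult.assoc)
  qed
qed

text \<open>Here the eigenvalue is - \<Lambda>, and the limiting mean is 0; an eigenfunction may
  decay faster than the rate asked for.\<close>

lemma mixes_eigen:
  assumes f: "\<And>s. (\<Sum>s'\<in>UNIV. q s s' * f s') = (exit_rate q s - \<Lambda>) * f s" and \<Lambda>: "\<gamma> \<le> \<Lambda>" "0 \<le> \<Lambda>"
  shows "mixes \<gamma> f"
  unfolding mixes_def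
proof (rule exI[of _ 0], rule exI[of _ "\<Sum>s\<in>UNIV. \<bar>f s\<bar>"], intro allI impI)
  fix t x :: real and s :: 's assume tx: "0 \<le> t" "0 \<le> x"
  have "(\<integral>z. f (snd z) \<partial>TR t (x, s)) = exp (- \<Lambda> * t) * f s"
    by (rule integral_eigen[OF _ _ tx]) (use f \<Lambda> in auto)
  then have "\<bar>(\<integral>z. f (snd z) \<partial>TR t (x, s)) - 0\<bar> = \<bar>f s\<bar> * exp (- \<Lambda> * t)"
    by (simp add: abs_mult mult.commute)
  also have "\<dots> \<le> (\<Sum>s\<in>UNIV. \<bar>f s\<bar>) * exp (- \<gamma> * t)"
    using \<Lambda> tx by (intro mult_mono member_le_sum) (auto intro: mult_right_mono)
  finally show "\<bar>(\<integral>z. f (snd z) \<partial>TR t (x, s)) - 0\<bar> \<le> (\<Sum>s\<in>UNIV. \<bar>f s\<bar>) * exp (- \<gamma> * t)" .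
qed

lemma invariant_D:
  assumes "invariant_prob TR \<pi>"
  shows "prob_space \<pi>" "sets \<pi> = sets E_space" "space \<pi> = {0..} \<times> UNIV" "\<And>t. 0 \<le> t \<Longrightarrow> \<pi> \<bind> TR t = \<pi>"
  using assms sets_eq_imp_space_eq[of \<pi> "E_space :: (real \<times> 's) measure"]
  by (auto simp: invariant_prob_def space_E)

lemma nn_integral_invariant:
  assumes \<pi>: "invariant_prob TR \<pi>" and t: "0 \<le> t" and g: "g \<in> borel_measurable E_space"
  shows "(\<integral>\<^sup>+z. \<integral>\<^sup>+z'. g z' \<partial>TR t z \<partial>\<pi>) = (\<integral>\<^sup>+z. g z \<partial>\<pi>)"
proof -
  have "(\<integral>\<^sup>+z. g z \<partial>(\<pi> \<bind> TR t)) = (\<integral>\<^sup>+z. \<integral>\<^sup>+z'. g z' \<partial>TR t z \<partial>\<pi>)"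
    by (rule nn_integral_bind[OF g]) (use measurable_TR measurable_cong_sets[OF invariant_D(2)[OF \<pi>] refl] in blast)
  then show ?thesis by (simp add: invariant_D(4)[OF \<pi> t])
qed

text \<open>The limit \<open>c\<close> is the same for every starting point. Integrating over \<pi>
  and using invariance puts the mass of \<pi> within the same distance of \<open>c\<close>, so the
  triangle inequality yields 2 K without identifying the stationary law of the states.\<close>

lemma mixing_invariant:
  assumes \<pi>: "invariant_prob TR \<pi>" and mix: "\<And>s. mixes \<gamma> (indicator {s})" and x: "0 \<le> x"
  shows "\<exists>K. \<forall>t\<ge>0. (\<Sum>s'\<in>UNIV. \<bar>measure (TR t (x, s)) {z\<in>space (TR t (x, s)). snd z = s'} -
    measure \<pi> {z\<in>space \<pi>. snd z = s'}\<bar>) \<le> K * exp (- \<gamma> * t)"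
proof -
  interpret \<pi>: prob_space \<pi> by (rule invariant_D(1)[OF \<pi>])
  have sp: "space \<pi> = space E_space" using invariant_D(3)[OF \<pi>] by (simp add: space_E)
  have meas_TR: "measure (TR t z) {z\<in>space E_space. snd z = s'} = (\<integral>y. indicator {s'} (snd y) \<partial>TR t z)" for t z s'
  proof -
    have "(\<integral>y. indicator {s'} (snd y) \<partial>TR t z) = (\<integral>y. indicator {z\<in>space E_space. snd z = s'} y \<partial>TR t z)"
      by (intro Bochner_Integration.integral_cong) (auto simp: indicator_def)
    also have "\<dots> = measure (TR t z) ({z\<in>space E_space. snd z = s'} \<inter> space (TR t z))"
      by (rule Bochner_Integration.integral_indicator)
    also have "{z\<in>space E_space. snd z = s'} \<inter> space (TR t z) = {z\<in>space E_space. snd z = s'}"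
      unfolding space_TR by blast
    finally show ?thesis by (rule sym)
  qed
  have "\<exists>K. \<forall>t\<ge>0. \<bar>measure (TR t (x, s)) {z\<in>space E_space. snd z = s'} - measure \<pi> {z\<in>space E_space. snd z = s'}\<bar> \<le> K * exp (- \<gamma> * t)" for s'
  proof -
    obtain c K where K0: "\<forall>t\<ge>0. \<forall>x\<ge>0. \<forall>s. \<bar>(\<integral>z. indicator {s'} (snd z) \<partial>TR t (x, s)) - c\<bar> \<le> K * exp (- \<gamma> * t)"
      using mix[of s'] unfolding mixes_def by blast
    note K = K0[rule_format]
    show ?thesis
    proof (intro exI[of _ "2 * K"] allI impI)
      fix t :: real assume t: "0 \<le> t"
      let ?A = "{z\<in>space E_space. snd z = s'}"
      have A: "?A \<in> sets E_space" by measurable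
      have TRt: "TR t \<in> \<pi> \<rightarrow>\<^sub>M subprob_algebra E_space"
        using measurable_TR measurable_cong_sets[OF invariant_D(2)[OF \<pi>] refl] by blast
      have int: "integrable \<pi> (\<lambda>z. measure (TR t z) ?A)"
      proof (rule \<pi>.integrable_const_bound[of _ 1])
        show "AE z in \<pi>. norm (measure (TR t z) ?A) \<le> 1"
          by (simp add: prob_space.prob_le_1[OF prob_space_TR])
        show "(\<lambda>z. measure (TR t z) ?A) \<in> borel_measurable \<pi>"
          by (rule measurable_compose[OF TRt measurable_measure_subprob_algebra[OF A]])
      qed
      have "measure (\<pi> \<bind> TR t) ?A = (\<integral>z. measure (TR t z) ?A \<partial>\<pi>)"
        by (rule \<pi>.measure_bind[OF TRt A])
      then have eq: "measure \<pi> ?A - c = (\<integral>z. measure (TR t z) ?A - c \<partial>\<pi>)"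
        using int by (simp add: invariant_D(4)[OF \<pi> t] \<pi>.prob_space)
      have "\<bar>measure \<pi> ?A - c\<bar> \<le> (\<integral>z. \<bar>measure (TR t z) ?A - c\<bar> \<partial>\<pi>)"
        unfolding eq by (rule integral_abs_bound)
      also have "\<dots> \<le> (\<integral>z. K * exp (- \<gamma> * t) \<partial>\<pi>)"
      proof (rule integral_mono)
        fix z assume "z \<in> space \<pi>"
        then have "0 \<le> fst z" by (auto simp: invariant_D(3)[OF \<pi>])
        from K[OF t this, of "snd z"] show "\<bar>measure (TR t z) ?A - c\<bar> \<le> K * exp (- \<gamma> * t)"
          by (simp add: meas_TR)
      qed (use int in auto)
      finally have "\<bar>measure \<pi> ?A - c\<bar> \<le> K * exp (- \<gamma> * t)" by (simp add: \<pi>.prob_space)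
      moreover have "\<bar>measure (TR t (x, s)) ?A - c\<bar> \<le> K * exp (- \<gamma> * t)"
        using K[OF t x, of s] by (simp add: meas_TR)
      ultimately show "\<bar>measure (TR t (x, s)) ?A - measure \<pi> ?A\<bar> \<le> 2 * K * exp (- \<gamma> * t)"
        by linarith
    qed
  qed
  then have "\<forall>s'. \<exists>K. \<forall>t\<ge>0. \<bar>measure (TR t (x, s)) {z\<in>space E_space. snd z = s'} - measure \<pi> {z\<in>space E_space. snd z = s'}\<bar> \<le> K * exp (- \<gamma> * t)" ..
  from choice[OF this] obtain K where
    K: "\<forall>s'. \<forall>t\<ge>0. \<bar>measure (TR t (x, s)) {z\<in>space E_space. snd z = s'} - measure \<pi> {z\<in>space E_space. snd z = s'}\<bar> \<le> K s' * exp (- \<gamma> * t)" ..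
  have "(\<Sum>s'\<in>UNIV. \<bar>measure (TR t (x, s)) {z\<in>space E_space. snd z = s'} - measure \<pi> {z\<in>space E_space. snd z = s'}\<bar>)
    \<le> (\<Sum>s'\<in>UNIV. K s') * exp (- \<gamma> * t)" if "0 \<le> t" for t
    unfolding sum_distrib_right using that K by (intro sum_mono) auto
  then show ?thesis by (auto simp: sp)
qed

text \<open>Couple the internal states up to time \<open>t\<close>, then drive both copies with the same noise.\<close>

lemma coupling_invariant:
  assumes \<pi>: "invariant_prob TR \<pi>" and mix: "\<And>s. mixes \<gamma> (indicator {s})" and x: "0 \<le> x"
  shows "\<exists>K\<ge>0. \<forall>t\<ge>0. \<forall>u\<ge>0. \<exists>\<Gamma>\<in>couplings (TR t (x, s)) \<pi>.
    emeasure \<Gamma> {p\<in>space \<Gamma>. snd (fst p) \<noteq> snd (snd p)} \<le> ennreal (K * exp (- \<gamma> * t)) \<and>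
    push u \<Gamma> \<in> couplings (TR (t + u) (x, s)) \<pi>"
proof -
  obtain K where K: "\<And>t. 0 \<le> t \<Longrightarrow> (\<Sum>s'\<in>UNIV. \<bar>measure (TR t (x, s)) {z\<in>space (TR t (x, s)). snd z = s'} -
    measure \<pi> {z\<in>space \<pi>. snd z = s'}\<bar>) \<le> K * exp (- \<gamma> * t)"
    using mixing_invariant[OF \<pi> mix x] by blast
  have m1: "snd \<in> TR t (x, s) \<rightarrow>\<^sub>M count_space UNIV" for t
    unfolding measurable_cong_sets[OF sets_TR refl] by (rule measurable_snd_E)
  have m2: "snd \<in> \<pi> \<rightarrow>\<^sub>M count_space UNIV"
    unfolding measurable_cong_sets[OF invariant_D(2)[OF \<pi>] refl] by (rule measurable_snd_E)
  show ?thesis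
  proof (rule exI[of _ "\<bar>K\<bar>"], intro conjI allI impI)
    fix t u :: real assume tu: "0 \<le> t" "0 \<le> u"
    obtain \<Gamma> where \<Gamma>: "\<Gamma> \<in> couplings (TR t (x, s)) \<pi>"
      "emeasure \<Gamma> {p\<in>space \<Gamma>. snd (fst p) \<noteq> snd (snd p)} \<le>
        ennreal (\<Sum>s'\<in>UNIV. \<bar>measure (TR t (x, s)) {z\<in>space (TR t (x, s)). snd z = s'} - measure \<pi> {z\<in>space \<pi>. snd z = s'}\<bar>)"
      by (rule coupling_of_labels[OF prob_space_TR[of t "(x, s)"] invariant_D(1)[OF \<pi>] m1 m2])
    have "K * exp (- \<gamma> * t) \<le> \<bar>K\<bar> * exp (- \<gamma> * t)" by (intro mult_right_mono) auto
    then have "emeasure \<Gamma> {p\<in>space \<Gamma>. snd (fst p) \<noteq> snd (snd p)} \<le> ennreal (\<bar>K\<bar> * exp (- \<gamma> * t))"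
      by (intro order_trans[OF \<Gamma>(2)] ennreal_leI order_trans[OF K[OF tu(1)]])
    moreover have "push u \<Gamma> \<in> couplings (TR (t + u) (x, s)) \<pi>"
      using push_coupling[OF \<Gamma>(1) prob_space_TR sets_TR invariant_D(1,2)[OF \<pi>], of u]
      by (simp add: bind_TR[OF tu x] invariant_D(4)[OF \<pi> tu(2)])
    ultimately show "\<exists>\<Gamma>\<in>couplings (TR t (x, s)) \<pi>.
      emeasure \<Gamma> {p\<in>space \<Gamma>. snd (fst p) \<noteq> snd (snd p)} \<le> ennreal (\<bar>K\<bar> * exp (- \<gamma> * t)) \<and>
      push u \<Gamma> \<in> couplings (TR (t + u) (x, s)) \<pi>"
      using \<Gamma>(1) by blast
  qed simp
qed

end

subsection \<open>Piecewise constant drift\<close>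

lemma sets_diagonal_E: "{u\<in>space ((E_space :: (real \<times> 's::finite) measure) \<Otimes>\<^sub>M E_space). fst u \<noteq> snd u} \<in> sets (E_space \<Otimes>\<^sub>M E_space)"
proof -
  have "{u\<in>space ((E_space :: (real \<times> 's) measure) \<Otimes>\<^sub>M E_space).
      fst (fst u) \<noteq> fst (snd u) \<or> snd (fst u) \<noteq> snd (snd u)} \<in> sets (E_space \<Otimes>\<^sub>M E_space)"
    by measurable
  then show ?thesis by (simp only: prod_eq_iff de_Morgan_conj)
qed

lemma measurable_neq_E:
  "(\<lambda>u. if fst u = snd u then 0 else 1 :: ennreal) \<in> borel_measurable ((E_space :: (real \<times> 's::finite) measure) \<Otimes>\<^sub>M E_space)"
proof -
  have "(\<lambda>u. indicator {u\<in>space ((E_space :: (real \<times> 's) measure) \<Otimes>\<^sub>M E_space). fst u \<noteq> snd u} u :: ennreal) \<in> borel_measurable (E_space \<Otimes>\<^sub>M E_space)"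
    by (rule borel_measurable_indicator[OF sets_diagonal_E])
  then show ?thesis by (rule measurable_cong[THEN iffD1, rotated]) (auto simp: indicator_def)
qed

locale linear_jump =
  fixes q :: "'s::finite \<Rightarrow> 's \<Rightarrow> real" and d :: "'s \<Rightarrow> real"
  assumes q_nonneg': "0 \<le> q s s'" and exit_pos': "0 < exit_rate q s"
begin

sublocale jump_flow q "\<lambda>s t x. x + d s * t"
proof
  show "max 0 (max 0 (x + d s * r) + d s * t) = max 0 (x + d s * (r + t))" if "0 \<le> x" "0 \<le> r" "0 \<le> t" for s x r t
  proof (cases "0 \<le> d s")
    case True
    then have "0 \<le> x + d s * r" "0 \<le> d s * t" using that by auto
    then show ?thesis by (simp add: algebra_simps)
  next
    case False
    then have "d s * t \<le> 0" using that by (intro mult_nonpos_nonneg) auto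
    then show ?thesis by (auto simp: algebra_simps max_def)
  qed
qed (use q_nonneg' exit_pos' in auto)

section \<open>Two copies until they merge, and exponential moments of one copy\<close>

lemma \<Phi>_eq: "\<Phi> s t x = max 0 (x + d s * t)"
  by (simp add: \<Phi>_def)

lemma exp_drift_deriv:
  "((\<lambda>r. exp (\<Lambda> * (t - r)) * exp (\<theta> * (x + d s * r)) * f s) has_real_derivative
    (\<theta> * d s - \<Lambda>) * (exp (\<Lambda> * (t - r)) * exp (\<theta> * (x + d s * r)) * f s)) (at r)"
  by (auto intro!: derivative_eq_intros simp: algebra_simps)

text \<open>Driven by the same noise, the copies stay ordered, at a distance that changes only
  through reflection of the lower one, and they agree once the upper one has been at 0. While they
  differ, the upper one is not reflected, so the exponential of its position meets no boundary
  term.\<close>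

lemma merge_prob_le:
  assumes \<theta>: "0 < \<theta>" and f: "\<And>s. 1 \<le> f s"
    and Q: "\<And>s. (\<Sum>s'\<in>UNIV. q s s' * f s') \<le> (exit_rate q s + \<Lambda> - \<theta> * d s) * f s"
    and t: "0 \<le> t" and p: "0 \<le> fst p" "0 \<le> snd p"
  shows "joint_mean t p s (\<lambda>u. if fst u = snd u then 0 else 1) \<le> ennreal (exp (\<Lambda> * t) * exp (\<theta> * max (fst p) (snd p)) * f s)"
proof -
  have f0: "0 \<le> f s" for s using f[of s] by linarith
  let ?G = "\<lambda>u. if fst u = snd u then 0 else 1 :: ennreal"
  note G = measurable_neq_E
  let ?\<Theta> = "\<lambda>s r p. (\<Phi> s r (fst p), \<Phi> s r (snd p))"
  \<comment> \<open>Zero on the diagonal: merged copies stay merged, and there both sides of the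
    comparison vanish.\<close>
  let ?V = "\<lambda>t p s. if fst p = snd p then 0 else ennreal (exp (\<Lambda> * t) * exp (\<theta> * max (fst p) (snd p)) * f s)"
  let ?g = "\<lambda>p (s::'s). ?G ((fst p, s), (snd p, s))"
  have "joint_mean t p s ?G \<le> ?V t p s"
  proof (rule comparison[where \<Theta> = ?\<Theta> and D = "\<lambda>_. {p. 0 \<le> fst p \<and> 0 \<le> snd p}" and g = ?g and B = 1
        and U = "\<lambda>t p s. joint_mean t p s ?G"])
    show "joint_mean t p s ?G \<le> (\<integral>\<^sup>+z. (if t < fst z then ?g (?\<Theta> s t p) s else joint_mean (t - fst z) (?\<Theta> s (fst z) p) (snd z) ?G) \<partial>H s)"
      if "0 \<le> t" for t p s
      by (subst renewal[OF G that]) simp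
    show "joint_mean t p s ?G \<le> ennreal 1" for t p s
    proof -
      have "joint_mean t p s ?G \<le> (\<integral>\<^sup>+w. 1 \<partial>N)" unfolding joint_mean_def by (intro nn_integral_mono) simp
      then show ?thesis by (simp add: N.emeasure_space_1[simplified])
    qed
    show "(\<lambda>r. ?V (t - r) (?\<Theta> s r p) s') \<in> borel_measurable borel" for t p s s'
      by measurable
    show "(\<integral>\<^sup>+z. (if t < fst z then ?g (?\<Theta> s t p) s else ?V (t - fst z) (?\<Theta> s (fst z) p) (snd z)) \<partial>H s) \<le> ?V t p s"
      if t: "0 \<le> t" for t p s
    proof (cases "fst p = snd p")
      case True
      then show ?thesis by (simp cong: if_cong)
    next
      case False
      define m where "m = max (fst p) (snd p)"
      \<comment> \<open>The images can differ only if the larger one is strictly positive, that is,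
        equal to its unreflected value.\<close>
      have m: "max (\<Phi> s r (fst p)) (\<Phi> s r (snd p)) = m + d s * r \<and> 0 \<le> m + d s * r" if "\<Phi> s r (fst p) \<noteq> \<Phi> s r (snd p)" for r
        using that by (auto simp: m_def \<Phi>_eq max_def split: if_splits)
      let ?u = "\<lambda>r. exp (\<Lambda> * (t - r)) * exp (\<theta> * (m + d s * r)) * f s"
      let ?b = "\<lambda>r s'. exp (\<Lambda> * (t - r)) * exp (\<theta> * (m + d s * r)) * f s'"
      have "(\<integral>\<^sup>+z. (if t < fst z then ?g (?\<Theta> s t p) s else ?V (t - fst z) (?\<Theta> s (fst z) p) (snd z)) \<partial>H s)
        \<le> (\<integral>\<^sup>+z. ennreal (if t < fst z then ?u t else ?b (fst z) (snd z)) \<partial>H s)"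
      proof (rule nn_integral_mono)
        fix z
        have "?g (?\<Theta> s t p) s \<le> ennreal (?u t)"
        proof (cases "\<Phi> s t (fst p) = \<Phi> s t (snd p)")
          case False
          then have "0 \<le> \<theta> * (m + d s * t)" using m \<theta> by auto
          then have "1 * 1 \<le> exp (\<theta> * (m + d s * t)) * f s" using f by (intro mult_mono) auto
          then show ?thesis by simp
        qed simp
        moreover have "?V (t - fst z) (?\<Theta> s (fst z) p) (snd z) \<le> ennreal (?b (fst z) (snd z))"
          using m[of "fst z"] by (auto simp del: mult_exp_exp)
        ultimately show "(if t < fst z then ?g (?\<Theta> s t p) s else ?V (t - fst z) (?\<Theta> s (fst z) p) (snd z))
          \<le> ennreal (if t < fst z then ?u t else ?b (fst z) (snd z))"
          by (simp only: if_distrib[of ennreal] split: if_split) simp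
      qed
      also have "\<dots> \<le> ennreal (?u 0)"
      proof (rule step_le[OF t, where u' = "\<lambda>r. (\<theta> * d s - \<Lambda>) * ?u r"])
        show "(\<Sum>s'\<in>UNIV. q s s' * ?b r s') \<le> exit_rate q s * ?u r - (\<theta> * d s - \<Lambda>) * ?u r" for r
        proof -
          have "(\<Sum>s'\<in>UNIV. q s s' * ?b r s') = exp (\<Lambda> * (t - r)) * exp (\<theta> * (m + d s * r)) * (\<Sum>s'\<in>UNIV. q s s' * f s')"
            unfolding sum_distrib_left by (intro sum.cong) (simp_all add: mult_ac del: mult_exp_exp)
          also have "\<dots> \<le> exp (\<Lambda> * (t - r)) * exp (\<theta> * (m + d s * r)) * ((exit_rate q s + \<Lambda> - \<theta> * d s) * f s)"
            by (rule mult_left_mono[OF Q]) simp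
          finally show ?thesis by (simp add: algebra_simps del: mult_exp_exp)
        qed
        show "(?u has_real_derivative (\<theta> * d s - \<Lambda>) * ?u r) (at r)" for r
          by (rule exp_drift_deriv)
      qed (use f0 in auto)
      finally show ?thesis using False by (simp add: m_def)
    qed
  qed (use t p in auto)
  then show ?thesis by (auto split: if_splits)
qed

text \<open>Reflection adds at most 1 to exp (\<theta> x). The resulting source, bounded by K exp (L
  t) with L = max 0 \<Lambda>, accumulates to the term K (1 + t) exp (L t). The weight is truncated
  at n because the comparison asks for a bounded subsolution, and monotone convergence removes the
  truncation.\<close>

lemma lyapunov:
  assumes \<theta>: "0 < \<theta>" and f: "\<And>s. 1 \<le> f s"
    and Q: "\<And>s. (\<Sum>s'\<in>UNIV. q s s' * f s') \<le> (exit_rate q s + \<Lambda> - \<theta> * d s) * f s"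
  obtains K where "0 \<le> K" "\<And>t x s. 0 \<le> t \<Longrightarrow> 0 \<le> x \<Longrightarrow>
    (\<integral>\<^sup>+z. ennreal (exp (\<theta> * fst z) * f (snd z)) \<partial>TR t (x, s))
      \<le> ennreal (exp (\<Lambda> * t) * (exp (\<theta> * x) * f s) + K * (1 + t) * exp (max 0 \<Lambda> * t))"
proof -
  have f0: "0 \<le> f s" for s using f[of s] by linarith
  \<comment> \<open>\<open>K\<close> dominates both what reflection adds to the final value and the
    source it creates through a jump.\<close>
  define K where "K = (\<Sum>s\<in>UNIV. f s) + (\<Sum>s\<in>UNIV. \<Sum>s'\<in>UNIV. q s s' * f s')"
  have sum0: "0 \<le> (\<Sum>s'\<in>UNIV. q s s' * f s')" for s
    by (intro sum_nonneg mult_nonneg_nonneg q_nonneg f0)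
  have K1: "f s \<le> K" for s
    using member_le_sum[of s UNIV f] f0 sum_nonneg[of UNIV "\<lambda>s. \<Sum>s'\<in>UNIV. q s s' * f s'"] sum0 by (auto simp: K_def)
  have K2: "(\<Sum>s'\<in>UNIV. q s s' * f s') \<le> K" for s
    using member_le_sum[of s UNIV "\<lambda>s. \<Sum>s'\<in>UNIV. q s s' * f s'"] sum0 sum_nonneg[of UNIV f] f0 by (auto simp: K_def)
  have K0: "0 \<le> K" using K1 f0 order_trans by blast
  define L where "L = max 0 \<Lambda>"
  have L: "0 \<le> L" "\<Lambda> \<le> L" by (auto simp: L_def)
  let ?h = "\<lambda>z. exp (\<theta> * fst z) * f (snd z)"
  let ?V = "\<lambda>t x s. exp (\<Lambda> * t) * exp (\<theta> * x) * f s + K * (1 + t) * exp (L * t)"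
  have hm: "?h \<in> borel_measurable E_space"
    by (intro borel_measurable_times measurable_compose[OF measurable_snd_E] measurable_compose[OF measurable_fst_E]) measurable
  have trunc: "(\<integral>\<^sup>+z. ennreal (min (real n) (?h z)) \<partial>TR t (x, s)) \<le> ennreal (?V t x s)" if t: "0 \<le> t" and x: "0 \<le> x" for n t x s
  proof (rule comparison_TR_le[where V = "\<lambda>t x s. ennreal (?V t x s)" and D = "\<lambda>_. {0..}" and B = "real n"])
    show "(\<lambda>z. ennreal (min (real n) (?h z))) \<in> borel_measurable E_space"
      using hm by measurable
    show "(\<integral>\<^sup>+z. (if t < fst z then ennreal (min (real n) (?h (\<Phi> s t x, s))) else ennreal (?V (t - fst z) (\<Phi> s (fst z) x) (snd z))) \<partial>H s)
      \<le> ennreal (?V t x s)" if t: "0 \<le> t" for t x s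
    proof -
      let ?u1 = "\<lambda>r. exp (\<Lambda> * (t - r)) * exp (\<theta> * (x + d s * r)) * f s"
      let ?u2 = "\<lambda>r. K * (1 + (t - r)) * exp (L * (t - r))"
      let ?u2' = "\<lambda>r. - K * exp (L * (t - r)) - L * ?u2 r"
      let ?b = "\<lambda>r s'. ?V (t - r) (\<Phi> s r x) s'"
      have expmax: "exp (\<theta> * \<Phi> s r x) \<le> exp (\<theta> * (x + d s * r)) + 1" for r
        by (auto simp: \<Phi>_eq max_def)
      have "(\<integral>\<^sup>+z. ennreal (if t < fst z then min (real n) (?h (\<Phi> s t x, s)) else ?b (fst z) (snd z)) \<partial>H s)
        \<le> ennreal (?u1 0 + ?u2 0)"
      proof (rule step_le[OF t, where u = "\<lambda>r. ?u1 r + ?u2 r" and u' = "\<lambda>r. (\<theta> * d s - \<Lambda>) * ?u1 r + ?u2' r"])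
        show "0 \<le> min (real n) (?h (\<Phi> s t x, s))" using f0 by simp
        show "min (real n) (?h (\<Phi> s t x, s)) \<le> ?u1 t + ?u2 t"
        proof -
          have "?h (\<Phi> s t x, s) \<le> (exp (\<theta> * (x + d s * t)) + 1) * f s"
            using expmax f0 by (auto intro!: mult_right_mono)
          then show ?thesis using K1[of s] by (simp add: algebra_simps min_le_iff_disj)
        qed
        show "0 \<le> ?b r s'" if "0 \<le> r" "r \<le> t" for r s'
          using that K0 f0 by (intro add_nonneg_nonneg mult_nonneg_nonneg) auto
        show "((\<lambda>r. ?u1 r + ?u2 r) has_real_derivative (\<theta> * d s - \<Lambda>) * ?u1 r + ?u2' r) (at r)" for r
          by (rule DERIV_add[OF exp_drift_deriv]) (auto intro!: derivative_eq_intros simp: algebra_simps)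
        show "(\<Sum>s'\<in>UNIV. q s s' * ?b r s') \<le> exit_rate q s * (?u1 r + ?u2 r) - ((\<theta> * d s - \<Lambda>) * ?u1 r + ?u2' r)"
          if r: "0 \<le> r" "r \<le> t" for r
        proof -
          let ?e = "exp (\<Lambda> * (t - r))"
          have "(\<Sum>s'\<in>UNIV. q s s' * ?b r s') = ?e * exp (\<theta> * \<Phi> s r x) * (\<Sum>s'\<in>UNIV. q s s' * f s') + exit_rate q s * ?u2 r"
            by (simp add: exit_rate_def sum_distrib_left sum_distrib_right sum.distrib[symmetric] algebra_simps del: mult_exp_exp)
          also have "?e * exp (\<theta> * \<Phi> s r x) * (\<Sum>s'\<in>UNIV. q s s' * f s')
            \<le> ?e * (exp (\<theta> * (x + d s * r)) + 1) * (\<Sum>s'\<in>UNIV. q s s' * f s')"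
            using expmax sum0 by (intro mult_right_mono mult_left_mono) auto
          also have "\<dots> = ?e * exp (\<theta> * (x + d s * r)) * (\<Sum>s'\<in>UNIV. q s s' * f s') + ?e * (\<Sum>s'\<in>UNIV. q s s' * f s')"
            by (simp add: algebra_simps del: mult_exp_exp)
          also have "?e * exp (\<theta> * (x + d s * r)) * (\<Sum>s'\<in>UNIV. q s s' * f s')
            \<le> ?e * exp (\<theta> * (x + d s * r)) * ((exit_rate q s + \<Lambda> - \<theta> * d s) * f s)"
            by (rule mult_left_mono[OF Q]) simp
          also have "?e * (\<Sum>s'\<in>UNIV. q s s' * f s') \<le> exp (L * (t - r)) * K"
            using L r K2 sum0 by (intro mult_mono) (auto intro!: mult_right_mono)
          finally have "(\<Sum>s'\<in>UNIV. q s s' * ?b r s') \<le> (exit_rate q s + \<Lambda> - \<theta> * d s) * ?u1 r + K * exp (L * (t - r)) + exit_rate q s * ?u2 r"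
            by (simp add: mult_ac del: mult_exp_exp)
          moreover have "0 \<le> L * ?u2 r" using L r K0 by (intro mult_nonneg_nonneg) auto
          ultimately show ?thesis by (simp add: algebra_simps del: mult_exp_exp)
        qed
      qed measurable
      then show ?thesis by (simp add: if_distrib[of ennreal] del: mult_exp_exp)
    qed
  qed (use t x in \<open>auto intro!: ennreal_leI\<close>)
  show ?thesis
  proof (rule that[OF K0])
    fix t x :: real and s assume t: "0 \<le> t" and x: "0 \<le> x"
    have "(\<integral>\<^sup>+z. ennreal (?h z) \<partial>TR t (x, s)) = (\<integral>\<^sup>+z. (SUP n. ennreal (min (real n) (?h z))) \<partial>TR t (x, s))"
    proof (rule nn_integral_cong)
      fix z
      have "(\<lambda>n. ennreal (min (real n) (?h z))) \<longlonglongrightarrow> ennreal (?h z)"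
      proof (rule tendsto_eventually)
        obtain n0 where "?h z \<le> real n0" using real_arch_simple by blast
        then show "\<forall>\<^sub>F n in sequentially. ennreal (min (real n) (?h z)) = ennreal (?h z)"
          by (intro eventually_sequentiallyI[of n0]) auto
      qed
      moreover have "incseq (\<lambda>n. ennreal (min (real n) (?h z)))"
        by (auto simp: incseq_def intro!: ennreal_leI)
      ultimately show "ennreal (?h z) = (SUP n. ennreal (min (real n) (?h z)))"
        using LIMSEQ_SUP LIMSEQ_unique by blast
    qed
    also have "\<dots> = (SUP n. \<integral>\<^sup>+z. ennreal (min (real n) (?h z)) \<partial>TR t (x, s))"
    proof (rule nn_integral_monotone_convergence_SUP)
      show "incseq (\<lambda>n z. ennreal (min (real n) (?h z)))"
        by (auto simp: incseq_def le_fun_def intro!: ennreal_leI)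
      show "(\<lambda>z. ennreal (min (real n) (?h z))) \<in> borel_measurable (TR t (x, s))" for n
        unfolding measurable_cong_sets[OF sets_TR refl] using hm by measurable
    qed
    also have "\<dots> \<le> ennreal (?V t x s)"
      by (rule SUP_least) (rule trunc[OF t x])
    finally show "(\<integral>\<^sup>+z. ennreal (?h z) \<partial>TR t (x, s))
      \<le> ennreal (exp (\<Lambda> * t) * (exp (\<theta> * x) * f s) + K * (1 + t) * exp (max 0 \<Lambda> * t))"
      by (simp add: L_def mult.assoc del: mult_exp_exp)
  qed
qed


section \<open>Exponential moments and tails of the invariant measure, and the rates they
  give\<close>

lemma measurable_lyapunov_fun: "(\<lambda>z. exp (\<theta> * fst z) * f (snd z)) \<in> borel_measurable E_space"
  by (intro borel_measurable_times measurable_compose[OF measurable_snd_E] measurable_compose[OF measurable_fst_E]) measurable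

text \<open>The eigenvalue conditions are homogeneous in the weight, so it may be rescaled; the
  lower bound 1 is what lets the weight dominate a final value 1.\<close>

lemma normalize_weight:
  assumes f: "\<And>s. (0::real) < f s"
  obtains k where "0 < k" "\<And>s::'s. 1 \<le> k * f s"
proof
  let ?m = "Min (range f)"
  have m: "0 < ?m" using f by (subst Min_gr_iff) auto
  then show "0 < 1 / ?m" by simp
  fix s
  have "?m \<le> f s" by (intro Min_le) auto
  then show "1 \<le> 1 / ?m * f s" using m by simp
qed

text \<open>
  With \<open>h\<close> the weight and \<open>P h \<le> h / 2 + K\<close>, invariance gives that the function
  \<open>min n h - min n (h / 2 + K) + K\<close> has integral at most \<open>K\<close>; it is nonnegative and tends to \<open>h / 2\<close>.
\<close>

lemma invariant_moment:
  assumes \<pi>: "invariant_prob TR \<pi>" and \<theta>: "0 < \<theta>" and f: "\<And>s. 1 \<le> f s" and \<rho>: "0 < \<rho>"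
    and Q: "\<And>s. (\<Sum>s'\<in>UNIV. q s s' * f s') \<le> (exit_rate q s - \<rho> - \<theta> * d s) * f s"
  obtains M where "0 \<le> M" "(\<integral>\<^sup>+z. ennreal (exp (\<theta> * fst z) * f (snd z)) \<partial>\<pi>) \<le> ennreal M"
proof -
  interpret \<pi>: prob_space \<pi> by (rule invariant_D(1)[OF \<pi>])
  note m\<pi> = measurable_cong_sets[OF invariant_D(2)[OF \<pi>] refl]
  have f0: "0 \<le> f s" for s using f[of s] by linarith
  obtain K0 where K0: "0 \<le> K0" "\<And>t x s. 0 \<le> t \<Longrightarrow> 0 \<le> x \<Longrightarrow>
    (\<integral>\<^sup>+z. ennreal (exp (\<theta> * fst z) * f (snd z)) \<partial>TR t (x, s))
      \<le> ennreal (exp (- \<rho> * t) * (exp (\<theta> * x) * f s) + K0 * (1 + t) * exp (max 0 (- \<rho>) * t))"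
    by (rule lyapunov[where \<Lambda> = "- \<rho>" and f = f and \<theta> = \<theta>]) (use \<theta> f Q in auto)
  \<comment> \<open>The time after which the contracting part of the moment bound has lost half of
    its size.\<close>
  define t where "t = ln 2 / \<rho>"
  have t: "0 \<le> t" "exp (- \<rho> * t) = 1 / 2" using \<rho> by (simp_all add: t_def exp_minus inverse_eq_divide)
  define K where "K = K0 * (1 + t)"
  have K: "0 \<le> K" using K0 t by (simp add: K_def)
  let ?h = "\<lambda>z. exp (\<theta> * fst z) * f (snd z)"
  have h0: "0 \<le> ?h z" for z using f0 by simp
  have hm: "?h \<in> borel_measurable E_space" by (rule measurable_lyapunov_fun)
  have hm\<pi> [measurable]: "?h \<in> borel_measurable \<pi>" unfolding m\<pi> by (rule hm)
  have step: "(\<integral>\<^sup>+z'. ennreal (?h z') \<partial>TR t z) \<le> ennreal (?h z / 2 + K)" if "z \<in> space \<pi>" for z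
  proof -
    have "(\<integral>\<^sup>+z'. ennreal (?h z') \<partial>TR t z) \<le> ennreal (exp (- \<rho> * t) * ?h z + K0 * (1 + t) * exp (max 0 (- \<rho>) * t))"
      using K0(2)[OF t(1), of "fst z" "snd z"] that by (auto simp: invariant_D(3)[OF \<pi>])
    also have "exp (- \<rho> * t) * ?h z + K0 * (1 + t) * exp (max 0 (- \<rho>) * t) = ?h z / 2 + K"
      unfolding t(2) using \<rho> by (simp add: K_def)
    finally show ?thesis .
  qed
  define G where "G n z = min (real n) (?h z) - min (real n) (?h z / 2 + K) + K" for n z
  have aux: "0 \<le> min (real n) a - min (real n) (a / 2 + K) + K" if "0 \<le> a" for n a
    using K that by (auto simp: min_def)
  have aux2: "min (real n) a - min (real n) (a / 2 + K) + K = a / 2" if "0 \<le> a" "a + K \<le> real n0" "n0 \<le> n" for n n0 a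
    using K that by (auto simp: min_def)
  have G0: "0 \<le> G n z" for n z using aux[OF h0] by (simp add: G_def)
  have G_meas [measurable]: "G n \<in> borel_measurable \<pi>" for n unfolding G_def by measurable
  have G_le: "(\<integral>\<^sup>+z. ennreal (G n z) \<partial>\<pi>) \<le> ennreal K" for n
  proof -
    let ?A = "\<integral>\<^sup>+z. ennreal (min (real n) (?h z / 2 + K)) \<partial>\<pi>"
    have "?A \<le> (\<integral>\<^sup>+z. ennreal (real n) \<partial>\<pi>)" by (intro nn_integral_mono ennreal_leI) simp
    \<comment> \<open>Finite because of the truncation, so that it may be cancelled at the
      end.\<close>
    then have fin: "?A \<noteq> \<top>" by (auto simp: \<pi>.emeasure_space_1 top_unique)
    have minm: "(\<lambda>z. ennreal (min (real n) (?h z))) \<in> borel_measurable E_space" using hm by measurable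
    have "(\<integral>\<^sup>+z. ennreal (G n z) \<partial>\<pi>) + ?A = (\<integral>\<^sup>+z. ennreal (G n z) + ennreal (min (real n) (?h z / 2 + K)) \<partial>\<pi>)"
      by (rule nn_integral_add[symmetric]) measurable
    also have "\<dots> = (\<integral>\<^sup>+z. ennreal (min (real n) (?h z)) + ennreal K \<partial>\<pi>)"
    proof (rule nn_integral_cong)
      fix z
      have "0 \<le> min (real n) (?h z / 2 + K)" "0 \<le> min (real n) (?h z)" using h0[of z] K by auto
      then show "ennreal (G n z) + ennreal (min (real n) (?h z / 2 + K)) = ennreal (min (real n) (?h z)) + ennreal K"
        using G0[of n z] K by (subst (1 2) ennreal_plus[symmetric]) (auto simp: G_def)
    qed
    also have "\<dots> = (\<integral>\<^sup>+z. ennreal (min (real n) (?h z)) \<partial>\<pi>) + ennreal K"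
      by (subst nn_integral_add) (auto simp: \<pi>.emeasure_space_1)
    also have "(\<integral>\<^sup>+z. ennreal (min (real n) (?h z)) \<partial>\<pi>) = (\<integral>\<^sup>+z. \<integral>\<^sup>+z'. ennreal (min (real n) (?h z')) \<partial>TR t z \<partial>\<pi>)"
      by (rule nn_integral_invariant[OF \<pi> t(1) minm, symmetric])
    also have "\<dots> \<le> ?A"
    proof (rule nn_integral_mono)
      fix z assume z: "z \<in> space \<pi>"
      have "(\<integral>\<^sup>+z'. ennreal (min (real n) (?h z')) \<partial>TR t z) \<le> (\<integral>\<^sup>+z'. ennreal (?h z') \<partial>TR t z)"
        by (intro nn_integral_mono ennreal_leI) simp
      also note step[OF z]
      finally have 1: "(\<integral>\<^sup>+z'. ennreal (min (real n) (?h z')) \<partial>TR t z) \<le> ennreal (?h z / 2 + K)" .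
      have 2: "(\<integral>\<^sup>+z'. ennreal (min (real n) (?h z')) \<partial>TR t z) \<le> ennreal (real n)"
        by (rule nn_integral_TR_le) (simp add: ennreal_leI)
      show "(\<integral>\<^sup>+z'. ennreal (min (real n) (?h z')) \<partial>TR t z) \<le> ennreal (min (real n) (?h z / 2 + K))"
        using 1 2 by (auto simp: min_def)
    qed
    finally have "(\<integral>\<^sup>+z. ennreal (G n z) \<partial>\<pi>) + ?A \<le> ennreal K + ?A"
      by (simp add: add.commute)
    then show ?thesis using fin by (simp add: ennreal_add_left_cancel_le add.commute)
  qed
  have "(\<integral>\<^sup>+z. ennreal (?h z / 2) \<partial>\<pi>) = (\<integral>\<^sup>+z. liminf (\<lambda>n. ennreal (G n z)) \<partial>\<pi>)"
  proof (rule nn_integral_cong)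
    fix z
    have "(\<lambda>n. ennreal (G n z)) \<longlonglongrightarrow> ennreal (?h z / 2)"
    proof (rule tendsto_eventually)
      obtain n0 where n0: "?h z + K \<le> real n0" using real_arch_simple by blast
      show "\<forall>\<^sub>F n in sequentially. ennreal (G n z) = ennreal (?h z / 2)"
        by (intro eventually_sequentiallyI[of n0]) (simp only: G_def aux2[OF h0 n0])
    qed
    then show "ennreal (?h z / 2) = liminf (\<lambda>n. ennreal (G n z))"
      by (simp add: tendsto_iff_Liminf_eq_Limsup)
  qed
  \<comment> \<open>Fatou's lemma rather than monotone convergence: \<open>G n\<close> increases to
    h / 2 where h is large and decreases to it where h < 2 K.\<close>
  also have "\<dots> \<le> liminf (\<lambda>n. \<integral>\<^sup>+z. ennreal (G n z) \<partial>\<pi>)"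
    by (rule nn_integral_liminf) measurable
  also have "\<dots> \<le> ennreal K"
    by (rule Liminf_le) (simp_all add: G_le)
  finally have half: "(\<integral>\<^sup>+z. ennreal (?h z / 2) \<partial>\<pi>) \<le> ennreal K" .
  have "(\<integral>\<^sup>+z. ennreal (?h z) \<partial>\<pi>) = (\<integral>\<^sup>+z. ennreal 2 * ennreal (?h z / 2) \<partial>\<pi>)"
    using f0 by (intro nn_integral_cong, subst ennreal_mult[symmetric]) auto
  also have "\<dots> = ennreal 2 * (\<integral>\<^sup>+z. ennreal (?h z / 2) \<partial>\<pi>)"
    by (rule nn_integral_cmult) measurable
  also have "\<dots> \<le> ennreal 2 * ennreal K"
    by (intro mult_left_mono half) simp
  also have "\<dots> = ennreal (2 * K)" using K by (simp add: ennreal_mult)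
  finally show ?thesis using that[of "2 * K"] K by simp
qed

text \<open>The copies can differ at time t only if their states disagree at t / 2 or if they have
  not merged since. The second probability is at most exp (- \<rho> t / 2) times the weight at the
  upper position, which is bounded by the sum of both weights; a sum separates the marginals of the
  coupling, and each marginal has a finite exponential moment.\<close>

theorem tv_decay:
  assumes \<pi>: "invariant_prob TR \<pi>" and mix: "\<And>s. mixes \<gamma> (indicator {s})" and x: "0 \<le> x"
    and \<theta>: "0 < \<theta>" and f: "\<And>s. 0 < f s" and \<rho>: "0 < \<rho>"
    and Q: "\<And>s. (\<Sum>s'\<in>UNIV. q s s' * f s') \<le> (exit_rate q s - \<rho> - \<theta> * d s) * f s"
    and r: "r \<le> \<gamma> / 2" "r \<le> \<rho> / 2"
  shows "ereal r \<le> Liminf at_top (\<lambda>t. - (log_ext (tv_dist (TR t (x, s)) \<pi>) / ereal t))"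
proof -
  obtain k where k: "0 < k" "\<And>s. 1 \<le> k * f s" using normalize_weight[of f] f by blast
  define g where "g s = k * f s" for s
  have g: "1 \<le> g s" for s using k by (simp add: g_def)
  have g0: "0 \<le> g s" for s using g[of s] by linarith
  have Qg: "(\<Sum>s'\<in>UNIV. q s s' * g s') \<le> (exit_rate q s - \<rho> - \<theta> * d s) * g s" for s
    using mult_left_mono[OF Q[of s], of k] k by (simp add: g_def sum_distrib_left mult_ac)
  let ?h = "\<lambda>z. exp (\<theta> * fst z) * g (snd z)"
  have hm: "(\<lambda>z. ennreal (?h z)) \<in> borel_measurable E_space" using measurable_lyapunov_fun by measurable
  obtain M where M: "0 \<le> M" "(\<integral>\<^sup>+z. ennreal (?h z) \<partial>\<pi>) \<le> ennreal M"
    by (rule invariant_moment[OF \<pi> \<theta> g \<rho> Qg])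
  obtain K0 where K0: "0 \<le> K0" "\<And>t x s. 0 \<le> t \<Longrightarrow> 0 \<le> x \<Longrightarrow>
    (\<integral>\<^sup>+z. ennreal (?h z) \<partial>TR t (x, s)) \<le> ennreal (exp (- \<rho> * t) * (exp (\<theta> * x) * g s) + K0 * (1 + t) * exp (max 0 (- \<rho>) * t))"
    by (rule lyapunov[where \<Lambda> = "- \<rho>" and f = g and \<theta> = \<theta>]) (use \<theta> g Qg in auto)
  obtain K where K: "0 \<le> K" "\<forall>t\<ge>0. \<forall>u\<ge>0. \<exists>\<Gamma>\<in>couplings (TR t (x, s)) \<pi>.
    emeasure \<Gamma> {p\<in>space \<Gamma>. snd (fst p) \<noteq> snd (snd p)} \<le> ennreal (K * exp (- \<gamma> * t)) \<and>
    push u \<Gamma> \<in> couplings (TR (t + u) (x, s)) \<pi>"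
    using coupling_invariant[OF \<pi> mix x, where s = s] by blast
  define C where "C = K + exp (\<theta> * x) * g s + K0 + M"
  have "tv_dist (TR t (x, s)) \<pi> \<le> C * (1 + t) * exp (- r * t)" if t: "0 \<le> t" for t
  proof -
    define u where "u = t / 2"
    have u: "0 \<le> u" "t = u + u" using t by (auto simp: u_def)
    obtain \<Gamma> where \<Gamma>: "\<Gamma> \<in> couplings (TR u (x, s)) \<pi>"
      "emeasure \<Gamma> {p\<in>space \<Gamma>. snd (fst p) \<noteq> snd (snd p)} \<le> ennreal (K * exp (- \<gamma> * u))"
      "push u \<Gamma> \<in> couplings (TR t (x, s)) \<pi>"
      using K(2)[rule_format, OF u(1) u(1)] unfolding u(2)[symmetric] by blast
    have s\<Gamma>: "sets \<Gamma> = sets (E_space \<Otimes>\<^sub>M E_space)"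
      unfolding couplings_D(2)[OF \<Gamma>(1)] by (rule sets_pair_measure_cong[OF sets_TR invariant_D(2)[OF \<pi>]])
    have sp\<Gamma>: "space \<Gamma> = space E_space \<times> space E_space"
      using couplings_D(3)[OF \<Gamma>(1)] by (simp add: invariant_D(3)[OF \<pi>] space_E)
    note m\<Gamma> = measurable_cong_sets[OF s\<Gamma> refl]
    let ?\<phi> = "\<lambda>s t x. x + d s * t"
    let ?G = "\<lambda>u. if fst u = snd u then 0 else 1 :: ennreal"
    let ?S = "{p\<in>space \<Gamma>. snd (fst p) \<noteq> snd (snd p)}"
    have S: "?S \<in> sets \<Gamma>"
    proof -
      have "{p\<in>space (E_space \<Otimes>\<^sub>M E_space). snd (fst p) \<noteq> snd (snd p :: real \<times> 's)} \<in> sets (E_space \<Otimes>\<^sub>M E_space)"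
        by measurable
      then show ?thesis by (simp add: s\<Gamma> sp\<Gamma> space_pair_measure)
    qed
    note G = measurable_neq_E
    have h1: "(\<lambda>p. ennreal (?h (fst p))) \<in> borel_measurable \<Gamma>" and h2: "(\<lambda>p. ennreal (?h (snd p))) \<in> borel_measurable \<Gamma>"
      unfolding m\<Gamma> by (rule measurable_compose[OF measurable_fst hm] measurable_compose[OF measurable_snd hm])+
    have hm1: "(\<lambda>z. ennreal (?h z)) \<in> borel_measurable (TR u (x, s))" and hm2: "(\<lambda>z. ennreal (?h z)) \<in> borel_measurable \<pi>"
      using hm unfolding measurable_cong_sets[OF sets_TR refl] measurable_cong_sets[OF invariant_D(2)[OF \<pi>] refl] by auto
    let ?e = "exp (- \<rho> * u)"
    interpret P: prob_space "push u \<Gamma>" by (rule couplings_D(1)[OF \<Gamma>(3)])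
    have "emeasure (push u \<Gamma>) {v\<in>space (push u \<Gamma>). fst v \<noteq> snd v} = (\<integral>\<^sup>+v. ?G v \<partial>push u \<Gamma>)"
    proof -
      have "space (push u \<Gamma>) = space (E_space \<Otimes>\<^sub>M E_space)" by (rule sets_eq_imp_space_eq) simp
      then have "emeasure (push u \<Gamma>) {v\<in>space (push u \<Gamma>). fst v \<noteq> snd v} = (\<integral>\<^sup>+v. indicator {v\<in>space (push u \<Gamma>). fst v \<noteq> snd v} v \<partial>push u \<Gamma>)"
        using sets_diagonal_E by (subst nn_integral_indicator) auto
      also have "\<dots> = (\<integral>\<^sup>+v. ?G v \<partial>push u \<Gamma>)" by (intro nn_integral_cong) (auto simp: indicator_def)
      finally show ?thesis .
    qed
    also have "\<dots> = (\<integral>\<^sup>+p. \<integral>\<^sup>+w. ?G (process ?\<phi> (fst p) u w, process ?\<phi> (snd p) u w) \<partial>N \<partial>\<Gamma>)"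
      by (rule nn_integral_push[OF s\<Gamma> G])
    also have "\<dots> \<le> (\<integral>\<^sup>+p. indicator ?S p + (ennreal ?e * ennreal (?h (fst p)) + ennreal ?e * ennreal (?h (snd p))) \<partial>\<Gamma>)"
    proof (rule nn_integral_mono)
      fix p assume p: "p \<in> space \<Gamma>"
      obtain y1 s1 y2 s2 where pp: "p = ((y1, s1), (y2, s2))" by (metis surj_pair)
      have y: "0 \<le> y1" "0 \<le> y2" using p by (auto simp: sp\<Gamma> space_E pp)
      show "(\<integral>\<^sup>+w. ?G (process ?\<phi> (fst p) u w, process ?\<phi> (snd p) u w) \<partial>N)
        \<le> indicator ?S p + (ennreal ?e * ennreal (?h (fst p)) + ennreal ?e * ennreal (?h (snd p)))"
      proof (cases "s1 = s2")
        case False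
        have "(\<integral>\<^sup>+w. ?G (process ?\<phi> (fst p) u w, process ?\<phi> (snd p) u w) \<partial>N) \<le> (\<integral>\<^sup>+w. 1 \<partial>N)"
          by (intro nn_integral_mono) simp
        also have "\<dots> = indicator ?S p" using False p by (simp add: pp N.emeasure_space_1[simplified])
        finally show ?thesis by (simp add: add_increasing2)
      next
        case True
        have "(\<integral>\<^sup>+w. ?G (process ?\<phi> (fst p) u w, process ?\<phi> (snd p) u w) \<partial>N)
          = joint_mean u (y1, y2) s1 ?G"
          by (simp add: joint_mean_def pp True)
        also have "\<dots> \<le> ennreal (?e * exp (\<theta> * max y1 y2) * g s1)"
          using merge_prob_le[where \<Lambda> = "- \<rho>" and f = g and t = u and p = "(y1, y2)" and s = s1, OF \<theta> g] Qg u(1) y by simp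
        also have "\<dots> \<le> ennreal (?e * ?h (fst p) + ?e * ?h (snd p))"
          using g0[of s1] by (intro ennreal_leI) (auto simp: pp True max_def mult_ac intro!: add_increasing add_increasing2 mult_nonneg_nonneg simp del: mult_exp_exp)
        also have "\<dots> = ennreal ?e * ennreal (?h (fst p)) + ennreal ?e * ennreal (?h (snd p))"
          using g0 by (simp add: ennreal_mult ennreal_plus mult_nonneg_nonneg del: mult_exp_exp)
        finally show ?thesis by (simp add: add_increasing)
      qed
    qed
    also have "\<dots> = emeasure \<Gamma> ?S + (ennreal ?e * (\<integral>\<^sup>+p. ennreal (?h (fst p)) \<partial>\<Gamma>) + ennreal ?e * (\<integral>\<^sup>+p. ennreal (?h (snd p)) \<partial>\<Gamma>))"
    proof -
      have i: "(\<lambda>p. indicator ?S p :: ennreal) \<in> borel_measurable \<Gamma>" by (rule borel_measurable_indicator[OF S])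
      have h1': "(\<lambda>p. ennreal ?e * ennreal (?h (fst p))) \<in> borel_measurable \<Gamma>"
        and h2': "(\<lambda>p. ennreal ?e * ennreal (?h (snd p))) \<in> borel_measurable \<Gamma>"
        using h1 h2 by measurable
      show ?thesis
        by (simp only: nn_integral_add[OF i borel_measurable_add[OF h1' h2']] nn_integral_add[OF h1' h2']
            nn_integral_cmult[OF h1] nn_integral_cmult[OF h2] nn_integral_indicator[OF S])
    qed
    also have "\<dots> = emeasure \<Gamma> ?S + (ennreal ?e * (\<integral>\<^sup>+z. ennreal (?h z) \<partial>TR u (x, s)) + ennreal ?e * (\<integral>\<^sup>+z. ennreal (?h z) \<partial>\<pi>))"
      by (simp only: nn_integral_coupling_fst[OF \<Gamma>(1) hm1] nn_integral_coupling_snd[OF \<Gamma>(1) hm2])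
    also have "\<dots> \<le> ennreal (K * exp (- \<gamma> * u)) + (ennreal ?e * ennreal (exp (\<theta> * x) * g s + K0 * (1 + t)) + ennreal ?e * ennreal M)"
    proof (intro add_mono mult_left_mono \<Gamma>(2) M(2))
      have "(\<integral>\<^sup>+z. ennreal (?h z) \<partial>TR u (x, s)) \<le> ennreal (exp (- \<rho> * u) * (exp (\<theta> * x) * g s) + K0 * (1 + u) * exp (max 0 (- \<rho>) * u))"
        by (rule K0(2)[OF u(1) x])
      \<comment> \<open>The moment at time t / 2 is bounded linearly in t, hence the factor 1 + t in
        the final bound.\<close>
      also have "\<dots> \<le> ennreal (exp (\<theta> * x) * g s + K0 * (1 + t))"
      proof (rule ennreal_leI, rule add_mono)
        have "exp (- \<rho> * u) * (exp (\<theta> * x) * g s) \<le> 1 * (exp (\<theta> * x) * g s)"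
          using \<rho> u g0 by (intro mult_right_mono) auto
        then show "exp (- \<rho> * u) * (exp (\<theta> * x) * g s) \<le> exp (\<theta> * x) * g s" by simp
        show "K0 * (1 + u) * exp (max 0 (- \<rho>) * u) \<le> K0 * (1 + t)"
          using \<rho> u K0(1) by (auto intro!: mult_left_mono)
      qed
      finally show "(\<integral>\<^sup>+z. ennreal (?h z) \<partial>TR u (x, s)) \<le> ennreal (exp (\<theta> * x) * g s + K0 * (1 + t))" .
    qed auto
    also have "\<dots> = ennreal (K * exp (- \<gamma> * u) + (?e * (exp (\<theta> * x) * g s + K0 * (1 + t)) + ?e * M))"
      using K K0 M g0 t by (simp add: ennreal_mult ennreal_plus mult_nonneg_nonneg del: mult_exp_exp)
    also have "\<dots> \<le> ennreal (C * (1 + t) * exp (- r * t))"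
    proof (rule ennreal_leI)
      have "r * t \<le> \<gamma> / 2 * t" "r * t \<le> \<rho> / 2 * t" by (rule mult_right_mono[OF r(1) t] mult_right_mono[OF r(2) t])+
      then have e1: "exp (- \<gamma> * u) \<le> exp (- r * t)" and e2: "?e \<le> exp (- r * t)"
        by (simp_all add: u_def)
      have nn: "0 \<le> exp (\<theta> * x) * g s" using g0 by simp
      have "K * exp (- \<gamma> * u) + (?e * (exp (\<theta> * x) * g s + K0 * (1 + t)) + ?e * M)
        \<le> K * exp (- r * t) + (exp (- r * t) * (exp (\<theta> * x) * g s + K0 * (1 + t)) + exp (- r * t) * M)"
        using e1 e2 K K0 M nn t by (intro add_mono mult_left_mono mult_right_mono) auto
      also have "\<dots> = (K + exp (\<theta> * x) * g s + K0 * (1 + t) + M) * exp (- r * t)"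
        by (simp add: algebra_simps del: mult_exp_exp)
      also have "\<dots> \<le> (C * (1 + t)) * exp (- r * t)"
      proof (rule mult_right_mono)
        have "0 \<le> (K + exp (\<theta> * x) * g s + M) * t" using K M nn t by (intro mult_nonneg_nonneg) auto
        then show "K + exp (\<theta> * x) * g s + K0 * (1 + t) + M \<le> C * (1 + t)"
          by (simp add: C_def algebra_simps del: mult_exp_exp)
      qed simp
      finally show "K * exp (- \<gamma> * u) + (?e * (exp (\<theta> * x) * g s + K0 * (1 + t)) + ?e * M) \<le> C * (1 + t) * exp (- r * t)" .
    qed
    finally have "measure (push u \<Gamma>) {v\<in>space (push u \<Gamma>). fst v \<noteq> snd v} \<le> C * (1 + t) * exp (- r * t)"
      using K K0 M g0 t by (simp add: P.emeasure_eq_measure C_def)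
    then show ?thesis by (rule tv_dist_le[OF \<Gamma>(3)])
  qed
  then show ?thesis
    by (intro decay_rate_ge[of _ C] eventually_at_top_linorderI[of 0])
qed


text \<open>Test invariance, over one unit of time, with the truncated weight \<open>exp (\<theta> min x (z + M)) f\<close>.\<close>

lemma invariant_tail:
  assumes \<pi>: "invariant_prob TR \<pi>" and \<theta>: "0 < \<theta>" and f: "\<And>s. 0 < f s" and \<Lambda>: "0 < \<Lambda>"
    and Q: "\<And>s. (\<Sum>s'\<in>UNIV. q s s' * f s') = (exit_rate q s + \<Lambda> - \<theta> * d s) * f s"
  shows "\<exists>c>0. \<forall>z\<ge>0. c * exp (- \<theta> * z) \<le> measure \<pi> {u\<in>space \<pi>. z < fst u}"
proof -
  interpret \<pi>: prob_space \<pi> by (rule invariant_D(1)[OF \<pi>])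
  note m\<pi> = measurable_cong_sets[OF invariant_D(2)[OF \<pi>] refl]
  have f0: "0 \<le> f s" for s using f[of s] by linarith
  \<comment> \<open>\<open>M\<close> bounds the upward speed, and the summand 1 makes it positive.
    In one unit of time a path from below z stays below z + M, where the truncation is not
    active.\<close>
  define M where "M = (\<Sum>s\<in>UNIV. \<bar>d s\<bar>) + 1"
  have M: "0 < M" "d s \<le> M" for s
    using member_le_sum[of s UNIV "\<lambda>s. \<bar>d s\<bar>"] sum_nonneg[of UNIV "\<lambda>s. \<bar>d s\<bar>"] by (auto simp: M_def)
  define F where "F = (\<Sum>s\<in>UNIV. f s)"
  have F: "f s \<le> F" for s unfolding F_def using f0 by (intro member_le_sum) auto
  have F0: "0 < F" using F f less_le_trans by blast
  define m where "m = Min (range f)"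
  have m: "0 < m" "m \<le> f s" for s
    using f by (auto simp: m_def)
  \<comment> \<open>A lower bound for the expected gain over one unit of time when starting below
    z.\<close>
  define \<delta> where "\<delta> = (exp \<Lambda> - 1) * m"
  have \<delta>: "0 < \<delta>" using \<Lambda> m by (simp add: \<delta>_def)
  define A where "A = F * exp (\<theta> * M)"
  have A: "0 < A" using F0 by (simp add: A_def)
  have tail: "\<delta> / (A + \<delta>) * exp (- \<theta> * z) \<le> measure \<pi> {u\<in>space \<pi>. z < fst u}" if z: "0 \<le> z" for z
  proof -
    let ?g = "\<lambda>u. exp (\<theta> * min (fst u) (z + M)) * f (snd u)"
    let ?U = "\<lambda>t x s. exp (\<Lambda> * t) * exp (\<theta> * x) * f s"
    \<comment> \<open>Positions that cannot pass the truncation level z + M within the remaining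
      time t. On them \<open>?U\<close> is bounded, since t \<le> (z + M) / M.\<close>
    let ?D = "\<lambda>t. {x. 0 \<le> x \<and> x + M * t \<le> z + M}"
    have gm: "(\<lambda>u. ennreal (?g u)) \<in> borel_measurable E_space"
    proof -
      have "(\<lambda>u. exp (\<theta> * min (fst u) (z + M))) \<in> borel_measurable E_space"
        by (rule measurable_compose[OF measurable_fst_E]) measurable
      moreover have "(\<lambda>u. f (snd u)) \<in> borel_measurable E_space"
        by (rule measurable_compose[OF measurable_snd_E]) simp
      ultimately show ?thesis by measurable
    qed
    have g_le: "?g u \<le> F * exp (\<theta> * (z + M))" for u
      using \<theta> F[of "snd u"] f0[of "snd u"] by (subst mult.commute) (intro mult_mono; auto)
    have sub: "ennreal (?U 1 x s) \<le> (\<integral>\<^sup>+u. ennreal (?g u) \<partial>TR 1 (x, s))" if x: "0 \<le> x" "x \<le> z" for x s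
    proof (rule comparison_TR_ge[where U = "\<lambda>t x s. ennreal (?U t x s)" and D = ?D
          and B = "exp (\<Lambda> * ((z + M) / M)) * exp (\<theta> * (z + M)) * F"])
      show "(\<lambda>u. ennreal (?g u)) \<in> borel_measurable E_space" by (rule gm)
      show "\<Phi> s r x \<in> ?D (t - r)" if "x \<in> ?D t" "0 \<le> r" "r \<le> t" for t x s r
      proof -
        have "d s * r \<le> M * r" using M that by (intro mult_right_mono) auto
        moreover have "M * r \<le> M * t" using M that by (intro mult_left_mono) auto
        moreover have "0 \<le> M * r" using M that by simp
        ultimately show ?thesis unfolding \<Phi>_eq using that by (auto simp: algebra_simps max_def)
      qed
      show "ennreal (?U t x s) \<le> ennreal (exp (\<Lambda> * ((z + M) / M)) * exp (\<theta> * (z + M)) * F)"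
        if t: "0 \<le> t" and x: "x \<in> ?D t" for t x s
      proof -
        have "0 \<le> M * t" using M t by simp
        then have "t \<le> (z + M) / M" "x \<le> z + M" using x M by (auto simp: field_simps)
        moreover from this(1) have "\<Lambda> * t \<le> \<Lambda> * ((z + M) / M)" using \<Lambda> by (intro mult_left_mono) auto
        ultimately show ?thesis using \<theta> F[of s] f0[of s]
          by (intro ennreal_leI mult_mono) (auto simp del: mult_exp_exp)
      qed
      show "ennreal (?U t x s) \<le> (\<integral>\<^sup>+a. (if t < fst a then ennreal (?g (\<Phi> s t x, s)) else ennreal (?U (t - fst a) (\<Phi> s (fst a) x) (snd a))) \<partial>H s)"
        if t: "0 \<le> t" and x: "x \<in> ?D t" for t x s
      proof -
        let ?u = "\<lambda>r. exp (\<Lambda> * (t - r)) * exp (\<theta> * (x + d s * r)) * f s"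
        have Qu: "exit_rate q s * ?u r - (\<theta> * d s - \<Lambda>) * ?u r = (\<Sum>s'\<in>UNIV. q s s' * (exp (\<Lambda> * (t - r)) * exp (\<theta> * (x + d s * r)) * f s'))" for r
        proof -
          have "(\<Sum>s'\<in>UNIV. q s s' * (exp (\<Lambda> * (t - r)) * exp (\<theta> * (x + d s * r)) * f s'))
            = exp (\<Lambda> * (t - r)) * exp (\<theta> * (x + d s * r)) * (\<Sum>s'\<in>UNIV. q s s' * f s')"
            unfolding sum_distrib_left by (intro sum.cong) (simp_all add: mult_ac del: mult_exp_exp)
          then show ?thesis unfolding Q by (simp add: algebra_simps del: mult_exp_exp)
        qed
        have "ennreal (?u 0) \<le> (\<integral>\<^sup>+a. ennreal (if t < fst a then ?g (\<Phi> s t x, s) else ?U (t - fst a) (\<Phi> s (fst a) x) (snd a)) \<partial>H s)"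
        proof (rule step_ge[OF t, where u = ?u and u' = "\<lambda>r. (\<theta> * d s - \<Lambda>) * ?u r"])
          show "?u t \<le> ?g (\<Phi> s t x, s)"
          proof -
            have "d s * t \<le> M * t" using M t by (intro mult_right_mono) auto
            then have "x + d s * t \<le> min (\<Phi> s t x) (z + M)" using x by (auto simp: \<Phi>_eq)
            then show ?thesis using \<theta> f0[of s] by (auto intro!: mult_right_mono)
          qed
          show "(?u has_real_derivative (\<theta> * d s - \<Lambda>) * ?u r) (at r)" for r
            by (rule exp_drift_deriv)
          show "0 \<le> exit_rate q s * ?u r - (\<theta> * d s - \<Lambda>) * ?u r" for r
            unfolding Qu using f0 q_nonneg by (intro sum_nonneg) auto
          show "exit_rate q s * ?u r - (\<theta> * d s - \<Lambda>) * ?u r \<le> (\<Sum>s'\<in>UNIV. q s s' * ?U (t - r) (\<Phi> s r x) s')" for r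
            unfolding Qu
          proof (intro sum_mono mult_left_mono mult_right_mono)
            \<comment> \<open>Reflection raises the exponential, which is the favourable direction
              for a subsolution.\<close>
            show "exp (\<theta> * (x + d s * r)) \<le> exp (\<theta> * \<Phi> s r x)" using \<theta> by (simp add: \<Phi>_eq)
          qed (use q_nonneg f0 in auto)
          show "0 \<le> ?U (t - r) (\<Phi> s r x) s'" for r s' using f0 by simp
        qed (use f0 in auto)
        then show ?thesis by (simp add: if_distrib[of ennreal] del: mult_exp_exp)
      qed
    qed (use x in auto)
    let ?lo = "{u\<in>space \<pi>. fst u \<le> z}" and ?hi = "{u\<in>space \<pi>. z < fst u}"
    have fst\<pi>: "fst \<in> borel_measurable \<pi>" unfolding m\<pi> by (rule measurable_fst_E)
    have lo: "?lo \<in> sets \<pi>" and hi: "?hi \<in> sets \<pi>" using fst\<pi> by measurable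
    have gm\<pi> [measurable]: "(\<lambda>u. ennreal (?g u)) \<in> borel_measurable \<pi>" unfolding m\<pi> by (rule gm)
    have kg [measurable]: "(\<lambda>u. \<integral>\<^sup>+u'. ennreal (?g u') \<partial>TR 1 u) \<in> borel_measurable \<pi>"
      unfolding m\<pi> by (rule measurable_nn_integral_TR[OF gm])
    define B where "B = F * exp (\<theta> * (z + M))"
    have B0: "0 < B" using F0 by (simp add: B_def)
    let ?I = "\<integral>\<^sup>+u. ennreal (?g u) \<partial>\<pi>"
    have "?I \<le> (\<integral>\<^sup>+u. ennreal B \<partial>\<pi>)" using g_le by (intro nn_integral_mono ennreal_leI) (simp add: B_def)
    then have fin: "?I \<noteq> \<top>" by (auto simp: \<pi>.emeasure_space_1 top_unique)
    \<comment> \<open>Below z the truncated weight gains at least \<delta> on average, above z it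
      loses at most its bound \<open>B\<close>. Under \<pi> gain and loss balance, which bounds the
      mass above z from below by a multiple of the mass below.\<close>
    have pt: "ennreal (?g u) + ennreal \<delta> * indicator ?lo u \<le> (\<integral>\<^sup>+u'. ennreal (?g u') \<partial>TR 1 u) + ennreal B * indicator ?hi u"
      if u: "u \<in> space \<pi>" for u
    proof (cases "fst u \<le> z")
      case True
      have u0: "0 \<le> fst u" using u by (auto simp: invariant_D(3)[OF \<pi>])
      have "1 * m \<le> exp (\<theta> * fst u) * f (snd u)"
        using \<theta> u0 m by (intro mult_mono) auto
      then have "\<delta> \<le> (exp \<Lambda> - 1) * (exp (\<theta> * fst u) * f (snd u))"
        unfolding \<delta>_def using \<Lambda> by (intro mult_left_mono) auto
      then have "exp (\<theta> * fst u) * f (snd u) + \<delta> \<le> ?U 1 (fst u) (snd u)"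
        by (simp add: algebra_simps del: mult_exp_exp)
      moreover have "min (fst u) (z + M) = fst u" using True M by simp
      ultimately have "?g u + \<delta> \<le> ?U 1 (fst u) (snd u)" by (simp only:)
      from ennreal_leI[OF this] sub[OF u0 True, of "snd u", unfolded prod.collapse]
      have "ennreal (?g u + \<delta>) \<le> (\<integral>\<^sup>+u'. ennreal (?g u') \<partial>TR 1 u)"
        by (rule order_trans)
      then show ?thesis using True u \<delta> f0 by (simp add: ennreal_plus)
    next
      case False
      then show ?thesis using u g_le[of u] by (auto intro!: add_increasing ennreal_leI simp: B_def)
    qed
    have "?I + ennreal \<delta> * emeasure \<pi> ?lo = (\<integral>\<^sup>+u. ennreal (?g u) + ennreal \<delta> * indicator ?lo u \<partial>\<pi>)"
      using lo by (subst nn_integral_add) (auto simp: nn_integral_cmult)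
    also have "\<dots> \<le> (\<integral>\<^sup>+u. (\<integral>\<^sup>+u'. ennreal (?g u') \<partial>TR 1 u) + ennreal B * indicator ?hi u \<partial>\<pi>)"
      by (rule nn_integral_mono) (rule pt)
    also have "\<dots> = (\<integral>\<^sup>+u. \<integral>\<^sup>+u'. ennreal (?g u') \<partial>TR 1 u \<partial>\<pi>) + ennreal B * emeasure \<pi> ?hi"
      using hi by (subst nn_integral_add) (auto simp: nn_integral_cmult)
    also have "(\<integral>\<^sup>+u. \<integral>\<^sup>+u'. ennreal (?g u') \<partial>TR 1 u \<partial>\<pi>) = ?I"
      by (rule nn_integral_invariant[OF \<pi> _ gm]) simp
    finally have "ennreal \<delta> * emeasure \<pi> ?lo \<le> ennreal B * emeasure \<pi> ?hi"
      using fin by (simp add: ennreal_add_left_cancel_le)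
    then have ineq: "\<delta> * measure \<pi> ?lo \<le> B * measure \<pi> ?hi"
      using \<delta> B0 by (simp add: \<pi>.emeasure_eq_measure ennreal_mult[symmetric])
    have "?hi = space \<pi> - ?lo" by auto
    then have compl: "measure \<pi> ?lo = 1 - measure \<pi> ?hi" using \<pi>.prob_compl[OF lo] by simp
    have ez: "1 \<le> exp (\<theta> * z)" using \<theta> z by simp
    have "\<delta> \<le> (B + \<delta>) * measure \<pi> ?hi"
      using ineq unfolding compl by (simp add: algebra_simps)
    also have "\<dots> \<le> ((A + \<delta>) * exp (\<theta> * z)) * measure \<pi> ?hi"
    proof (rule mult_right_mono)
      have "\<delta> * 1 \<le> \<delta> * exp (\<theta> * z)" using \<delta> ez by (intro mult_left_mono) auto
      then show "B + \<delta> \<le> (A + \<delta>) * exp (\<theta> * z)"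
        by (simp add: B_def A_def algebra_simps exp_add)
    qed simp
    finally have "\<delta> / (A + \<delta>) \<le> exp (\<theta> * z) * measure \<pi> ?hi"
      using A \<delta> by (simp add: field_simps)
    then have "\<delta> / (A + \<delta>) * exp (- \<theta> * z) \<le> (exp (\<theta> * z) * measure \<pi> ?hi) * exp (- \<theta> * z)"
      by (rule mult_right_mono) simp
    then show ?thesis by (simp add: exp_minus field_simps)
  qed
  show ?thesis
    by (rule exI[of _ "\<delta> / (A + \<delta>)"]) (use tail A \<delta> in auto)
qed

theorem tv_slow:
  assumes \<pi>: "invariant_prob TR \<pi>" and x: "0 \<le> x" and \<theta>1: "0 < \<theta>1" and \<theta>: "\<theta>1 < \<theta>2"
    and f1: "\<And>s. 0 < f1 s" and f2: "\<And>s. 0 < f2 s" and \<Lambda>1: "0 < \<Lambda>1" and y: "0 < y" and \<Lambda>2: "\<Lambda>2 < y * (\<theta>2 - \<theta>1)"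
    and Q1: "\<And>s. (\<Sum>s'\<in>UNIV. q s s' * f1 s') = (exit_rate q s + \<Lambda>1 - \<theta>1 * d s) * f1 s"
    and Q2: "\<And>s. (\<Sum>s'\<in>UNIV. q s s' * f2 s') \<le> (exit_rate q s + \<Lambda>2 - \<theta>2 * d s) * f2 s"
  shows "Limsup at_top (\<lambda>t. - (log_ext (tv_dist (TR t (x, s)) \<pi>) / ereal t)) \<le> ereal (\<theta>1 * y)"
proof -
  interpret \<pi>: prob_space \<pi> by (rule invariant_D(1)[OF \<pi>])
  have \<theta>2: "0 < \<theta>2" using \<theta> \<theta>1 by simp
  obtain c where c: "0 < c" "\<And>z. 0 \<le> z \<Longrightarrow> c * exp (- \<theta>1 * z) \<le> measure \<pi> {u\<in>space \<pi>. z < fst u}"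
    using invariant_tail[OF \<pi> \<theta>1 f1 \<Lambda>1 Q1] by blast
  obtain k where k: "0 < k" "\<And>s. 1 \<le> k * f2 s" using normalize_weight[of f2] f2 by blast
  define g where "g s = k * f2 s" for s
  have g: "1 \<le> g s" for s using k by (simp add: g_def)
  have g0: "0 \<le> g s" for s using g[of s] by linarith
  have Qg: "(\<Sum>s'\<in>UNIV. q s s' * g s') \<le> (exit_rate q s + \<Lambda>2 - \<theta>2 * d s) * g s" for s
    using mult_left_mono[OF Q2[of s], of k] k by (simp add: g_def sum_distrib_left mult_ac)
  obtain K0 where K0: "0 \<le> K0" "\<And>t x s. 0 \<le> t \<Longrightarrow> 0 \<le> x \<Longrightarrow>
    (\<integral>\<^sup>+z. ennreal (exp (\<theta>2 * fst z) * g (snd z)) \<partial>TR t (x, s)) \<le> ennreal (exp (\<Lambda>2 * t) * (exp (\<theta>2 * x) * g s) + K0 * (1 + t) * exp (max 0 \<Lambda>2 * t))"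
    by (rule lyapunov[where \<Lambda> = \<Lambda>2 and f = g and \<theta> = \<theta>2]) (use \<theta>2 g Qg in auto)
  \<comment> \<open>The moment bound carries max 0 \<Lambda>2; the strict upper bound for \<Lambda>2
    passes to this maximum since y (\<theta>2 - \<theta>1) is positive.\<close>
  define L where "L = max 0 \<Lambda>2"
  have L: "0 \<le> L" "\<Lambda>2 \<le> L" "L < y * (\<theta>2 - \<theta>1)" using \<Lambda>2 y \<theta> by (auto simp: L_def)
  define C where "C = exp (\<theta>2 * x) * g s + K0"
  have C0: "0 \<le> C" using g0 K0 by (simp add: C_def)
  \<comment> \<open>A Chernoff bound with the exponent \<theta>2.\<close>
  have upper: "measure (TR t (x, s)) {u\<in>space E_space. y * t < fst u} \<le> C * (1 + t) * exp (L * t - \<theta>2 * (y * t))" if t: "0 \<le> t" for t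
  proof -
    interpret P: prob_space "TR t (x, s)" by (rule prob_space_TR)
    let ?A = "{u\<in>space (E_space :: (real \<times> 's) measure). y * t < fst u}"
    have A: "?A \<in> sets E_space" by measurable
    have "ennreal (exp (\<theta>2 * (y * t))) * emeasure (TR t (x, s)) ?A = (\<integral>\<^sup>+u. ennreal (exp (\<theta>2 * (y * t))) * indicator ?A u \<partial>TR t (x, s))"
      using A by (simp add: nn_integral_cmult)
    also have "\<dots> \<le> (\<integral>\<^sup>+z. ennreal (exp (\<theta>2 * fst z) * g (snd z)) \<partial>TR t (x, s))"
    proof (rule nn_integral_mono)
      fix u
      have "exp (\<theta>2 * (y * t)) * 1 \<le> exp (\<theta>2 * fst u) * g (snd u)" if "y * t < fst u"
        using that \<theta>2 g by (intro mult_mono) auto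
      then show "ennreal (exp (\<theta>2 * (y * t))) * indicator ?A u \<le> ennreal (exp (\<theta>2 * fst u) * g (snd u))"
        by (auto simp: indicator_def intro!: ennreal_leI)
    qed
    also have "\<dots> \<le> ennreal (exp (\<Lambda>2 * t) * (exp (\<theta>2 * x) * g s) + K0 * (1 + t) * exp (max 0 \<Lambda>2 * t))"
      by (rule K0(2)[OF t x])
    also have "\<dots> \<le> ennreal (C * (1 + t) * exp (L * t))"
    proof (rule ennreal_leI)
      have "exp (\<Lambda>2 * t) * (exp (\<theta>2 * x) * g s) \<le> exp (L * t) * ((exp (\<theta>2 * x) * g s) * (1 + t))"
      proof (rule mult_mono)
        show "exp (\<Lambda>2 * t) \<le> exp (L * t)" using L t by (auto intro: mult_right_mono)
        show "exp (\<theta>2 * x) * g s \<le> (exp (\<theta>2 * x) * g s) * (1 + t)"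
          using mult_left_mono[of 1 "1 + t" "exp (\<theta>2 * x) * g s"] t g0 by simp
      qed (use g0 in auto)
      then show "exp (\<Lambda>2 * t) * (exp (\<theta>2 * x) * g s) + K0 * (1 + t) * exp (max 0 \<Lambda>2 * t) \<le> C * (1 + t) * exp (L * t)"
        by (simp add: C_def L_def algebra_simps del: mult_exp_exp)
    qed
    finally have "exp (\<theta>2 * (y * t)) * measure (TR t (x, s)) ?A \<le> C * (1 + t) * exp (L * t)"
      using C0 t by (simp add: P.emeasure_eq_measure ennreal_mult[symmetric])
    then show ?thesis by (simp add: exp_diff field_simps)
  qed
  have "\<forall>\<^sub>F t in at_top. C * (1 + t) * exp (L * t - \<theta>2 * (y * t)) \<le> c / 2 * exp (- (\<theta>1 * y) * t)"
  proof -
    \<comment> \<open>The surplus exponent after the two tails have been compared at the level y t.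
      It absorbs the factor 1 + t and leaves half of the lower bound for \<pi>.\<close>
    define \<epsilon> where "\<epsilon> = y * (\<theta>2 - \<theta>1) - L"
    have \<epsilon>: "0 < \<epsilon>" using L by (simp add: \<epsilon>_def)
    have "((\<lambda>t. C * (1 + t) * exp (- \<epsilon> * t)) \<longlongrightarrow> 0) at_top"
      using \<epsilon> by real_asymp
    then have "\<forall>\<^sub>F t in at_top. C * (1 + t) * exp (- \<epsilon> * t) < c / 2"
      using c by (intro order_tendstoD) auto
    then show ?thesis
    proof eventually_elim
      case (elim t)
      have "exp (L * t - \<theta>2 * (y * t)) = exp (- \<epsilon> * t) * exp (- (\<theta>1 * y) * t)"
        by (simp add: mult_exp_exp \<epsilon>_def algebra_simps)
      then have "C * (1 + t) * exp (L * t - \<theta>2 * (y * t)) = (C * (1 + t) * exp (- \<epsilon> * t)) * exp (- (\<theta>1 * y) * t)"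
        by simp
      also have "\<dots> \<le> c / 2 * exp (- (\<theta>1 * y) * t)"
        using elim by (intro mult_right_mono) auto
      finally show ?case .
    qed
  qed
  then have "\<forall>\<^sub>F t in at_top. c / 2 * exp (- (\<theta>1 * y) * t) \<le> tv_dist (TR t (x, s)) \<pi>"
    using eventually_ge_at_top[of 0]
  proof eventually_elim
    case (elim t)
    let ?A = "{u\<in>space (E_space :: (real \<times> 's) measure). y * t < fst u}"
    have A: "?A \<in> sets E_space" by measurable
    have sp: "space \<pi> = space E_space" using invariant_D(3)[OF \<pi>] by (simp add: space_E)
    have eqs: "sets (TR t (x, s) \<Otimes>\<^sub>M \<pi>) = sets (E_space \<Otimes>\<^sub>M E_space)"
      by (rule sets_pair_measure_cong[OF sets_TR invariant_D(2)[OF \<pi>]])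
    have "measure \<pi> ?A - measure (TR t (x, s)) ?A \<le> tv_dist (TR t (x, s)) \<pi>"
    proof (rule tv_dist_ge[OF prob_space_TR invariant_D(1)[OF \<pi>]])
      show "{u\<in>space (TR t (x, s) \<Otimes>\<^sub>M \<pi>). fst u \<noteq> snd u} \<in> sets (TR t (x, s) \<Otimes>\<^sub>M \<pi>)"
        using sets_diagonal_E unfolding eqs sets_eq_imp_space_eq[OF eqs] .
    qed (use A invariant_D(2)[OF \<pi>] in auto)
    moreover have "c * exp (- \<theta>1 * (y * t)) \<le> measure \<pi> ?A"
      using c(2)[of "y * t"] y elim by (simp add: sp)
    moreover have "c * exp (- \<theta>1 * (y * t)) = 2 * (c / 2 * exp (- (\<theta>1 * y) * t))"
      by (simp add: mult.assoc)
    ultimately show ?case using upper[of t] elim by linarith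
  qed
  then show ?thesis using c by (intro decay_rate_le[of "c / 2"]) auto
qed

end

subsection \<open>The instantaneous linear process\<close>

text \<open>
  The eigenvalue problem for \<open>exp (\<theta> x) f\<close> is solved by eigenvalue \<open>2 (l - c \<theta>)\<close> whenever
  \<open>v\<^sup>2 \<theta>\<^sup>2 = G l\<close>. At the decay rate \<open>\<theta> = l / c\<close> of the invariant measure the eigenvalue vanishes;
  parameters slightly above it have the properties needed in \<open>tv_slow\<close>.
\<close>

lemma exists_slow_parameters:
  fixes G g :: "real \<Rightarrow> real"
  assumes v: "0 < v" and c: "0 < c" and l: "0 < l" and B: "0 < B"
    and G_pos: "\<And>z. 0 < z \<Longrightarrow> 0 < G z" and G_mono: "\<And>y z. 0 < y \<Longrightarrow> y < z \<Longrightarrow> G y < G z"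
    and G_deriv: "\<And>z. 0 < z \<Longrightarrow> (G has_real_derivative g z) (at z)"
    and root: "c\<^sup>2 * G l = l\<^sup>2 * v\<^sup>2"
    and incr: "c\<^sup>2 * g l < 2 * v\<^sup>2 * l"
    and slope: "4 * l\<^sup>2 * v\<^sup>2 < (B + 2 * l) * (c\<^sup>2 * g l)"
  obtains a b \<theta>1 \<theta>2 where "0 < a" "0 < b" "(v * \<theta>1)\<^sup>2 = G a" "(v * \<theta>2)\<^sup>2 = G b"
    "0 < \<theta>1" "\<theta>1 < \<theta>2" "0 < 2 * a - 2 * c * \<theta>1" "2 * b - 2 * c * \<theta>2 < B / \<theta>1 * (\<theta>2 - \<theta>1)"
proof -
  \<comment> \<open>The exponent \<theta> as a function of the spectral parameter: the positive
    solution of (v \<theta>)^2 = G z. The hypothesis \<open>root\<close> then reads c T l =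
    l.\<close>
  define T where "T z = sqrt (G z) / v" for z
  have T_pos: "0 < T z" if "0 < z" for z using G_pos[OF that] v by (simp add: T_def)
  have T_sq: "(v * T z)\<^sup>2 = G z" if "0 < z" for z using G_pos[OF that] v by (simp add: T_def)
  have T_mono: "T y < T z" if "0 < y" "y < z" for y z
    using G_mono[OF that] v by (simp add: T_def divide_strict_right_mono)
  have T_deriv: "(T has_real_derivative g z / (2 * sqrt (G z) * v)) (at z)" if "0 < z" for z
    unfolding T_def using G_pos[OF that] v
    by (auto intro!: derivative_eq_intros G_deriv that simp: field_simps)
  have cvT: "c * T l = l"
  proof (rule power2_eq_imp_eq)
    have "v\<^sup>2 * (c * T l)\<^sup>2 = c\<^sup>2 * G l" using T_sq[OF l] by (simp add: power_mult_distrib mult_ac)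
    then show "(c * T l)\<^sup>2 = l\<^sup>2" using root v by simp
  qed (use c l T_pos[OF l] in auto)
  \<comment> \<open>The derivative of \<open>T\<close> at l. The hypotheses \<open>incr\<close> and
    \<open>slope\<close> translate into c \<tau> < 1 and 2 l < (B + 2 l) c \<tau>.\<close>
  define \<tau> where "\<tau> = g l / (2 * sqrt (G l) * v)"
  have sG: "c * sqrt (G l) = l * v" using cvT v by (simp add: T_def field_simps)
  have \<tau>: "(2 * v\<^sup>2 * l) * \<tau> = c * g l"
  proof -
    have "sqrt (G l) = l * v / c" using sG c by (simp add: field_simps)
    then show ?thesis unfolding \<tau>_def using c v l by (simp only:) (simp add: field_simps power2_eq_square)
  qed
  have vl: "0 < 2 * v\<^sup>2 * l" using v l by simp
  have \<tau>1: "c * \<tau> < 1"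
  proof -
    have "(2 * v\<^sup>2 * l) * (c * \<tau>) = c\<^sup>2 * g l" using \<tau> by (simp add: power2_eq_square mult_ac)
    also have "\<dots> < (2 * v\<^sup>2 * l) * 1" using incr by simp
    finally show ?thesis using mult_less_cancel_left_pos[OF vl] by blast
  qed
  have \<tau>2: "2 * l < (B + 2 * l) * (c * \<tau>)"
  proof -
    have "(2 * v\<^sup>2 * l) * (2 * l) = 4 * l\<^sup>2 * v\<^sup>2" by (simp add: power2_eq_square)
    also note slope
    also have "(B + 2 * l) * (c\<^sup>2 * g l) = (2 * v\<^sup>2 * l) * ((B + 2 * l) * (c * \<tau>))"
      using arg_cong[OF \<tau>[symmetric], of "\<lambda>x. (B + 2 * l) * c * x"] by (simp add: power2_eq_square mult_ac)
    finally show ?thesis using mult_less_cancel_left_pos[OF vl] by blast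
  qed
  define E where "E z = 2 * z - 2 * c * T z" for z
  have El: "E l = 0" using cvT by (simp add: E_def)
  have E_deriv: "(E has_real_derivative 2 - 2 * c * \<tau>) (at l)"
    unfolding E_def \<tau>_def by (auto intro!: derivative_eq_intros T_deriv l)
  \<comment> \<open>With \<theta>1 = T y and \<theta>2 = T z, positivity of \<open>F y z\<close> is
    the last inequality of the claim multiplied by \<theta>1. At y = z = l both sides of it vanish,
    so a derivative in z decides the sign to the right of l.\<close>
  define F where "F y z = B * (T z - T y) - T y * E z" for y z
  have F_deriv: "((\<lambda>z. F l z) has_real_derivative B * \<tau> - T l * (2 - 2 * c * \<tau>)) (at l)"
    unfolding F_def by (auto intro!: derivative_eq_intros E_deriv T_deriv l simp: \<tau>_def)
  have "0 < B * \<tau> - T l * (2 - 2 * c * \<tau>)"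
  proof -
    have "c * (B * \<tau> - T l * (2 - 2 * c * \<tau>)) = B * (c * \<tau>) - (c * T l) * (2 - 2 * (c * \<tau>))"
      by (simp add: algebra_simps)
    also have "\<dots> = (B + 2 * l) * (c * \<tau>) - 2 * l" unfolding cvT by (simp add: algebra_simps)
    finally have "0 < c * (B * \<tau> - T l * (2 - 2 * c * \<tau>))" using \<tau>2 by linarith
    then show ?thesis using c zero_less_mult_pos by blast
  qed
  from DERIV_pos_inc_right[OF F_deriv this] obtain e1 where e1: "0 < e1" "\<And>h. 0 < h \<Longrightarrow> h < e1 \<Longrightarrow> F l l < F l (l + h)"
    by blast
  \<comment> \<open>The order of choice matters: \<open>b\<close> is fixed for y = l, where the
    first eigenvalue is still zero. Only then is y moved slightly to the right of l, which makes
    \<open>E\<close> positive while \<open>F\<close> stays positive by continuity.\<close>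
  define b where "b = l + e1 / 2"
  have b: "l < b" "0 < b" using e1 l by (auto simp: b_def)
  have Fb: "0 < F l b" using e1(2)[of "e1 / 2"] e1(1) by (simp add: b_def F_def El)
  have "0 < 2 - 2 * c * \<tau>" using \<tau>1 by simp
  from DERIV_pos_inc_right[OF E_deriv this] obtain e2 where e2: "0 < e2" "\<And>h. 0 < h \<Longrightarrow> h < e2 \<Longrightarrow> E l < E (l + h)"
    by blast
  have "isCont (\<lambda>y. F y b) l"
    unfolding F_def using DERIV_isCont[OF T_deriv[OF l]] by (auto intro!: continuous_intros)
  then have "\<forall>\<^sub>F y in at l. 0 < F y b"
    using Fb by (intro order_tendstoD) (auto simp: isCont_def)
  then obtain e3 where e3: "0 < e3" "\<And>y. y \<noteq> l \<Longrightarrow> dist y l < e3 \<Longrightarrow> 0 < F y b"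
    by (auto simp: eventually_at)
  define h where "h = min (e2 / 2) (min (e3 / 2) (e1 / 4))"
  have h: "0 < h" "h < e2" "h < e3" "l + h < b" using e1 e2 e3 by (auto simp: h_def b_def)
  have Fa: "0 < F (l + h) b" using e3(2)[of "l + h"] h by (simp add: dist_real_def)
  have Ea: "0 < E (l + h)" using e2(2)[of h] h by (simp add: El)
  show ?thesis
  proof (rule that[of "l + h" b "T (l + h)" "T b"])
    show "2 * b - 2 * c * T b < B / T (l + h) * (T b - T (l + h))"
      using Fa T_pos[of "l + h"] h l by (simp add: F_def E_def field_simps)
    show "0 < 2 * (l + h) - 2 * c * T (l + h)" using Ea by (simp add: E_def)
  qed (use b h l T_sq[of "l + h"] T_sq[of b] T_pos[of "l + h"] T_mono[of "l + h" b] in auto)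
qed

section \<open>The three-state tumble as two independent two-state motors\<close>

lemma UNIV_inst: "(UNIV :: inst_state set) = {Inst_Plus2, Inst_Zero, Inst_Minus2}"
  using inst_state.exhaust by blast

lemma sum_inst: "(\<Sum>s\<in>UNIV. h s) = h Inst_Plus2 + h Inst_Zero + h Inst_Minus2" for h :: "inst_state \<Rightarrow> real"
  by (simp add: UNIV_inst add.assoc)

lemma exit_inst: "exit_rate (inst_rate \<omega>) s = 2 * \<omega>"
  by (cases s) (simp_all add: exit_rate_def sum_inst)

primrec inst_fun :: "real \<Rightarrow> real \<Rightarrow> real \<Rightarrow> inst_state \<Rightarrow> real" where
  "inst_fun a b c Inst_Plus2 = a"
| "inst_fun a b c Inst_Zero = b"
| "inst_fun a b c Inst_Minus2 = c"

text \<open>The tumble is the sum of two independent motors with values 1 and -1 that flip at rate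
  \<omega>. For A = l + \<omega> + u the pair (A, \<omega>) solves the tilted one-motor problem with
  eigenvalue l, because \<open>eq\<close> says (l + \<omega>)^2 - u^2 = \<omega>^2; products of
  one-motor weights belong to the sum 2 l.\<close>

lemma inst_weight:
  assumes \<omega>: "0 < \<omega>" and l: "0 < l" and u: "0 \<le> u" and eq: "u\<^sup>2 = l * (l + 2 * \<omega>)"
  obtains f where "\<And>s. 0 < f s"
    "\<And>s. (\<Sum>s'\<in>UNIV. inst_rate \<omega> s s' * f s') = (2 * \<omega> + 2 * l - u * inst_value s) * f s"
proof -
  define A where "A = l + \<omega> + u"
  have A: "0 < A" using assms by (simp add: A_def)
  have A1: "(l + \<omega> - u) * A = \<omega>\<^sup>2" using eq by (simp add: A_def power2_eq_square algebra_simps)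
  have A2: "A\<^sup>2 + \<omega>\<^sup>2 = 2 * (\<omega> + l) * A" using eq by (simp add: A_def power2_eq_square algebra_simps)
  show ?thesis
  proof (rule that[of "inst_fun (A\<^sup>2) (A * \<omega>) (\<omega>\<^sup>2)"])
    show "0 < inst_fun (A\<^sup>2) (A * \<omega>) (\<omega>\<^sup>2) s" for s using A \<omega> by (cases s) auto
    show "(\<Sum>s'\<in>UNIV. inst_rate \<omega> s s' * inst_fun (A\<^sup>2) (A * \<omega>) (\<omega>\<^sup>2) s') =
      (2 * \<omega> + 2 * l - u * inst_value s) * inst_fun (A\<^sup>2) (A * \<omega>) (\<omega>\<^sup>2) s" for s
    proof (cases s)
      case Inst_Plus2
      have "(2 * \<omega> + 2 * l - u * 2) * A\<^sup>2 = 2 * A * ((l + \<omega> - u) * A)"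
        by (simp add: power2_eq_square algebra_simps)
      also have "\<dots> = 2 * \<omega> * (A * \<omega>)" unfolding A1 by (simp add: power2_eq_square)
      finally show ?thesis using Inst_Plus2 by (simp add: sum_inst)
    next
      case Inst_Zero
      have "\<omega> * A\<^sup>2 + \<omega> * \<omega>\<^sup>2 = \<omega> * (2 * (\<omega> + l) * A)" unfolding A2[symmetric] by (simp add: algebra_simps)
      then show ?thesis using Inst_Zero by (simp add: sum_inst algebra_simps)
    next
      case Inst_Minus2
      then show ?thesis by (simp add: sum_inst A_def power2_eq_square algebra_simps)
    qed
  qed
qed

text \<open>The eigenvalues are 0, - 2 \<omega> and - 4 \<omega>. The constants,
  \<open>inst_value\<close> and the product of the signs of the two motors span all functions on the
  three states, in particular the indicators.\<close>

lemma inst_mixes: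
  assumes \<omega>: "0 < \<omega>" and "jump_flow (inst_rate \<omega>) \<phi>"
  shows "jump_flow.mixes (inst_rate \<omega>) \<phi> (2 * \<omega>) (indicator {s})"
proof -
  interpret jump_flow "inst_rate \<omega>" \<phi> by fact
  have e1: "mixes (2 * \<omega>) inst_value"
    by (rule mixes_eigen[where \<Lambda> = "2 * \<omega>"], rename_tac s, case_tac s)
       (use \<omega> in \<open>simp_all add: sum_inst exit_inst\<close>)
  have e2: "mixes (2 * \<omega>) (inst_fun 1 (-1) 1)"
    by (rule mixes_eigen[where \<Lambda> = "4 * \<omega>"], rename_tac s, case_tac s)
       (use \<omega> in \<open>simp_all add: sum_inst exit_inst\<close>)
  have comb: "mixes (2 * \<omega>) (\<lambda>s. a + (b * inst_value s + c * inst_fun 1 (-1) 1 s))" for a b c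
    by (intro mixes_add mixes_const mixes_scale e1 e2)
  have "\<exists>a b c. (indicator {s} :: inst_state \<Rightarrow> real) = (\<lambda>s. a + (b * inst_value s + c * inst_fun 1 (-1) 1 s))"
  proof (cases s)
    case Inst_Plus2
    show ?thesis unfolding Inst_Plus2
      by (rule exI[of _ "1/4"], rule exI[of _ "1/4"], rule exI[of _ "1/4"], rule ext, rename_tac s', case_tac s') auto
  next
    case Inst_Zero
    show ?thesis unfolding Inst_Zero
      by (rule exI[of _ "1/2"], rule exI[of _ 0], rule exI[of _ "-1/2"], rule ext, rename_tac s', case_tac s') auto
  next
    case Inst_Minus2
    show ?thesis unfolding Inst_Minus2
      by (rule exI[of _ "1/4"], rule exI[of _ "-1/4"], rule exI[of _ "1/4"], rule ext, rename_tac s', case_tac s') auto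
  qed
  then show ?thesis using comb by metis
qed

theorem inst_linear_bounds:
  assumes \<omega>: "0 < \<omega>" and c: "0 < c" and cv: "c < v" and \<pi>: "invariant_prob (inst_linear \<omega> v c) \<pi>" and x: "0 \<le> x"
  shows "ereal (1 / 2 * \<omega> * (c\<^sup>2 / v\<^sup>2)) \<le> Liminf at_top (\<lambda>t. - (log_ext (tv_dist (inst_linear \<omega> v c t (x, s)) \<pi>) / ereal t))"
    and "Limsup at_top (\<lambda>t. - (log_ext (tv_dist (inst_linear \<omega> v c t (x, s)) \<pi>) / ereal t)) \<le> ereal (4 * \<omega> * (c\<^sup>2 / v\<^sup>2))"
proof -
  have v: "0 < v" using c cv by simp
  interpret linear_jump "inst_rate \<omega>" "\<lambda>s. v * inst_value s - 2 * c"
  proof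
    show "0 \<le> inst_rate \<omega> s s'" for s s' using \<omega> by (cases "(\<omega>, s, s')" rule: inst_rate.cases) auto
    show "0 < exit_rate (inst_rate \<omega>) s" for s using \<omega> by (simp add: exit_inst)
  qed
  have P: "inst_linear \<omega> v c = TR"
    unfolding inst_linear_def by (intro arg_cong2[where f = transition] ext) (simp_all add: linear_flow_def)
  note \<pi>' = \<pi>[unfolded P]
  have mix: "mixes (2 * \<omega>) (indicator {s})" for s
    by (rule inst_mixes[OF \<omega>]) unfold_locales
  define y where "y = c\<^sup>2 / v\<^sup>2"
  have y: "0 < y" "y < 1" using c cv by (auto simp: y_def power_strict_mono)
  have weight: "\<exists>f. (\<forall>s. 0 < f s) \<and> (\<forall>s. (\<Sum>s'\<in>UNIV. inst_rate \<omega> s s' * f s') =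
      (exit_rate (inst_rate \<omega>) s + (2 * l - 2 * c * \<theta>) - \<theta> * (v * inst_value s - 2 * c)) * f s)"
    if l: "0 < l" and \<theta>: "0 < \<theta>" and eq: "(v * \<theta>)\<^sup>2 = l * (l + 2 * \<omega>)" for l \<theta>
  proof -
    have "0 \<le> v * \<theta>" using v \<theta> by simp
    from inst_weight[OF \<omega> l this eq] obtain f where "\<And>s. 0 < f s"
      "\<And>s. (\<Sum>s'\<in>UNIV. inst_rate \<omega> s s' * f s') = (2 * \<omega> + 2 * l - v * \<theta> * inst_value s) * f s" by blast
    then show ?thesis by (intro exI[of _ f]) (simp add: exit_inst algebra_simps)
  qed
  show "ereal (1 / 2 * \<omega> * (c\<^sup>2 / v\<^sup>2)) \<le> Liminf at_top (\<lambda>t. - (log_ext (tv_dist (inst_linear \<omega> v c t (x, s)) \<pi>) / ereal t))"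
  proof -
    \<comment> \<open>The maximiser of 2 c \<theta> - 2 l when l is neglected against 2 \<omega>
      under the root. The gap it gives is at least \<omega> y, twice the claimed rate.\<close>
    define l where "l = \<omega> * y / 2"
    define \<theta> where "\<theta> = sqrt (l * (l + 2 * \<omega>)) / v"
    have l: "0 < l" using \<omega> y by (simp add: l_def)
    then have G: "0 < l * (l + 2 * \<omega>)" using \<omega> by simp
    have \<theta>: "0 < \<theta>" "(v * \<theta>)\<^sup>2 = l * (l + 2 * \<omega>)" using G v by (simp_all add: \<theta>_def)
    have "l + \<omega> * y / 2 \<le> c * \<theta>"
    proof (rule power2_le_imp_le)
      have "(c * \<theta>)\<^sup>2 = y * (v * \<theta>)\<^sup>2" using v by (simp add: y_def power_mult_distrib)
      also have "\<dots> = y * (l * (l + 2 * \<omega>))" unfolding \<theta>(2) ..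
      finally show "(l + \<omega> * y / 2)\<^sup>2 \<le> (c * \<theta>)\<^sup>2"
        using \<omega> y by (simp add: l_def power2_eq_square algebra_simps)
    qed (use c \<theta> in auto)
    then have gap: "\<omega> * y \<le> 2 * c * \<theta> - 2 * l" by (simp add: l_def)
    from weight[OF l \<theta>] obtain f where f: "\<And>s. 0 < f s" "\<And>s. (\<Sum>s'\<in>UNIV. inst_rate \<omega> s s' * f s') =
      (exit_rate (inst_rate \<omega>) s + (2 * l - 2 * c * \<theta>) - \<theta> * (v * inst_value s - 2 * c)) * f s" by blast
    have "ereal (1 / 2 * \<omega> * (c\<^sup>2 / v\<^sup>2)) \<le> Liminf at_top (\<lambda>t. - (log_ext (tv_dist (TR t (x, s)) \<pi>) / ereal t))"
    proof (rule tv_decay[OF \<pi>' mix x \<theta>(1), where f = f and \<rho> = "2 * c * \<theta> - 2 * l"])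
      have "0 < \<omega> * y" using \<omega> y by simp
      then show "0 < 2 * c * \<theta> - 2 * l" using gap by linarith
      have "\<omega> * y \<le> \<omega> * 1" using \<omega> y by (intro mult_left_mono) auto
      then show "1 / 2 * \<omega> * (c\<^sup>2 / v\<^sup>2) \<le> 2 * \<omega> / 2" using \<omega> unfolding y_def[symmetric] by simp
      show "1 / 2 * \<omega> * (c\<^sup>2 / v\<^sup>2) \<le> (2 * c * \<theta> - 2 * l) / 2" using gap unfolding y_def[symmetric] by simp
    qed (use f in \<open>simp_all\<close>)
    then show ?thesis unfolding P .
  qed
  show "Limsup at_top (\<lambda>t. - (log_ext (tv_dist (inst_linear \<omega> v c t (x, s)) \<pi>) / ereal t)) \<le> ereal (4 * \<omega> * (c\<^sup>2 / v\<^sup>2))"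
  proof -
    define B where "B = 4 * \<omega> * y"
    have B: "0 < B" using \<omega> y by (simp add: B_def)
    have vc: "0 < v\<^sup>2 - c\<^sup>2" using c cv by (simp add: power_strict_mono)
    \<comment> \<open>The root of c^2 (l + 2 \<omega>) = l v^2, that is, of c \<theta> = l; it is
      positive because c < v.\<close>
    define l where "l = 2 * \<omega> * c\<^sup>2 / (v\<^sup>2 - c\<^sup>2)"
    have l: "0 < l" using \<omega> c vc by (simp add: l_def)
    have rel: "c\<^sup>2 * (l + 2 * \<omega>) = l * v\<^sup>2"
      using vc by (simp add: l_def field_simps)
    have yl: "y * (l + 2 * \<omega>) = l" using rel v by (simp add: y_def field_simps)
    obtain a b \<theta>1 \<theta>2 where ab: "0 < a" "0 < b" "(v * \<theta>1)\<^sup>2 = a * (a + 2 * \<omega>)" "(v * \<theta>2)\<^sup>2 = b * (b + 2 * \<omega>)"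
      "0 < \<theta>1" "\<theta>1 < \<theta>2" "0 < 2 * a - 2 * c * \<theta>1" "2 * b - 2 * c * \<theta>2 < B / \<theta>1 * (\<theta>2 - \<theta>1)"
    proof (rule exists_slow_parameters[OF v c l B, where G = "\<lambda>z. z * (z + 2 * \<omega>)" and g = "\<lambda>z. 2 * z + 2 * \<omega>"])
      show "y * (y + 2 * \<omega>) < z * (z + 2 * \<omega>)" if "0 < y" "y < z" for y z
        using that \<omega> by (intro mult_strict_mono) auto
      show "((\<lambda>z. z * (z + 2 * \<omega>)) has_real_derivative 2 * z + 2 * \<omega>) (at z)" for z
        by (auto intro!: derivative_eq_intros)
      show "c\<^sup>2 * (l * (l + 2 * \<omega>)) = l\<^sup>2 * v\<^sup>2"
        using arg_cong[OF rel, of "\<lambda>z. l * z"] by (simp add: power2_eq_square mult_ac)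
      have "c\<^sup>2 * (2 * l + 2 * \<omega>) < c\<^sup>2 * (2 * (l + 2 * \<omega>))" using c \<omega> by (intro mult_strict_left_mono) auto
      also have "\<dots> = 2 * v\<^sup>2 * l" using rel by (simp add: algebra_simps)
      finally show "c\<^sup>2 * (2 * l + 2 * \<omega>) < 2 * v\<^sup>2 * l" .
      \<comment> \<open>The slope condition after c^2 (l + 2 \<omega>) = l v^2 has removed v.
        Multiplied by l + 2 \<omega> it reduces to (l + 2 \<omega>)^2 < (l + 4 \<omega>) (l +
        \<omega>).\<close>
      have "4 * l * (l + 2 * \<omega>) < (B + 2 * l) * (2 * l + 2 * \<omega>)"
      proof -
        have "(4 * l * (l + 2 * \<omega>)) * (l + 2 * \<omega>) < 4 * l * (l + 4 * \<omega>) * (l + \<omega>)"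
          using l \<omega> by (simp add: algebra_simps)
        also have "\<dots> = ((B + 2 * l) * (2 * l + 2 * \<omega>)) * (l + 2 * \<omega>)"
        proof -
          have "B * (l + 2 * \<omega>) = 4 * \<omega> * l" using arg_cong[OF yl, of "\<lambda>z. 4 * \<omega> * z"] by (simp add: B_def mult_ac)
          then have "(B + 2 * l) * (l + 2 * \<omega>) = 2 * l * (l + 4 * \<omega>)" by (simp add: algebra_simps)
          then have "(B + 2 * l) * (l + 2 * \<omega>) * (2 * l + 2 * \<omega>) = 2 * l * (l + 4 * \<omega>) * (2 * l + 2 * \<omega>)" by simp
          then show ?thesis by (simp add: algebra_simps)
        qed
        finally show ?thesis using l \<omega> by simp
      qed
      then have "c\<^sup>2 * (4 * l * (l + 2 * \<omega>)) < c\<^sup>2 * ((B + 2 * l) * (2 * l + 2 * \<omega>))" using c by simp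
      moreover have "c\<^sup>2 * (4 * l * (l + 2 * \<omega>)) = 4 * l\<^sup>2 * v\<^sup>2"
        using arg_cong[OF rel, of "\<lambda>z. 4 * l * z"] by (simp add: power2_eq_square mult_ac)
      ultimately show "4 * l\<^sup>2 * v\<^sup>2 < (B + 2 * l) * (c\<^sup>2 * (2 * l + 2 * \<omega>))" by (simp add: mult_ac)
    qed (use \<omega> in auto)
    have \<theta>2: "0 < \<theta>2" using ab by simp
    from weight[OF ab(1,5,3)] obtain f1 where f1: "\<And>s. 0 < f1 s" "\<And>s. (\<Sum>s'\<in>UNIV. inst_rate \<omega> s s' * f1 s') =
      (exit_rate (inst_rate \<omega>) s + (2 * a - 2 * c * \<theta>1) - \<theta>1 * (v * inst_value s - 2 * c)) * f1 s" by blast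
    from weight[OF ab(2) \<theta>2 ab(4)] obtain f2 where f2: "\<And>s. 0 < f2 s" "\<And>s. (\<Sum>s'\<in>UNIV. inst_rate \<omega> s s' * f2 s') =
      (exit_rate (inst_rate \<omega>) s + (2 * b - 2 * c * \<theta>2) - \<theta>2 * (v * inst_value s - 2 * c)) * f2 s" by blast
    \<comment> \<open>The level moves at speed B / \<theta>1, so that the resulting rate equals B
      whatever the perturbed value of \<theta>1.\<close>
    have "Limsup at_top (\<lambda>t. - (log_ext (tv_dist (TR t (x, s)) \<pi>) / ereal t)) \<le> ereal (\<theta>1 * (B / \<theta>1))"
      by (rule tv_slow[OF \<pi>' x ab(5,6), where ?f1.0 = f1 and ?f2.0 = f2, OF f1(1) f2(1) ab(7) _ ab(8) f1(2)]) (use B ab(5) f2(2) in auto)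
    then show ?thesis unfolding P using ab(5) by (simp add: B_def y_def)
  qed
qed

subsection \<open>The finite linear process\<close>

lemma UNIV_fin: "(UNIV :: fin_state set) =
    {Fin_Plus2, Fin_Plus1, Fin_Zero_PM, Fin_Zero_Zero, Fin_Minus1, Fin_Minus2}"
  using fin_state.exhaust by blast

lemma sum_fin: "(\<Sum>s\<in>UNIV. h s) = h Fin_Plus2 + h Fin_Plus1 + h Fin_Zero_PM + h Fin_Zero_Zero + h Fin_Minus1 + h Fin_Minus2"
  for h :: "fin_state \<Rightarrow> real"
  by (simp add: UNIV_fin add.assoc)

primrec fin_fun :: "real \<Rightarrow> real \<Rightarrow> real \<Rightarrow> real \<Rightarrow> real \<Rightarrow> real \<Rightarrow> fin_state \<Rightarrow> real" where
  "fin_fun a b c d e f Fin_Plus2 = a"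
| "fin_fun a b c d e f Fin_Plus1 = b"
| "fin_fun a b c d e f Fin_Zero_PM = c"
| "fin_fun a b c d e f Fin_Zero_Zero = d"
| "fin_fun a b c d e f Fin_Minus1 = e"
| "fin_fun a b c d e f Fin_Minus2 = f"

lemma exit_fin: "exit_rate (fin_rate \<alpha> \<beta>) s = fin_fun (2 * \<alpha>) (\<alpha> + \<beta>) (2 * \<alpha>) (2 * \<beta>) (\<alpha> + \<beta>) (2 * \<alpha>) s"
  by (cases s) (simp_all add: exit_rate_def sum_fin)

text \<open>
  The finite tumble is the sum of two independent motors with states \<open>1, 0, -1\<close>; the weight is the
  product of the corresponding one-motor weights \<open>g1, g0, g2\<close>.
\<close>

lemma fin_weight:
  assumes \<alpha>: "0 < \<alpha>" and \<beta>: "0 < \<beta>" and l: "0 < l" and u: "0 \<le> u"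
    and eq: "u\<^sup>2 * (l + \<beta>) = l * (l + \<alpha>) * (l + \<alpha> + \<beta>)"
  obtains f where "\<And>s. 0 < f s"
    "\<And>s. (\<Sum>s'\<in>UNIV. fin_rate \<alpha> \<beta> s s' * f s') = (exit_rate (fin_rate \<alpha> \<beta>) s + 2 * l - u * fin_value s) * f s"
proof -
  \<comment> \<open>The eigenvector of the tilted one-motor problem, up to a factor: a motor leaves
    1 and -1 for 0 at rate \<alpha>, and leaves 0 for each of them at rate \<beta> / 2.\<close>
  define g1 g0 g2 where "g1 = \<alpha> * (\<alpha> + l + u)" and "g0 = (\<alpha> + l)\<^sup>2 - u\<^sup>2" and "g2 = \<alpha> * (\<alpha> + l - u)"
  have u_less: "u < \<alpha> + l"
  proof (rule power2_less_imp_less)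
    have "u\<^sup>2 * (l + \<beta>) < (\<alpha> + l)\<^sup>2 * (l + \<beta>)"
      unfolding eq using \<alpha> \<beta> l by (simp add: power2_eq_square algebra_simps add_pos_pos)
    then show "u\<^sup>2 < (\<alpha> + l)\<^sup>2" using l \<beta> by simp
  qed (use \<alpha> l in auto)
  have pos: "0 < g1" "0 < g0" "0 < g2"
    using \<alpha> l u u_less power_strict_mono[OF u_less u, of 2] by (auto simp: g1_def g0_def g2_def)
  \<comment> \<open>The one-motor equations at 1, at -1 and (doubled) at 0. The first two hold by
    construction; among the three only the last one uses the characteristic equation
    \<open>eq\<close>.\<close>
  have E1: "\<alpha> * g0 = (\<alpha> + l - u) * g1" by (simp add: g0_def g1_def power2_eq_square algebra_simps)
  have E2: "\<alpha> * g0 = (\<alpha> + l + u) * g2" by (simp add: g0_def g2_def power2_eq_square algebra_simps)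
  have E3: "\<beta> * (g1 + g2) = 2 * (l + \<beta>) * g0"
  proof -
    have "2 * (l + \<beta>) * g0 = 2 * (l + \<beta>) * (\<alpha> + l)\<^sup>2 - 2 * (u\<^sup>2 * (l + \<beta>))" by (simp add: g0_def algebra_simps)
    also have "\<dots> = \<beta> * (g1 + g2)" unfolding eq by (simp add: g1_def g2_def power2_eq_square algebra_simps)
    finally show ?thesis ..
  qed
  let ?f = "fin_fun (g1 * g1) (g1 * g0) (g1 * g2) (g0 * g0) (g0 * g2) (g2 * g2)"
  show ?thesis
  proof (rule that[of ?f])
    show "0 < ?f s" for s using pos by (cases s) auto
    show "(\<Sum>s'\<in>UNIV. fin_rate \<alpha> \<beta> s s' * ?f s') = (exit_rate (fin_rate \<alpha> \<beta>) s + 2 * l - u * fin_value s) * ?f s" for s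
    proof (cases s)
      case Fin_Plus2
      show ?thesis unfolding Fin_Plus2 exit_fin
        using arg_cong[OF E1, of "\<lambda>z. 2 * z * g1"] by (simp add: sum_fin algebra_simps)
    next
      case Fin_Plus1
      show ?thesis unfolding Fin_Plus1 exit_fin
        using arg_cong[OF E1, of "\<lambda>z. z * g0"] arg_cong[OF E3, of "\<lambda>z. z * g1 / 2"] by (simp add: sum_fin algebra_simps)
    next
      case Fin_Zero_PM
      show ?thesis unfolding Fin_Zero_PM exit_fin
        using arg_cong[OF E1, of "\<lambda>z. z * g2"] arg_cong[OF E2, of "\<lambda>z. z * g1"] by (simp add: sum_fin algebra_simps)
    next
      case Fin_Zero_Zero
      show ?thesis unfolding Fin_Zero_Zero exit_fin
        using arg_cong[OF E3, of "\<lambda>z. z * g0"] by (simp add: sum_fin algebra_simps)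
    next
      case Fin_Minus1
      show ?thesis unfolding Fin_Minus1 exit_fin
        using arg_cong[OF E2, of "\<lambda>z. z * g0"] arg_cong[OF E3, of "\<lambda>z. z * g2 / 2"] by (simp add: sum_fin algebra_simps)
    next
      case Fin_Minus2
      show ?thesis unfolding Fin_Minus2 exit_fin
        using arg_cong[OF E2, of "\<lambda>z. 2 * z * g2"] by (simp add: sum_fin algebra_simps)
    qed
  qed
qed

text \<open>
  One motor has the eigenfunctions \<open>1\<close>, \<open>e1 = (1, 0, -1)\<close> and \<open>e2 = (\<alpha>, -\<beta>, \<alpha>)\<close>; \<open>E1, \<dots>, E5\<close> below
  are the symmetrised products \<open>e1 1, e1 e1, e2 1, e1 e2, e2 e2\<close>.
\<close>

lemma fin_mixes:
  assumes \<alpha>: "0 < \<alpha>" and \<beta>: "0 < \<beta>" and "jump_flow (fin_rate \<alpha> \<beta>) \<phi>"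
  shows "jump_flow.mixes (fin_rate \<alpha> \<beta>) \<phi> \<alpha> (indicator {s})"
proof -
  interpret jump_flow "fin_rate \<alpha> \<beta>" \<phi> by fact
  \<comment> \<open>One motor has the decay rates 0, \<alpha> and \<alpha> + \<beta>. A product
    decays at the sum of the rates of its factors, and \<alpha> is the smallest positive
    sum.\<close>
  define E1 where "E1 = fin_fun 2 1 0 0 (-1) (-2)"
  define E2 where "E2 = fin_fun 1 0 (-1) 0 0 1"
  define E3 where "E3 = fin_fun (2 * \<alpha>) (\<alpha> - \<beta>) (2 * \<alpha>) (- 2 * \<beta>) (\<alpha> - \<beta>) (2 * \<alpha>)"
  define E4 where "E4 = fin_fun (2 * \<alpha>) (- \<beta>) 0 0 \<beta> (- 2 * \<alpha>)"
  define E5 where "E5 = fin_fun (\<alpha> * \<alpha>) (- \<alpha> * \<beta>) (\<alpha> * \<alpha>) (\<beta> * \<beta>) (- \<alpha> * \<beta>) (\<alpha> * \<alpha>)"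
  have m1: "mixes \<alpha> E1"
    by (rule mixes_eigen[where \<Lambda> = \<alpha>], rename_tac s, case_tac s)
       (use \<alpha> in \<open>simp_all add: sum_fin exit_fin E1_def algebra_simps\<close>)
  have m2: "mixes \<alpha> E2"
    by (rule mixes_eigen[where \<Lambda> = "2 * \<alpha>"], rename_tac s, case_tac s)
       (use \<alpha> in \<open>simp_all add: sum_fin exit_fin E2_def algebra_simps\<close>)
  have m3: "mixes \<alpha> E3"
    by (rule mixes_eigen[where \<Lambda> = "\<alpha> + \<beta>"], rename_tac s, case_tac s)
       (use \<alpha> \<beta> in \<open>simp_all add: sum_fin exit_fin E3_def algebra_simps\<close>)
  have m4: "mixes \<alpha> E4"
    by (rule mixes_eigen[where \<Lambda> = "2 * \<alpha> + \<beta>"], rename_tac s, case_tac s)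
       (use \<alpha> \<beta> in \<open>simp_all add: sum_fin exit_fin E4_def algebra_simps\<close>)
  have m5: "mixes \<alpha> E5"
    by (rule mixes_eigen[where \<Lambda> = "2 * \<alpha> + 2 * \<beta>"], rename_tac s, case_tac s)
       (use \<alpha> \<beta> in \<open>simp_all add: sum_fin exit_fin E5_def algebra_simps\<close>)
  \<comment> \<open>In terms of D the one-motor indicators are (\<beta> + e2 + D e1) / (2 D) for 1,
    (\<beta> + e2 - D e1) / (2 D) for -1 and (\<alpha> - e2) / D for 0. The coefficients below come
    from expanding their products, symmetrised over the two motors.\<close>
  define D where "D = \<alpha> + \<beta>"
  have D: "D \<noteq> 0" using \<alpha> \<beta> by (simp add: D_def)
  have comb: "mixes \<alpha> (\<lambda>s. a * (b + (c1 * E1 s + (c2 * E2 s + (c3 * E3 s + (c4 * E4 s + c5 * E5 s))))))" for a b c1 c2 c3 c4 c5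
    by (intro mixes_add mixes_const mixes_scale m1 m2 m3 m4 m5)
  have ind: "(indicator {s} :: fin_state \<Rightarrow> real) = (\<lambda>s'. k / D\<^sup>2 * (b + (c1 * E1 s' + (c2 * E2 s' + (c3 * E3 s' + (c4 * E4 s' + c5 * E5 s'))))))"
    if "\<And>s'. D\<^sup>2 * indicator {s} s' = k * (b + (c1 * E1 s' + (c2 * E2 s' + (c3 * E3 s' + (c4 * E4 s' + c5 * E5 s')))))"
    for s b c1 c2 c3 c4 c5 k
  proof
    fix s'
    show "indicator {s} s' = k / D\<^sup>2 * (b + (c1 * E1 s' + (c2 * E2 s' + (c3 * E3 s' + (c4 * E4 s' + c5 * E5 s')))))"
      using that[of s'] D by (simp add: eq_divide_eq mult.commute)
  qed
  note defs = E1_def E2_def E3_def E4_def E5_def D_def power2_eq_square algebra_simps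
  show ?thesis
  proof (cases s)
    case Fin_Plus2
    show ?thesis unfolding Fin_Plus2
      by (subst ind[of _ "1/4" "\<beta> * \<beta>" "D * \<beta>" "D\<^sup>2" \<beta> D 1];
          (rule comb)?) (rename_tac s', case_tac s'; simp add: defs)
  next
    case Fin_Minus2
    show ?thesis unfolding Fin_Minus2
      by (subst ind[of _ "1/4" "\<beta> * \<beta>" "- D * \<beta>" "D\<^sup>2" \<beta> "- D" 1];
          (rule comb)?) (rename_tac s', case_tac s'; simp add: defs)
  next
    case Fin_Zero_PM
    show ?thesis unfolding Fin_Zero_PM
      by (subst ind[of _ "1/2" "\<beta> * \<beta>" 0 "- D\<^sup>2" \<beta> 0 1];
          (rule comb)?) (rename_tac s', case_tac s'; simp add: defs)
  next
    case Fin_Zero_Zero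
    show ?thesis unfolding Fin_Zero_Zero
      by (subst ind[of _ 1 "\<alpha> * \<alpha>" 0 0 "- \<alpha>" 0 1];
          (rule comb)?) (rename_tac s', case_tac s'; simp add: defs)
  next
    case Fin_Plus1
    show ?thesis unfolding Fin_Plus1
      by (subst ind[of _ "1/2" "2 * \<alpha> * \<beta>" "D * \<alpha>" 0 "\<alpha> - \<beta>" "- D" "-2"];
          (rule comb)?) (rename_tac s', case_tac s'; simp add: defs)
  next
    case Fin_Minus1
    show ?thesis unfolding Fin_Minus1
      by (subst ind[of _ "1/2" "2 * \<alpha> * \<beta>" "- D * \<alpha>" 0 "\<alpha> - \<beta>" D "-2"];
          (rule comb)?) (rename_tac s', case_tac s'; simp add: defs)
  qed
qed

text \<open>After division by l this is the equation c \<theta> = l for the finite tumble, with y in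
  the place of c^2 / v^2. The difference of the two sides is negative at 0 and, its leading
  coefficient 1 - y being positive, nonnegative at a large \<open>R\<close>.\<close>

lemma fin_root:
  assumes \<alpha>: "0 < \<alpha>" and \<beta>: "0 < \<beta>" and y: "0 < y" "y < 1"
  obtains l :: real where "0 < l" "l * (l + \<beta>) = y * ((l + \<alpha>) * (l + \<alpha> + \<beta>))"
proof -
  define h where "h l = l * (l + \<beta>) - y * ((l + \<alpha>) * (l + \<alpha> + \<beta>))" for l
  define R where "R = (2 * \<alpha> + \<beta> + \<alpha> * (\<alpha> + \<beta>)) / (1 - y) + 1"
  have ab: "0 < \<alpha> * (\<alpha> + \<beta>)" using \<alpha> \<beta> by simp
  have R: "1 \<le> R" "(2 * \<alpha> + \<beta> + \<alpha> * (\<alpha> + \<beta>)) \<le> (1 - y) * R"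
  proof -
    have eq: "(1 - y) * R = (2 * \<alpha> + \<beta> + \<alpha> * (\<alpha> + \<beta>)) + (1 - y)"
    proof -
      have "(1 - y) * (X / (1 - y) + 1) = X + (1 - y)" for X using y by (simp add: field_simps)
      then show ?thesis unfolding R_def .
    qed
    show "2 * \<alpha> + \<beta> + \<alpha> * (\<alpha> + \<beta>) \<le> (1 - y) * R" unfolding eq using y by simp
    show "1 \<le> R" using \<alpha> \<beta> y ab by (simp add: R_def)
  qed
  have "h 0 \<le> 0" using \<alpha> \<beta> y by (simp add: h_def)
  moreover have "0 \<le> h R"
  proof -
    have "y * ((R + \<alpha>) * (R + \<alpha> + \<beta>)) = y * (R * R) + y * ((2 * \<alpha> + \<beta>) * R + \<alpha> * (\<alpha> + \<beta>))"
      by (simp add: algebra_simps)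
    also have "y * ((2 * \<alpha> + \<beta>) * R + \<alpha> * (\<alpha> + \<beta>)) \<le> 1 * ((2 * \<alpha> + \<beta>) * R + \<alpha> * (\<alpha> + \<beta>) * R)"
    proof (rule mult_mono)
      show "(2 * \<alpha> + \<beta>) * R + \<alpha> * (\<alpha> + \<beta>) \<le> (2 * \<alpha> + \<beta>) * R + \<alpha> * (\<alpha> + \<beta>) * R"
        using mult_left_mono[of 1 R "\<alpha> * (\<alpha> + \<beta>)"] R(1) ab by simp
    qed (use y \<alpha> \<beta> R(1) in auto)
    also have "\<dots> = (2 * \<alpha> + \<beta> + \<alpha> * (\<alpha> + \<beta>)) * R" by (simp add: algebra_simps)
    also have "\<dots> \<le> ((1 - y) * R) * R" using R by (intro mult_right_mono) auto
    finally have "y * ((R + \<alpha>) * (R + \<alpha> + \<beta>)) \<le> R * R" by (simp add: algebra_simps)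
    moreover have "0 \<le> R * \<beta>" using R \<beta> by simp
    ultimately show ?thesis by (simp add: h_def algebra_simps)
  qed
  moreover have "continuous_on {0..R} h" unfolding h_def by (intro continuous_intros)
  ultimately obtain l where l: "0 \<le> l" "h l = 0"
    using IVT'[of h 0 0 R] R by auto
  have "l \<noteq> 0" using l(2) y \<alpha> \<beta> by (auto simp: h_def)
  with l show ?thesis using that[of l] by (simp add: h_def)
qed

theorem fin_linear_bounds:
  assumes \<alpha>: "0 < \<alpha>" and \<beta>: "0 < \<beta>" and c: "0 < c" and cv: "c < v"
    and \<pi>: "invariant_prob (fin_linear \<alpha> \<beta> v c) \<pi>" and x: "0 \<le> x"
  shows "ereal ((3 - sqrt 5) / 8 * min (\<alpha> * (1 + \<alpha> / \<beta>) * (c\<^sup>2 / v\<^sup>2)) (\<alpha> * (c / v)))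
      \<le> Liminf at_top (\<lambda>t. - (log_ext (tv_dist (fin_linear \<alpha> \<beta> v c t (x, s)) \<pi>) / ereal t))"
    and "Limsup at_top (\<lambda>t. - (log_ext (tv_dist (fin_linear \<alpha> \<beta> v c t (x, s)) \<pi>) / ereal t))
      \<le> ereal (4 * \<alpha> * (1 + \<alpha> / \<beta>) * (c\<^sup>2 / v\<^sup>2))"
proof -
  have v: "0 < v" using c cv by simp
  interpret linear_jump "fin_rate \<alpha> \<beta>" "\<lambda>s. v * fin_value s - 2 * c"
  proof
    show "0 \<le> fin_rate \<alpha> \<beta> s s'" for s s' using \<alpha> \<beta> by (cases s; cases s') auto
    show "0 < exit_rate (fin_rate \<alpha> \<beta>) s" for s using \<alpha> \<beta> by (cases s) (auto simp: exit_fin)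
  qed
  have P: "fin_linear \<alpha> \<beta> v c = TR"
    unfolding fin_linear_def by (intro arg_cong2[where f = transition] ext) (simp_all add: linear_flow_def)
  note \<pi>' = \<pi>[unfolded P]
  have mix: "mixes \<alpha> (indicator {s})" for s
    by (rule fin_mixes[OF \<alpha> \<beta>]) unfold_locales
  define y where "y = c / v"
  have y: "0 < y" "y < 1" using c cv by (auto simp: y_def)
  have y2: "c\<^sup>2 / v\<^sup>2 = y\<^sup>2" by (simp add: y_def power_divide)
  have y2': "0 < y\<^sup>2" "y\<^sup>2 < 1" using y mult_strict_mono[of y 1 y 1] by (auto simp: power2_eq_square)
  define G where "G l = l * (l + \<alpha>) * (l + \<alpha> + \<beta>) / (l + \<beta>)" for l
  have G_pos: "0 < G l" if "0 < l" for l using that \<alpha> \<beta> by (simp add: G_def)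
  have weight: "\<exists>f. (\<forall>s. 0 < f s) \<and> (\<forall>s. (\<Sum>s'\<in>UNIV. fin_rate \<alpha> \<beta> s s' * f s') =
      (exit_rate (fin_rate \<alpha> \<beta>) s + (2 * l - 2 * c * \<theta>) - \<theta> * (v * fin_value s - 2 * c)) * f s)"
    if l: "0 < l" and \<theta>: "0 < \<theta>" and eq: "(v * \<theta>)\<^sup>2 = G l" for l \<theta>
  proof -
    have u: "0 \<le> v * \<theta>" using v \<theta> by simp
    have "(v * \<theta>)\<^sup>2 * (l + \<beta>) = l * (l + \<alpha>) * (l + \<alpha> + \<beta>)"
      unfolding eq G_def using l \<beta> by simp
    from fin_weight[OF \<alpha> \<beta> l u this] obtain f where "\<And>s. 0 < f s"
      "\<And>s. (\<Sum>s'\<in>UNIV. fin_rate \<alpha> \<beta> s s' * f s') = (exit_rate (fin_rate \<alpha> \<beta>) s + 2 * l - v * \<theta> * fin_value s) * f s" by blast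
    then show ?thesis by (intro exI[of _ f]) (simp add: algebra_simps)
  qed
  show "ereal ((3 - sqrt 5) / 8 * min (\<alpha> * (1 + \<alpha> / \<beta>) * (c\<^sup>2 / v\<^sup>2)) (\<alpha> * (c / v)))
      \<le> Liminf at_top (\<lambda>t. - (log_ext (tv_dist (fin_linear \<alpha> \<beta> v c t (x, s)) \<pi>) / ereal t))"
  proof -
    define M where "M = min (\<alpha> * (1 + \<alpha> / \<beta>) * y\<^sup>2) (\<alpha> * y)"
    have M: "0 < M" "M \<le> \<alpha> * (1 + \<alpha> / \<beta>) * y\<^sup>2" "M \<le> \<alpha> * y"
      using \<alpha> \<beta> y by (auto simp: M_def add_pos_pos)
    \<comment> \<open>With a quarter of \<open>M\<close>, c \<theta> exceeds l by at least M / 10,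
      as shown below; this is half of the spectral gap 2 c \<theta> - 2 l that enters the
      rate.\<close>
    define l where "l = M / 4"
    define \<theta> where "\<theta> = sqrt (G l) / v"
    have l: "0 < l" using M by (simp add: l_def)
    have \<theta>: "0 < \<theta>" "(v * \<theta>)\<^sup>2 = G l" using G_pos[OF l] v by (simp_all add: \<theta>_def)
    have key: "4 * M * (l + \<beta>) \<le> 5 * y\<^sup>2 * \<alpha> * (l + \<alpha> + \<beta>)"
    proof -
      have "4 * M * (l + \<beta>) \<le> 5 * y\<^sup>2 * \<alpha> * (\<alpha> + \<beta>)"
      \<comment> \<open>The cases tell which term is the minimum: the quadratic one is at most the
        linear one exactly when (\<alpha> + \<beta>) y \<le> \<beta>.\<close>
      proof (cases "(\<alpha> + \<beta>) * y \<le> \<beta>")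
        case True
        have "\<alpha> * y \<le> (\<alpha> + \<beta>) * y" using y \<beta> by (intro mult_right_mono) auto
        then have "M \<le> \<beta>" using M(3) True order_trans by blast
        then have h: "4 * (l + \<beta>) \<le> 5 * \<beta>" by (simp add: l_def)
        have "M * (4 * (l + \<beta>)) \<le> (\<alpha> * (1 + \<alpha> / \<beta>) * y\<^sup>2) * (5 * \<beta>)"
          by (rule mult_mono[OF M(2) h order_trans[OF less_imp_le[OF M(1)] M(2)]]) (use l \<beta> in simp)
        also have "\<dots> = 5 * y\<^sup>2 * \<alpha> * (\<alpha> + \<beta>)" using \<beta> by (simp add: field_simps)
        finally show ?thesis by (simp add: mult_ac)
      next
        case False
        have "\<alpha> * y \<le> (\<alpha> + \<beta>) * y" using y \<beta> by (intro mult_right_mono) auto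
        then have "M \<le> (\<alpha> + \<beta>) * y" using M(3) order_trans by blast
        then have h: "4 * (l + \<beta>) \<le> 5 * ((\<alpha> + \<beta>) * y)" using False by (simp add: l_def)
        have "M * (4 * (l + \<beta>)) \<le> (\<alpha> * y) * (5 * ((\<alpha> + \<beta>) * y))"
          by (rule mult_mono[OF M(3) h order_trans[OF less_imp_le[OF M(1)] M(3)]]) (use l \<beta> in simp)
        then show ?thesis by (simp add: power2_eq_square mult_ac)
      qed
      also have "\<dots> \<le> 5 * y\<^sup>2 * \<alpha> * (l + \<alpha> + \<beta>)" using \<alpha> l by (intro mult_left_mono) auto
      finally show ?thesis .
    qed
    have "l + M / 10 \<le> c * \<theta>"
    proof (rule power2_le_imp_le)
      have "M\<^sup>2 / 5 * (l + \<beta>) = (4 * M * (l + \<beta>)) * (M / 20)" by (simp add: power2_eq_square)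
      also have "\<dots> \<le> (5 * y\<^sup>2 * \<alpha> * (l + \<alpha> + \<beta>)) * (M / 20)"
        using M(1) by (intro mult_right_mono[OF key]) simp
      also have "M / 20 = l / 5" by (simp add: l_def)
      also have "(5 * y\<^sup>2 * \<alpha> * (l + \<alpha> + \<beta>)) * (l / 5) = y\<^sup>2 * (l * \<alpha> * (l + \<alpha> + \<beta>))" by simp
      also have "\<dots> \<le> y\<^sup>2 * (l * (l + \<alpha>) * (l + \<alpha> + \<beta>))"
        using l \<alpha> \<beta> by (intro mult_left_mono mult_right_mono) auto
      also have "\<dots> = y\<^sup>2 * G l * (l + \<beta>)" using l \<beta> by (simp add: G_def)
      finally have "M\<^sup>2 / 5 \<le> y\<^sup>2 * G l" using l \<beta> by simp
      moreover have "(c * \<theta>)\<^sup>2 = y\<^sup>2 * G l"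
        using v unfolding \<theta>(2)[symmetric] by (simp add: y_def power_mult_distrib power_divide)
      moreover have "(l + M / 10)\<^sup>2 \<le> M\<^sup>2 / 5" by (simp add: l_def power2_eq_square field_simps)
      ultimately show "(l + M / 10)\<^sup>2 \<le> (c * \<theta>)\<^sup>2" by simp
    qed (use c \<theta> in auto)
    then have gap: "M / 5 \<le> 2 * c * \<theta> - 2 * l" by simp
    have gap_pos: "0 < 2 * c * \<theta> - 2 * l" by (rule less_le_trans[OF _ gap]) (use M(1) in simp)
    \<comment> \<open>The constant (3 - sqrt 5) / 8 is about 0.095, so the rate M / 10 is
      enough.\<close>
    have "(11 / 5)\<^sup>2 \<le> (5::real)" by (simp add: power2_eq_square)
    then have "11 / 5 \<le> sqrt 5" by (rule real_le_rsqrt)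
    then have r: "(3 - sqrt 5) / 8 * M \<le> M / 10" using M(1) by (simp add: field_simps)
    from weight[OF l \<theta>] obtain f where f: "\<And>s. 0 < f s" "\<And>s. (\<Sum>s'\<in>UNIV. fin_rate \<alpha> \<beta> s s' * f s') =
      (exit_rate (fin_rate \<alpha> \<beta>) s + (2 * l - 2 * c * \<theta>) - \<theta> * (v * fin_value s - 2 * c)) * f s" by blast
    have "ereal ((3 - sqrt 5) / 8 * M) \<le> Liminf at_top (\<lambda>t. - (log_ext (tv_dist (TR t (x, s)) \<pi>) / ereal t))"
    proof (rule tv_decay[OF \<pi>' mix x \<theta>(1), where f = f and \<rho> = "2 * c * \<theta> - 2 * l"])
      show "0 < 2 * c * \<theta> - 2 * l" by (rule gap_pos)
      have "\<alpha> * y \<le> \<alpha> * 1" using \<alpha> y by (intro mult_left_mono) auto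
      from order_trans[OF M(3) this] have "M / 10 \<le> \<alpha> / 2" using M(1) by simp
      with r show "(3 - sqrt 5) / 8 * M \<le> \<alpha> / 2" by (rule order_trans)
      show "(3 - sqrt 5) / 8 * M \<le> (2 * c * \<theta> - 2 * l) / 2" by (rule order_trans[OF r]) (use gap in simp)
    qed (use f in \<open>simp_all\<close>)
    then show ?thesis unfolding P M_def y2 by (simp add: y_def)
  qed
  show "Limsup at_top (\<lambda>t. - (log_ext (tv_dist (fin_linear \<alpha> \<beta> v c t (x, s)) \<pi>) / ereal t))
      \<le> ereal (4 * \<alpha> * (1 + \<alpha> / \<beta>) * (c\<^sup>2 / v\<^sup>2))"
  proof -
    define B where "B = 4 * \<alpha> * (1 + \<alpha> / \<beta>) * y\<^sup>2"
    have B: "0 < B" using \<alpha> \<beta> y2' by (simp add: B_def add_pos_pos)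
    obtain l where l: "0 < l" "l * (l + \<beta>) = y\<^sup>2 * ((l + \<alpha>) * (l + \<alpha> + \<beta>))"
      by (rule fin_root[OF \<alpha> \<beta> y2'])
    \<comment> \<open>Written through the logarithmic derivative of \<open>G\<close>, so that at the
      root only the sum of reciprocals \<open>\<Sigma>\<close> remains in both conditions on the
      derivative.\<close>
    define g where "g z = G z * (1 / z + 1 / (z + \<alpha>) + 1 / (z + \<alpha> + \<beta>) - 1 / (z + \<beta>))" for z
    have G_deriv: "(G has_real_derivative g z) (at z)" if "0 < z" for z
      unfolding G_def g_def using that \<alpha> \<beta>
      by (auto intro!: derivative_eq_intros simp: divide_simps) (simp add: algebra_simps)?
    have yG: "y\<^sup>2 * G l = l\<^sup>2"
    proof -
      have "y\<^sup>2 * G l * (l + \<beta>) = l * (y\<^sup>2 * ((l + \<alpha>) * (l + \<alpha> + \<beta>)))" using l \<beta> by (simp add: G_def)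
      also have "\<dots> = l\<^sup>2 * (l + \<beta>)" unfolding l(2)[symmetric] by (simp add: power2_eq_square)
      finally show ?thesis using l(1) \<beta> by simp
    qed
    have cG: "c\<^sup>2 * G l = l\<^sup>2 * v\<^sup>2" using yG v by (simp add: y_def power_divide field_simps)
    define p q s where "p = l + \<alpha>" and "q = l + \<alpha> + \<beta>" and "s = l + \<beta>"
    have pos: "0 < p" "0 < q" "0 < s" using l \<alpha> \<beta> by (auto simp: p_def q_def s_def)
    define \<Sigma> where "\<Sigma> = 1 / l + 1 / p + 1 / q - 1 / s"
    have cg: "c\<^sup>2 * g l = l\<^sup>2 * v\<^sup>2 * \<Sigma>"
      unfolding cG[symmetric] g_def \<Sigma>_def p_def q_def s_def by simp
    obtain a b \<theta>1 \<theta>2 where ab: "0 < a" "0 < b" "(v * \<theta>1)\<^sup>2 = G a" "(v * \<theta>2)\<^sup>2 = G b"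
      "0 < \<theta>1" "\<theta>1 < \<theta>2" "0 < 2 * a - 2 * c * \<theta>1" "2 * b - 2 * c * \<theta>2 < B / \<theta>1 * (\<theta>2 - \<theta>1)"
    proof (rule exists_slow_parameters[OF v c l(1) B G_pos _ G_deriv cG])
      show "G y < G z" if "0 < y" "y < z" for y z
      proof -
        have "y * ((y + \<alpha>) * (y + \<alpha> + \<beta>)) * (z + \<beta>) < z * ((z + \<alpha>) * (z + \<alpha> + \<beta>)) * (y + \<beta>)"
        proof -
          have 1: "y * (z + \<beta>) < z * (y + \<beta>)" using that \<beta> by (simp add: algebra_simps)
          have 2: "(y + \<alpha>) * (y + \<alpha> + \<beta>) \<le> (z + \<alpha>) * (z + \<alpha> + \<beta>)" using that \<alpha> \<beta> by (intro mult_mono) auto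
          have "(y * (z + \<beta>)) * ((y + \<alpha>) * (y + \<alpha> + \<beta>)) < (z * (y + \<beta>)) * ((z + \<alpha>) * (z + \<alpha> + \<beta>))"
            using that \<alpha> \<beta> by (intro mult_less_le_imp_less 1 2) auto
          then show ?thesis by (simp add: mult_ac)
        qed
        then show ?thesis using that \<beta> by (simp add: G_def field_simps)
      qed
      \<comment> \<open>The condition that the eigenvalue increases amounts to l \<Sigma> < 2: the
        terms 1 and l / p stay below 2 in total, and l / q does not exceed l / s.\<close>
      have "l / p < 1" using pos \<alpha> by (simp add: p_def)
      moreover have "l / q \<le> l / s" using l \<alpha> \<beta> by (intro divide_left_mono) (auto simp: q_def s_def)
      ultimately have "l * \<Sigma> < 2" using l by (simp add: \<Sigma>_def algebra_simps)
      then have "(l * v\<^sup>2) * (l * \<Sigma>) < (l * v\<^sup>2) * 2" using l v by (intro mult_strict_left_mono) auto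
      then show "c\<^sup>2 * g l < 2 * v\<^sup>2 * l" unfolding cg by (simp add: power2_eq_square mult_ac)
      \<comment> \<open>The slope condition divided by l^2 v^2. Denominators are cleared, and the
        root equation replaces y^2 p q by l s, which removes the speeds altogether.\<close>
      have "4 < (B + 2 * l) * \<Sigma>"
      proof -
        have Bs: "B * (\<beta> * p * q) = 4 * \<alpha> * (\<alpha> + \<beta>) * l * s"
        proof -
          have "B * (\<beta> * p * q) = 4 * \<alpha> * (\<alpha> + \<beta>) * (y\<^sup>2 * (p * q))" using \<beta> by (simp add: B_def field_simps)
          also have "y\<^sup>2 * (p * q) = l * s" using l(2) by (simp add: p_def q_def s_def)
          finally show ?thesis by (simp add: mult_ac)
        qed
        have eqS: "l * p * q * s * \<Sigma> = p * q * s + l * q * s - \<alpha> * l * p"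
        proof -
          have "l * p * q * s * \<Sigma> = p * q * s + l * q * s + l * p * s - l * p * q"
            using l pos by (simp add: \<Sigma>_def field_simps)
          then show ?thesis by (simp add: q_def s_def algebra_simps)
        qed
        have "(l * p * q * s) * (\<beta> * p * q) * ((B + 2 * l) * \<Sigma>) = (B * (\<beta> * p * q) + 2 * l * (\<beta> * p * q)) * (l * p * q * s * \<Sigma>)"
          by (simp add: algebra_simps)
        also have "\<dots> = (B * (\<beta> * p * q) + 2 * l * (\<beta> * p * q)) * (p * q * s + l * q * s - \<alpha> * l * p)"
          unfolding eqS ..
        also have "\<dots> = l * ((4 * \<alpha> * (\<alpha> + \<beta>) * s + 2 * (\<beta> * p * q)) * (p * q * s + l * q * s - \<alpha> * l * p))"
          unfolding Bs by (simp add: algebra_simps)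
        also have "\<dots> > l * (4 * (\<beta> * p * q) * (p * q * s))"
        proof (rule mult_strict_left_mono[OF _ l(1)])
          \<comment> \<open>After this replacement the difference is a polynomial in l, \<alpha>,
            \<beta> with positive coefficients only.\<close>
          have "(4 * \<alpha> * (\<alpha> + \<beta>) * s + 2 * (\<beta> * p * q)) * (p * q * s + l * q * s - \<alpha> * l * p) - 4 * (\<beta> * p * q) * (p * q * s)
            = 8*l^4*\<alpha>^2 + 20*l^3*\<alpha>^2*\<beta> + 8*l^3*\<alpha>^3 + 12*l^2*\<alpha>^3*\<beta> + 30*l^2*\<alpha>^2*\<beta>^2 + 12*l*\<alpha>^3*\<beta>^2 + 18*l*\<alpha>^2*\<beta>^3
              + 2*\<alpha>^4*\<beta>^2 + 4*\<alpha>^3*\<beta>^3 + 4*l^4*\<alpha>*\<beta> + 16*l^3*\<alpha>*\<beta>^2 + 18*l^2*\<alpha>*\<beta>^3 + 6*l*\<alpha>*\<beta>^4 + 2*\<alpha>^2*\<beta>^4"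
            unfolding p_def q_def s_def by algebra
          moreover have "0 < \<dots>" using l \<alpha> \<beta> by (intro add_pos_pos mult_pos_pos zero_less_power) auto
          ultimately show "4 * (\<beta> * p * q) * (p * q * s) < (4 * \<alpha> * (\<alpha> + \<beta>) * s + 2 * (\<beta> * p * q)) * (p * q * s + l * q * s - \<alpha> * l * p)"
            by linarith
        qed
        finally have "(l * p * q * s) * (\<beta> * p * q) * 4 < (l * p * q * s) * (\<beta> * p * q) * ((B + 2 * l) * \<Sigma>)"
          by (simp add: mult_ac)
        then show ?thesis using l pos \<beta> by (subst (asm) mult_less_cancel_left_pos) auto
      qed
      then have "(l\<^sup>2 * v\<^sup>2) * 4 < (l\<^sup>2 * v\<^sup>2) * ((B + 2 * l) * \<Sigma>)" using l v by (intro mult_strict_left_mono) auto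
      then show "4 * l\<^sup>2 * v\<^sup>2 < (B + 2 * l) * (c\<^sup>2 * g l)" unfolding cg by (simp add: mult_ac)
    qed auto
    have \<theta>2: "0 < \<theta>2" using ab by simp
    from weight[OF ab(1,5,3)] obtain f1 where f1: "\<And>s. 0 < f1 s" "\<And>s. (\<Sum>s'\<in>UNIV. fin_rate \<alpha> \<beta> s s' * f1 s') =
      (exit_rate (fin_rate \<alpha> \<beta>) s + (2 * a - 2 * c * \<theta>1) - \<theta>1 * (v * fin_value s - 2 * c)) * f1 s" by blast
    from weight[OF ab(2) \<theta>2 ab(4)] obtain f2 where f2: "\<And>s. 0 < f2 s" "\<And>s. (\<Sum>s'\<in>UNIV. fin_rate \<alpha> \<beta> s s' * f2 s') =
      (exit_rate (fin_rate \<alpha> \<beta>) s + (2 * b - 2 * c * \<theta>2) - \<theta>2 * (v * fin_value s - 2 * c)) * f2 s" by blast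
    \<comment> \<open>The state is quantified anew, since \<open>s\<close> now denotes l +
      \<beta>.\<close>
    have "Limsup at_top (\<lambda>t. - (log_ext (tv_dist (TR t (x, s)) \<pi>) / ereal t)) \<le> ereal (\<theta>1 * (B / \<theta>1))" for s
      by (rule tv_slow[OF \<pi>' x ab(5,6), where ?f1.0 = f1 and ?f2.0 = f2, OF f1(1) f2(1) ab(7) _ ab(8) f1(2)]) (use B ab(5) f2(2) in auto)
    then show ?thesis unfolding P using ab(5) by (simp add: B_def y2)
  qed
qed

subsection \<open>The instantaneous harmonic process\<close>

text \<open>\<open>a s\<close> is the rest point of the flow in state s; it may be negative.
  \<open>A\<close> is a common upper bound, and above it every flow line descends.\<close>

locale relaxing_jump =
  fixes q :: "'s::finite \<Rightarrow> 's \<Rightarrow> real" and a :: "'s \<Rightarrow> real" and \<kappa> A :: real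
  assumes q_nonneg': "0 \<le> q s s'" and exit_pos': "0 < exit_rate q s" and \<kappa>: "0 < \<kappa>"
    and A: "a s \<le> A" "0 \<le> A"
begin

definition flow :: "'s \<Rightarrow> real \<Rightarrow> real \<Rightarrow> real" where
  "flow s t x = a s + exp (- \<kappa> * t) * (x - a s)"

lemma exp_le_1: "0 \<le> t \<Longrightarrow> exp (- \<kappa> * t) \<le> 1"
  using \<kappa> by simp

lemma exp_shift: "exp (- \<kappa> * r) * (exp (\<kappa> * t) * y) = exp (\<kappa> * (t - r)) * y"
proof -
  have "exp (- \<kappa> * r) * exp (\<kappa> * t) = exp (\<kappa> * (t - r))" by (simp add: mult_exp_exp right_diff_distrib)
  then show ?thesis by (simp only: mult.assoc[symmetric])
qed

lemma exp_shift': "exp (- \<kappa> * (t - r)) * (exp (- \<kappa> * r) * y) = exp (- \<kappa> * t) * y"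
proof -
  have "exp (- \<kappa> * (t - r)) * exp (- \<kappa> * r) = exp (- \<kappa> * t)" by (simp add: mult_exp_exp right_diff_distrib)
  then show ?thesis by (simp only: mult.assoc[symmetric])
qed

sublocale jump_flow q flow
proof
  show "max 0 (flow s t (max 0 (flow s r x))) = max 0 (flow s (r + t) x)" if "0 \<le> x" "0 \<le> r" "0 \<le> t" for s x r t
  proof -
    have add: "flow s t (flow s r x) = flow s (r + t) x" by (simp add: flow_def distrib_left mult_exp_exp mult.assoc[symmetric] add.commute)
    define e where "e = exp (- \<kappa> * t)"
    have e: "0 < e" "e \<le> 1" using exp_le_1[OF that(3)] by (auto simp: e_def)
    show ?thesis
    proof (cases "0 \<le> flow s r x")
      case True
      then show ?thesis by (simp add: add[symmetric])
    next
      \<comment> \<open>From x \<ge> 0 the flow can only become negative if its rest point is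
        negative; it then stays negative, and both sides of the equation are 0.\<close>
      case False
      define h where "h = exp (- \<kappa> * r)"
      have h: "0 < h" "h \<le> 1" using exp_le_1[OF that(2)] by (auto simp: h_def)
      have "(1 - h) * a s + h * x < 0" using False by (simp add: flow_def h_def algebra_simps)
      moreover have "0 \<le> h * x" using h that by simp
      ultimately have "(1 - h) * a s < 0" by linarith
      then have a0: "a s < 0" using h by (auto simp: mult_less_0_iff)
      have "flow s t y \<le> 0" if "y \<le> 0" for y
      proof -
        have "(1 - e) * a s \<le> 0" "e * y \<le> 0" using e a0 that by (auto intro: mult_nonneg_nonpos)
        moreover have "flow s t y = (1 - e) * a s + e * y" by (simp add: flow_def e_def algebra_simps)
        ultimately show ?thesis by linarith
      qed
      from this[of 0] this[of "flow s r x"] show ?thesis using False by (simp add: add)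
    qed
  qed
qed (use q_nonneg' exit_pos' in \<open>auto simp: flow_def\<close>)

section \<open>Contraction of the flow and bounded support of the invariant measure\<close>

lemma \<Phi>_eq: "\<Phi> s t x = max 0 (flow s t x)"
  by (simp add: \<Phi>_def)

lemma \<Phi>_le:
  assumes "0 \<le> r" "x \<le> A + y" "0 \<le> y"
  shows "\<Phi> s r x \<le> A + exp (- \<kappa> * r) * y"
proof -
  define e where "e = exp (- \<kappa> * r)"
  have e: "0 < e" "e \<le> 1" using exp_le_1[OF assms(1)] by (auto simp: e_def)
  have "(1 - e) * a s \<le> (1 - e) * A" "e * x \<le> e * (A + y)" using e A assms by (auto intro: mult_left_mono)
  then have "a s + e * (x - a s) \<le> A + e * y" by (simp add: algebra_simps)
  then show ?thesis using A e assms unfolding \<Phi>_eq flow_def e_def[symmetric] by simp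
qed

lemma \<Phi>_contraction: "\<bar>\<Phi> s r x - \<Phi> s r y\<bar> \<le> exp (- \<kappa> * r) * \<bar>x - y\<bar>"
proof -
  have "\<bar>\<Phi> s r x - \<Phi> s r y\<bar> \<le> \<bar>flow s r x - flow s r y\<bar>" unfolding \<Phi>_eq by auto
  also have "\<dots> = exp (- \<kappa> * r) * \<bar>x - y\<bar>" by (simp add: flow_def abs_mult right_diff_distrib[symmetric])
  finally show ?thesis .
qed

text \<open>The excess over \<open>A\<close> shrinks by exp (- \<kappa> r) along every flow line and
  is unaffected by jumps. This is deterministic; the null set is obtained by comparison with the
  zero function on the positions that are low enough for the remaining time.\<close>

lemma stays_below:
  assumes t: "0 \<le> t" and x: "0 \<le> x" "x \<le> A + exp (\<kappa> * t) * y" and y: "0 \<le> y"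
  shows "emeasure (TR t (x, s)) {z\<in>space E_space. A + y < fst z} = 0"
proof -
  let ?S = "{z\<in>space E_space. A + y < fst (z :: real \<times> 's)}"
  have S: "?S \<in> sets E_space" by measurable
  have "(\<integral>\<^sup>+z. indicator ?S z \<partial>TR t (x, s)) \<le> 0"
  proof (rule comparison_TR_le[where V = "\<lambda>_ _ _. 0" and D = "\<lambda>t. {x. 0 \<le> x \<and> x \<le> A + exp (\<kappa> * t) * y}" and B = 1])
    show "\<Phi> s r x \<in> {x. 0 \<le> x \<and> x \<le> A + exp (\<kappa> * (t - r)) * y}"
      if "x \<in> {x. 0 \<le> x \<and> x \<le> A + exp (\<kappa> * t) * y}" "0 \<le> r" for t x s r
    proof -
      have "\<Phi> s r x \<le> A + exp (- \<kappa> * r) * (exp (\<kappa> * t) * y)" using that y by (intro \<Phi>_le) auto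
      also have "\<dots> = A + exp (\<kappa> * (t - r)) * y" by (simp only: exp_shift)
      finally show ?thesis by simp
    qed
    show "(\<integral>\<^sup>+z. (if t < fst z then indicator ?S (\<Phi> s t x, s) else 0) \<partial>H s) \<le> 0"
      if t: "0 \<le> t" and x: "x \<in> {x. 0 \<le> x \<and> x \<le> A + exp (\<kappa> * t) * y}" for t x s
    proof -
      have "\<Phi> s t x \<le> A + exp (- \<kappa> * t) * (exp (\<kappa> * t) * y)" using x y t by (intro \<Phi>_le) auto
      also have "\<dots> = A + y" by (simp add: exp_minus field_simps)
      finally show ?thesis by (simp cong: if_cong)
    qed
  qed (use S t x in \<open>auto simp: indicator_def\<close>)
  then show ?thesis using S by simp
qed

text \<open>Within the time n / \<kappa> an excess of at most n shrinks to at most 1, since exp n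
  \<ge> n. By invariance the mass above A + 1 is therefore at most the mass above A + n, which tends
  to 0.\<close>

lemma invariant_support:
  assumes \<pi>: "invariant_prob TR \<pi>"
  shows "emeasure \<pi> {z\<in>space E_space. A + 1 < fst z} = 0"
proof -
  interpret \<pi>: prob_space \<pi> by (rule invariant_D(1)[OF \<pi>])
  let ?S = "\<lambda>y. {z\<in>space E_space. A + y < fst (z :: real \<times> 's)}"
  have S: "?S y \<in> sets E_space" for y by measurable
  have S\<pi>: "?S y \<in> sets \<pi>" for y using S by (simp add: invariant_D(2)[OF \<pi>])
  have le: "emeasure \<pi> (?S 1) \<le> emeasure \<pi> (?S (real n))" for n
  proof -
    define t where "t = real n / \<kappa>"
    have t: "0 \<le> t" "real n \<le> exp (\<kappa> * t)" using \<kappa> order_trans[OF _ exp_ge_add_one_self[of "real n"]] by (auto simp: t_def)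
    have "emeasure \<pi> (?S 1) = (\<integral>\<^sup>+z. indicator (?S 1) z \<partial>\<pi>)" using S\<pi> by simp
    also have "\<dots> = (\<integral>\<^sup>+z. \<integral>\<^sup>+z'. indicator (?S 1) z' \<partial>TR t z \<partial>\<pi>)"
      by (rule nn_integral_invariant[OF \<pi> t(1), symmetric]) (rule borel_measurable_indicator[OF S])
    also have "\<dots> \<le> (\<integral>\<^sup>+z. indicator (?S (real n)) z \<partial>\<pi>)"
    proof (rule nn_integral_mono)
      fix z assume z: "z \<in> space \<pi>"
      then have z': "z \<in> space E_space" "0 \<le> fst z" by (auto simp: invariant_D(3)[OF \<pi>] space_E)
      show "(\<integral>\<^sup>+z'. indicator (?S 1) z' \<partial>TR t z) \<le> indicator (?S (real n)) z"
      proof (cases "A + real n < fst z")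
        case True
        have "(\<integral>\<^sup>+z'. indicator (?S 1) z' \<partial>TR t z) \<le> 1" by (rule nn_integral_TR_le) (simp add: indicator_def)
        then show ?thesis using True z' by simp
      next
        case False
        then have "fst z \<le> A + exp (\<kappa> * t) * 1" using t(2) by simp
        from stays_below[OF t(1) z'(2) this, of "snd z"] show ?thesis using S by simp
      qed
    qed
    also have "\<dots> = emeasure \<pi> (?S (real n))" using S\<pi> by simp
    finally show ?thesis .
  qed
  have "(\<lambda>n. emeasure \<pi> (?S (real n))) \<longlonglongrightarrow> emeasure \<pi> (\<Inter>n. ?S (real n))"
    by (rule Lim_emeasure_decseq) (use S\<pi> in \<open>auto simp: decseq_def\<close>)
  moreover have "(\<Inter>n. ?S (real n)) = {}"
  proof -
    have "\<exists>n. fst z \<le> A + real n" for z :: "real \<times> 's"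
      using real_arch_simple[of "fst z - A"] by (auto simp: algebra_simps)
    then show ?thesis by (auto simp: set_eq_iff not_less[symmetric])
  qed
  ultimately have "(\<lambda>n. emeasure \<pi> (?S (real n))) \<longlonglongrightarrow> 0" by simp
  from LIMSEQ_le_const[OF this, of "emeasure \<pi> (?S 1)"] le show ?thesis by auto
qed

text \<open>Reflection at 0 does not increase distances, so synchronous copies with equal states
  approach each other along almost every path. Zero is a supersolution on the pairs that are close
  enough for the remaining time.\<close>

lemma synchronous_contraction:
  assumes t: "0 \<le> t" and p: "0 \<le> fst p" "0 \<le> snd p" "exp (- \<kappa> * t) * \<bar>fst p - snd p\<bar> \<le> \<delta>"
  shows "joint_mean t p s (indicator {u\<in>space (E_space \<Otimes>\<^sub>M E_space). \<delta> < \<bar>fst (fst u) - fst (snd u)\<bar> \<or> snd (fst u) \<noteq> snd (snd u)}) = 0"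
proof -
  let ?S = "{u\<in>space (E_space \<Otimes>\<^sub>M E_space). \<delta> < \<bar>fst (fst u) - fst (snd u)\<bar> \<or> snd (fst u) \<noteq> snd (snd u :: real \<times> 's)}"
  have G: "(indicator ?S :: _ \<Rightarrow> ennreal) \<in> borel_measurable (E_space \<Otimes>\<^sub>M E_space)"
    by (rule borel_measurable_indicator) measurable
  let ?\<Theta> = "\<lambda>s r p. (\<Phi> s r (fst p), \<Phi> s r (snd p))"
  let ?D = "\<lambda>t. {p. 0 \<le> fst p \<and> 0 \<le> snd p \<and> exp (- \<kappa> * t) * \<bar>fst p - snd p\<bar> \<le> \<delta>}"
  have "joint_mean t p s (indicator ?S) \<le> 0"
  proof (rule comparison[where \<Theta> = ?\<Theta> and D = ?D and B = 1 and V = "\<lambda>_ _ _. 0" and U = "\<lambda>t p s. joint_mean t p s (indicator ?S)"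
        and g = "\<lambda>p s. indicator ?S ((fst p, s), (snd p, s))"])
    show "?\<Theta> s r p \<in> ?D (t - r)" if "p \<in> ?D t" "0 \<le> r" for t p s r
    proof -
      have "exp (- \<kappa> * (t - r)) * \<bar>\<Phi> s r (fst p) - \<Phi> s r (snd p)\<bar> \<le> exp (- \<kappa> * (t - r)) * (exp (- \<kappa> * r) * \<bar>fst p - snd p\<bar>)"
        by (intro mult_left_mono \<Phi>_contraction) simp
      also have "\<dots> = exp (- \<kappa> * t) * \<bar>fst p - snd p\<bar>"
        by (rule exp_shift')
      finally show ?thesis using that by auto
    qed
    show "joint_mean t p s (indicator ?S) \<le> (\<integral>\<^sup>+z. (if t < fst z then indicator ?S ((fst (?\<Theta> s t p), s), (snd (?\<Theta> s t p), s))
        else joint_mean (t - fst z) (?\<Theta> s (fst z) p) (snd z) (indicator ?S)) \<partial>H s)"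
      if "0 \<le> t" for t p s
      by (subst renewal[OF G that]) (simp cong: if_cong)
    show "joint_mean t p s (indicator ?S) \<le> ennreal 1" for t p s
    proof -
      have "joint_mean t p s (indicator ?S) \<le> (\<integral>\<^sup>+w. 1 \<partial>N)" unfolding joint_mean_def by (intro nn_integral_mono) (simp add: indicator_def)
      then show ?thesis by (simp add: N.emeasure_space_1[simplified])
    qed
    show "(\<integral>\<^sup>+z. (if t < fst z then indicator ?S ((fst (?\<Theta> s t p), s), (snd (?\<Theta> s t p), s)) else 0) \<partial>H s) \<le> 0"
      if "0 \<le> t" "p \<in> ?D t" for t p s
    proof -
      have "\<bar>\<Phi> s t (fst p) - \<Phi> s t (snd p)\<bar> \<le> \<delta>"
        using \<Phi>_contraction[of s t "fst p" "snd p"] that by auto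
      then show ?thesis by (simp cong: if_cong)
    qed
  qed (use t p in auto)
  then show ?thesis by simp
qed

text \<open>If the states agree at t / 2, the distance of the positions at t is at most C exp (-
  \<kappa> t / 2); otherwise it is at most the common bound \<open>C\<close> of both supports. The
  failure probability enters the p-th moment linearly, and the p-th root turns \<gamma> / 2 into
  \<gamma> / (2 p).\<close>

theorem wasserstein_decay:
  assumes \<pi>: "invariant_prob TR \<pi>" and mix: "\<And>s. mixes \<gamma> (indicator {s})" and x: "0 \<le> x"
    and p: "1 \<le> p" and r: "0 \<le> r" "r \<le> \<kappa> / 2" "r \<le> \<gamma> / (2 * p)"
  shows "ereal r \<le> Liminf at_top (\<lambda>t. - (log_ext (wasserstein p (TR t (x, s)) \<pi>) / ereal t))"
proof -
  obtain K where K: "0 \<le> K" "\<forall>t\<ge>0. \<forall>u\<ge>0. \<exists>\<Gamma>\<in>couplings (TR t (x, s)) \<pi>.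
    emeasure \<Gamma> {p\<in>space \<Gamma>. snd (fst p) \<noteq> snd (snd p)} \<le> ennreal (K * exp (- \<gamma> * t)) \<and>
    push u \<Gamma> \<in> couplings (TR (t + u) (x, s)) \<pi>"
    using coupling_invariant[OF \<pi> mix x, where s = s] by blast
  \<comment> \<open>Covers both laws: \<pi> lives below A + 1, and the process started at x never
    exceeds A + (x + 1), up to null sets.\<close>
  define C where "C = A + (x + 1)"
  have C: "0 < C" using A x by (simp add: C_def)
  let ?far = "{z\<in>space E_space. C < fst (z :: real \<times> 's)}"
  have far: "?far \<in> sets E_space" by measurable
  have far_TR: "emeasure (TR t (x, s)) ?far = 0" if "0 \<le> t" for t
  proof -
    define y where "y = exp (\<kappa> * t) * (x + 1)"
    have "1 * (x + 1) \<le> y" unfolding y_def using x that \<kappa> by (intro mult_right_mono) auto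
    then have "x \<le> y" by simp
    then have "x \<le> A + y" by (rule add_increasing[OF A(2)])
    then have "x \<le> A + exp (\<kappa> * t) * (x + 1)" unfolding y_def .
    from stays_below[OF that x this] x show ?thesis by (simp add: C_def)
  qed
  have far_\<pi>: "emeasure \<pi> ?far = 0"
  proof -
    have "emeasure \<pi> ?far \<le> emeasure \<pi> {z\<in>space E_space. A + 1 < fst (z :: real \<times> 's)}"
    proof (rule emeasure_mono)
      show "{z\<in>space E_space. A + 1 < fst (z :: real \<times> 's)} \<in> sets \<pi>"
        unfolding invariant_D(2)[OF \<pi>] by measurable
    qed (use x in \<open>auto simp: C_def\<close>)
    then show ?thesis by (simp add: invariant_support[OF \<pi>])
  qed
  have close: "AE u in \<Gamma>. 0 \<le> fst (fst u) \<and> fst (fst u) \<le> C \<and> 0 \<le> fst (snd u) \<and> fst (snd u) \<le> C"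
    if \<Gamma>: "\<Gamma> \<in> couplings (TR t (x, s)) \<pi>" and t: "0 \<le> t" for \<Gamma> t
  proof -
    have f: "fst \<in> \<Gamma> \<rightarrow>\<^sub>M TR t (x, s)" and g: "snd \<in> \<Gamma> \<rightarrow>\<^sub>M \<pi>"
      using measurable_fst[of "TR t (x, s)" \<pi>] measurable_snd[of "TR t (x, s)" \<pi>]
        measurable_cong_sets[OF couplings_D(2)[OF \<Gamma>] refl] by blast+
    have sp: "space \<pi> = space E_space" using invariant_D(3)[OF \<pi>] by (simp add: space_E)
    have "AE z in TR t (x, s). 0 \<le> fst z \<and> fst z \<le> C"
      by (rule AE_I[OF _ far_TR[OF t]]) (use far in \<open>auto simp: space_E\<close>)
    then have "AE z in distr \<Gamma> (TR t (x, s)) fst. 0 \<le> fst z \<and> fst z \<le> C"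
      unfolding couplings_D(4)[OF \<Gamma>] .
    from AE_distrD[OF f this] have 1: "AE u in \<Gamma>. 0 \<le> fst (fst u) \<and> fst (fst u) \<le> C" .
    have "AE z in \<pi>. 0 \<le> fst z \<and> fst z \<le> C"
      by (rule AE_I[OF _ far_\<pi>]) (use far in \<open>auto simp: space_E sp invariant_D(2)[OF \<pi>]\<close>)
    then have "AE z in distr \<Gamma> \<pi> snd. 0 \<le> fst z \<and> fst z \<le> C"
      unfolding couplings_D(5)[OF \<Gamma>] .
    from AE_distrD[OF g this] have 2: "AE u in \<Gamma>. 0 \<le> fst (snd u) \<and> fst (snd u) \<le> C" .
    from 1 2 show ?thesis by eventually_elim auto
  qed
  define C' where "C' = (C powr p * (1 + K)) powr (1 / p) + K"
  have "wasserstein p (TR t (x, s)) \<pi> \<le> C' * (1 + t) * exp (- r * t)" if t: "0 \<le> t" for t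
  proof -
    define u where "u = t / 2"
    have u: "0 \<le> u" "t = u + u" using t by (auto simp: u_def)
    obtain \<Gamma> where \<Gamma>: "\<Gamma> \<in> couplings (TR u (x, s)) \<pi>"
      "emeasure \<Gamma> {p\<in>space \<Gamma>. snd (fst p) \<noteq> snd (snd p)} \<le> ennreal (K * exp (- \<gamma> * u))"
      "push u \<Gamma> \<in> couplings (TR t (x, s)) \<pi>"
      using K(2)[rule_format, OF u(1) u(1)] unfolding u(2)[symmetric] by blast
    let ?\<Delta> = "push u \<Gamma>"
    interpret \<Delta>: prob_space ?\<Delta> by (rule couplings_D(1)[OF \<Gamma>(3)])
    have s\<Gamma>: "sets \<Gamma> = sets (E_space \<Otimes>\<^sub>M E_space)"
      unfolding couplings_D(2)[OF \<Gamma>(1)] by (rule sets_pair_measure_cong[OF sets_TR invariant_D(2)[OF \<pi>]])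
    have sp\<Gamma>: "space \<Gamma> = space (E_space \<Otimes>\<^sub>M E_space)" by (rule sets_eq_imp_space_eq[OF s\<Gamma>])
    have sp\<Delta>: "space ?\<Delta> = space (E_space \<Otimes>\<^sub>M E_space)" by (rule sets_eq_imp_space_eq[OF sets_push])
    define \<delta> where "\<delta> = exp (- \<kappa> * u) * C"
    let ?S = "{v\<in>space (E_space \<Otimes>\<^sub>M E_space). \<delta> < \<bar>fst (fst v) - fst (snd v)\<bar> \<or> snd (fst v) \<noteq> snd (snd v :: real \<times> 's)}"
    let ?T = "{v\<in>space \<Gamma>. snd (fst v) \<noteq> snd (snd v)}"
    have S: "?S \<in> sets (E_space \<Otimes>\<^sub>M E_space)" by measurable
    have T: "?T \<in> sets \<Gamma>" unfolding s\<Gamma> sp\<Gamma> by measurable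
    have "emeasure ?\<Delta> ?S = (\<integral>\<^sup>+v. indicator ?S v \<partial>?\<Delta>)" using S by simp
    also have "\<dots> = (\<integral>\<^sup>+v. \<integral>\<^sup>+w. indicator ?S (process flow (fst v) u w, process flow (snd v) u w) \<partial>N \<partial>\<Gamma>)"
      by (rule nn_integral_push[OF s\<Gamma> borel_measurable_indicator[OF S]])
    also have "\<dots> \<le> (\<integral>\<^sup>+v. indicator ?T v \<partial>\<Gamma>)"
    proof (rule nn_integral_mono_AE, use close[OF \<Gamma>(1) u(1)] AE_space in eventually_elim)
      case (elim v)
      obtain y1 s1 y2 s2 where v: "v = ((y1, s1), (y2, s2))" by (metis surj_pair)
      show "(\<integral>\<^sup>+w. indicator ?S (process flow (fst v) u w, process flow (snd v) u w) \<partial>N) \<le> indicator ?T v"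
      proof (cases "s1 = s2")
        case True
        have "\<bar>y1 - y2\<bar> \<le> C" using elim by (auto simp: v)
        then have "exp (- \<kappa> * u) * \<bar>fst (y1, y2) - snd (y1, y2)\<bar> \<le> \<delta>" by (simp add: \<delta>_def)
        from synchronous_contraction[OF u(1) _ _ this, of s1]
        have "joint_mean u (y1, y2) s1 (indicator ?S) = 0" using elim by (simp add: v)
        then show ?thesis by (simp add: v True joint_mean_def)
      next
        case False
        have "(\<integral>\<^sup>+w. indicator ?S (process flow (fst v) u w, process flow (snd v) u w) \<partial>N) \<le> (\<integral>\<^sup>+w. 1 \<partial>N)"
          by (intro nn_integral_mono) (simp add: indicator_def)
        also have "\<dots> = indicator ?T v" using False elim by (simp add: v N.emeasure_space_1[simplified])
        finally show ?thesis .
      qed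
    qed
    also have "\<dots> = emeasure \<Gamma> ?T" using T by simp
    also have "\<dots> \<le> ennreal (K * exp (- \<gamma> * u))" by (rule \<Gamma>(2))
    finally have "emeasure ?\<Delta> ?S \<le> ennreal (K * exp (- \<gamma> * u))" .
    then have mS: "measure ?\<Delta> ?S \<le> K * exp (- \<gamma> * u)" using K(1) by (simp add: \<Delta>.emeasure_eq_measure)
    have rp: "r * p * t \<le> \<gamma> * u"
    proof -
      have "r * (2 * p) \<le> \<gamma>" using r(3) p by (simp add: field_simps)
      then have "r * (2 * p) * u \<le> \<gamma> * u" using u(1) by (rule mult_right_mono)
      then show ?thesis by (simp add: u_def mult_ac)
    qed
    have rk: "r * t \<le> \<kappa> * u" using mult_right_mono[OF r(2) t] by (simp add: u_def)
    \<comment> \<open>Without the p-th root the failure probability decays at the better rate r p;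
      as r \<ge> 0 and p \<ge> 1, this also serves the second term of the distance.\<close>
    have rr: "r * t \<le> r * p * t" using mult_left_mono[OF p, of "r * t"] r t by (simp add: mult_ac)
    have mS': "measure ?\<Delta> ?S \<le> K * exp (- (r * p * t))"
      by (rule order_trans[OF mS]) (use rp K in \<open>auto intro: mult_left_mono\<close>)
    let ?f = "\<lambda>v. \<bar>fst (fst v) - fst (snd v)\<bar> powr p"
    have fm: "?f \<in> borel_measurable ?\<Delta>"
    proof -
      have "?f \<in> borel_measurable ((E_space :: (real \<times> 's) measure) \<Otimes>\<^sub>M E_space)" by measurable
      then show ?thesis by (simp add: measurable_cong_sets[OF sets_push refl])
    qed
    note close\<Delta> = close[OF \<Gamma>(3) t]
    have int: "integrable ?\<Delta> ?f"
    proof (rule \<Delta>.integrable_const_bound[OF _ fm, of "C powr p"])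
      show "AE v in ?\<Delta>. norm (?f v) \<le> C powr p"
        using close\<Delta> by eventually_elim (use p in \<open>auto intro!: powr_mono2\<close>)
    qed
    have S\<Delta>: "?S \<in> sets ?\<Delta>" using S by simp
    have "(\<integral>v. ?f v \<partial>?\<Delta>) \<le> (\<integral>v. \<delta> powr p + C powr p * indicator ?S v \<partial>?\<Delta>)"
    proof (rule integral_mono_AE[OF int])
      show "integrable ?\<Delta> (\<lambda>v. \<delta> powr p + C powr p * indicator ?S v)"
        using S\<Delta> by (intro Bochner_Integration.integrable_add integrable_mult_right) (auto simp: \<Delta>.emeasure_eq_measure)
      show "AE v in ?\<Delta>. ?f v \<le> \<delta> powr p + C powr p * indicator ?S v"
        using close\<Delta> AE_space
      proof eventually_elim
        case (elim v)
        show ?case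
        proof (cases "v \<in> ?S")
          case True
          have "?f v \<le> C powr p" using elim p by (intro powr_mono2) auto
          then show ?thesis using True by (simp add: add_increasing)
        next
          case False
          then have "\<bar>fst (fst v) - fst (snd v)\<bar> \<le> \<delta>" using elim by (auto simp: sp\<Delta>)
          then have "?f v \<le> \<delta> powr p" using p by (intro powr_mono2) auto
          then show ?thesis using False by simp
        qed
      qed
    qed
    also have "\<dots> = \<delta> powr p + C powr p * measure ?\<Delta> ?S"
    proof -
      have "?S \<inter> space ?\<Delta> = ?S" by (auto simp: sp\<Delta>)
      then show ?thesis
        using S\<Delta> \<Delta>.prob_space by (subst Bochner_Integration.integral_add) (auto simp: \<Delta>.emeasure_eq_measure)
    qed
    also have "\<dots> \<le> C powr p * exp (- (r * p * t)) + C powr p * (K * exp (- (r * p * t)))"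
    proof (intro add_mono mult_left_mono mS')
      have "\<delta> powr p = exp (- \<kappa> * u * p) * C powr p"
        using C by (simp add: \<delta>_def powr_mult exp_powr_real)
      moreover have "r * t * p \<le> \<kappa> * u * p" using rk p by (intro mult_right_mono) auto
      ultimately show "\<delta> powr p \<le> C powr p * exp (- (r * p * t))" by (auto simp: mult_ac intro!: mult_left_mono)
    qed simp
    also have "\<dots> = (C powr p * (1 + K)) * exp (- (r * p * t))" by (simp add: algebra_simps)
    finally have I: "(\<integral>v. ?f v \<partial>?\<Delta>) \<le> (C powr p * (1 + K)) * exp (- (r * p * t))" .
    have "(\<integral>v. ?f v \<partial>?\<Delta>) powr (1 / p) \<le> ((C powr p * (1 + K)) * exp (- (r * p * t))) powr (1 / p)"
      using I p by (intro powr_mono2) (auto intro: integral_nonneg_AE)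
    also have "\<dots> = (C powr p * (1 + K)) powr (1 / p) * exp (- r * t)"
      using K(1) p by (subst powr_mult) (auto simp: exp_powr_real)
    finally have W1: "(\<integral>v. ?f v \<partial>?\<Delta>) powr (1 / p) \<le> (C powr p * (1 + K)) powr (1 / p) * exp (- r * t)" .
    have W2: "measure ?\<Delta> {v\<in>space ?\<Delta>. snd (fst v) \<noteq> snd (snd v)} \<le> K * exp (- r * t)"
    proof -
      have "measure ?\<Delta> {v\<in>space ?\<Delta>. snd (fst v) \<noteq> snd (snd v)} \<le> measure ?\<Delta> ?S"
        by (rule \<Delta>.finite_measure_mono[OF _ S\<Delta>]) (auto simp: sp\<Delta>)
      also note mS'
      also have "K * exp (- (r * p * t)) \<le> K * exp (- r * t)" using K(1) rr by (intro mult_left_mono) auto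
      finally show ?thesis .
    qed
    have "wasserstein p (TR t (x, s)) \<pi> \<le> (\<integral>v. ?f v \<partial>?\<Delta>) powr (1 / p) + measure ?\<Delta> {v\<in>space ?\<Delta>. snd (fst v) \<noteq> snd (snd v)}"
      unfolding wasserstein_def
    proof (rule cINF_lower)
      show "bdd_below ((\<lambda>\<Gamma>. (\<integral>v. ?f v \<partial>\<Gamma>) powr (1 / p) + measure \<Gamma> {v\<in>space \<Gamma>. snd (fst v) \<noteq> snd (snd v)}) `
          {\<Gamma> \<in> couplings (TR t (x, s)) \<pi>. integrable \<Gamma> ?f})"
        by (intro bdd_belowI[of _ 0]) (auto intro: add_nonneg_nonneg)
      show "?\<Delta> \<in> {\<Gamma> \<in> couplings (TR t (x, s)) \<pi>. integrable \<Gamma> ?f}" using \<Gamma>(3) int by simp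
    qed
    also have "\<dots> \<le> C' * exp (- r * t)" using W1 W2 by (simp add: C'_def algebra_simps)
    also have "\<dots> \<le> (C' * (1 + t)) * exp (- r * t)"
    proof (rule mult_right_mono)
      have "0 \<le> C'" using K(1) by (simp add: C'_def)
      from mult_left_mono[of 1 "1 + t", OF _ this] t show "C' \<le> C' * (1 + t)" by simp
    qed simp
    finally show ?thesis .
  qed
  then show ?thesis
    by (intro decay_rate_ge[of _ C'] eventually_at_top_linorderI[of 0])
qed

end

text \<open>Here \<kappa> = 2 \<mu> and \<gamma> = 2 \<omega>, so \<kappa> / 2 and \<gamma> / (2 p)
  are the two terms of the minimum; v / \<mu> is the rest point of the state with value 2.\<close>

theorem inst_harmonic_bound:
  assumes \<omega>: "0 < \<omega>" and \<mu>: "0 < \<mu>" and v: "0 < v" and \<pi>: "invariant_prob (inst_harmonic \<omega> v \<mu>) \<pi>"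
    and p: "1 \<le> p" and x: "0 \<le> x"
  shows "ereal (min \<mu> (\<omega> / p))
    \<le> Liminf at_top (\<lambda>t. - (log_ext (wasserstein p (inst_harmonic \<omega> v \<mu> t (x, s)) \<pi>) / ereal t))"
proof -
  interpret relaxing_jump "inst_rate \<omega>" "\<lambda>s. v * inst_value s / (2 * \<mu>)" "2 * \<mu>" "v / \<mu>"
  proof
    show "0 \<le> inst_rate \<omega> s s'" for s s' using \<omega> by (cases "(\<omega>, s, s')" rule: inst_rate.cases) auto
    show "0 < exit_rate (inst_rate \<omega>) s" for s using \<omega> by (simp add: exit_inst)
    show "v * inst_value s / (2 * \<mu>) \<le> v / \<mu>" for s using v \<mu> by (cases s) (auto simp: field_simps)
  qed (use v \<mu> in auto)
  have P: "inst_harmonic \<omega> v \<mu> = TR"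
    unfolding inst_harmonic_def by (intro arg_cong2[where f = transition] ext) (simp_all add: harmonic_flow_def flow_def)
  have mix: "mixes (2 * \<omega>) (indicator {s})" for s
    by (rule inst_mixes[OF \<omega>]) unfold_locales
  show ?thesis unfolding P
    by (rule wasserstein_decay[OF \<pi>[unfolded P] mix x p]) (use \<omega> \<mu> p in auto)
qed

subsection \<open>Convergence rates of the three processes\<close>

theorem theorem5:
  shows
    "(\<forall>\<omega> v c \<pi>. 0 < \<omega> \<and> 0 < c \<and> c < v \<and> invariant_prob (inst_linear \<omega> v c) \<pi> \<longrightarrow>
       (\<forall>x\<ge>0. \<forall>s.
          let r = (\<lambda>t::real. - (log_ext (tv_dist (inst_linear \<omega> v c t (x, s)) \<pi>) / ereal t))
          in ereal (1 / 2 * \<omega> * (c\<^sup>2 / v\<^sup>2)) \<le> Liminf at_top r \<and>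
             Liminf at_top r \<le> Limsup at_top r \<and>
             Limsup at_top r \<le> ereal (4 * \<omega> * (c\<^sup>2 / v\<^sup>2))))
   \<and> (\<forall>\<alpha> \<beta> v c \<pi>. 0 < \<alpha> \<and> 0 < \<beta> \<and> 0 < c \<and> c < v \<and> invariant_prob (fin_linear \<alpha> \<beta> v c) \<pi> \<longrightarrow>
       (\<forall>x\<ge>0. \<forall>s.
          let r = (\<lambda>t::real. - (log_ext (tv_dist (fin_linear \<alpha> \<beta> v c t (x, s)) \<pi>) / ereal t))
          in ereal ((3 - sqrt 5) / 8 * min (\<alpha> * (1 + \<alpha> / \<beta>) * (c\<^sup>2 / v\<^sup>2)) (\<alpha> * (c / v)))
               \<le> Liminf at_top r \<and>
             Liminf at_top r \<le> Limsup at_top r \<and>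
             Limsup at_top r \<le> ereal (4 * \<alpha> * (1 + \<alpha> / \<beta>) * (c\<^sup>2 / v\<^sup>2))))
   \<and> (\<forall>\<omega> \<mu> v \<pi>. 0 < \<omega> \<and> 0 < \<mu> \<and> 0 < v \<and> invariant_prob (inst_harmonic \<omega> v \<mu>) \<pi> \<longrightarrow>
       (\<forall>p\<ge>1. \<forall>x\<ge>0. \<forall>s.
          ereal (min \<mu> (\<omega> / p))
            \<le> Liminf at_top (\<lambda>t::real.
                 - (log_ext (wasserstein p (inst_harmonic \<omega> v \<mu> t (x, s)) \<pi>) / ereal t))))"
proof (intro conjI allI impI)
  fix \<omega> v c x :: real and \<pi> s
  assume "0 < \<omega> \<and> 0 < c \<and> c < v \<and> invariant_prob (inst_linear \<omega> v c) \<pi>" "0 \<le> x"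
  then show "let r = (\<lambda>t::real. - (log_ext (tv_dist (inst_linear \<omega> v c t (x, s)) \<pi>) / ereal t))
      in ereal (1 / 2 * \<omega> * (c\<^sup>2 / v\<^sup>2)) \<le> Liminf at_top r \<and> Liminf at_top r \<le> Limsup at_top r \<and>
         Limsup at_top r \<le> ereal (4 * \<omega> * (c\<^sup>2 / v\<^sup>2))"
    unfolding Let_def by (intro conjI inst_linear_bounds Liminf_le_Limsup) auto
next
  fix \<alpha> \<beta> v c x :: real and \<pi> s
  assume "0 < \<alpha> \<and> 0 < \<beta> \<and> 0 < c \<and> c < v \<and> invariant_prob (fin_linear \<alpha> \<beta> v c) \<pi>" "0 \<le> x"
  then show "let r = (\<lambda>t::real. - (log_ext (tv_dist (fin_linear \<alpha> \<beta> v c t (x, s)) \<pi>) / ereal t))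
      in ereal ((3 - sqrt 5) / 8 * min (\<alpha> * (1 + \<alpha> / \<beta>) * (c\<^sup>2 / v\<^sup>2)) (\<alpha> * (c / v))) \<le> Liminf at_top r \<and>
         Liminf at_top r \<le> Limsup at_top r \<and>
         Limsup at_top r \<le> ereal (4 * \<alpha> * (1 + \<alpha> / \<beta>) * (c\<^sup>2 / v\<^sup>2))"
    unfolding Let_def by (intro conjI fin_linear_bounds Liminf_le_Limsup) auto
next
  fix \<omega> \<mu> v p x :: real and \<pi> s
  assume "0 < \<omega> \<and> 0 < \<mu> \<and> 0 < v \<and> invariant_prob (inst_harmonic \<omega> v \<mu>) \<pi>" "1 \<le> p" "0 \<le> x"
  then show "ereal (min \<mu> (\<omega> / p)) \<le>
      Liminf at_top (\<lambda>t::real. - (log_ext (wasserstein p (inst_harmonic \<omega> v \<mu> t (x, s)) \<pi>) / ereal t))"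
    by (intro inst_harmonic_bound) auto
qed

end
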